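(* Let $n\geq 1$ and let $\|\cdot\|$ be a Euclidean norm on $\mathrm{LT}^0(n)$. The Riemannian operations of the log-Euclidean-Cholesky metric on $\mathrm{Cor}^+(n)$ associated to this norm are, for all $C,C',C_1,\dots,C_k\in\mathrm{Cor}^+(n)$ ($k\geq1$), $X\in T_C\mathrm{Cor}^+(n)\simeq\mathrm{Hol}(n)$, $t\in\mathbb{R}$: - (Exponential map) $\mathrm{Exp}_C(tX)=\Theta^{-1}\circ\exp\big(\log(\Theta(C))+t\,d_C(\log\circ\,\Theta)(X)\big)$; - (Logarithm map) $\mathrm{Log}_C(C')=(d_C(\log\circ\,\Theta))^{-1}\big(\log(\Theta(C'))-\log(\Theta(C))\big)$; - (Geodesic from $C$ at $t=0$ to $C'$ at $t=1$) $\gamma_{C\to C'}(t)=\Theta^{-1}\circ\exp\big((1-t)\log(\Theta(C))+t\,\log(\Theta(C'))\big)$; - (Distance) $d(C,C')=\|\log(\Theta(C'))-\log(\Theta(C))\|$; - (Parallel transport) $\Pi_{C\to C'}X=(d_{C'}(\log\circ\,\Theta))^{-1}\big(d_C(\log\circ\,\Theta)(X)\big)$; - (Curvature) null; - (Fréchet mean of $C_1,\dots,C_k$) $\bar C=\Theta^{-1}\circ\exp\big(\frac1k\sum_{i=1}^k\log(\Theta(C_i))\big)$; where $d_C(\log\circ\,\Theta)(X)=d_{\Theta(C)}\log(d_C\Theta(X))$. The log-Euclidean-Cholesky metrics are geodesically complete.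
   Context: $\mathrm{Cor}^+(n)$ is the manifold of real symmetric positive definite $n\times n$ matrices with unit diagonal; $\mathrm{Hol}(n)$ is the space of symmetric matrices with zero diagonal. $\mathrm{LT}^0(n)$ is the vector space of strictly lower triangular matrices and $\mathrm{LT}^1(n)=I_n+\mathrm{LT}^0(n)$. $\mathrm{Diag}(M)$ is the diagonal matrix with the same diagonal as $M$. $\mathrm{Chol}(C)$ is the unique lower triangular matrix $L$ with positive diagonal such that $C=LL^\top$. The map $\Theta:\mathrm{Cor}^+(n)\to\mathrm{LT}^1(n)$, $\Theta(C)=\mathrm{Diag}(\mathrm{Chol}(C))^{-1}\mathrm{Chol}(C)$, is a diffeomorphism with inverse $\Gamma\mapsto\mathrm{Diag}(\Gamma\Gamma^\top)^{-1/2}\,\Gamma\Gamma^\top\,\mathrm{Diag}(\Gamma\Gamma^\top)^{-1/2}$. The matrix exponential $\exp:\mathrm{LT}^0(n)\to\mathrm{LT}^1(n)$, $\exp(\xi)=\sum_{k=0}^{n-1}\frac{1}{k!}\xi^k$, is a diffeomorphism with inverse $\log(Z)=\sum_{k=1}^{n-1}\frac{(-1)^{k-1}}{k}(Z-I_n)^k$. Differentials are denoted $d$. The log-Euclidean-Cholesky metric associated to a Euclidean norm $\|\cdot\|$ on $\mathrm{LT}^0(n)$ (norm coming from an inner product) is the pullback by $\log\circ\,\Theta:\mathrm{Cor}^+(n)\to\mathrm{LT}^0(n)$ of that inner product, i.e. $g_C(X,X)=\|d_C(\log\circ\,\Theta)(X)\|^2$. A Fréchet mean of $C_1,\dots,C_k$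 is a minimizer of $C\mapsto\sum_{i=1}^kd(C,C_i)^2$; it is unique here. *)

theory Defs
  imports "HOL-Analysis.Analysis"
begin

section \<open>Riemannian geometry of open subsets of affine subspaces\<close>

text \<open>
  A manifold is given here as a relatively open subset \<open>M\<close> of an affine subspace with
  direction \<open>V\<close>; every tangent space of \<open>M\<close> is then identified with \<open>V\<close>.
  For \<open>p \<in> M\<close> the derivative of a differentiable map at \<open>p\<close> within \<open>M\<close> is uniquely
  determined on \<open>V\<close> only, and it is only ever applied to elements of \<open>V\<close>.
\<close>

definition affine_domain :: "'a::euclidean_space set \<Rightarrow> 'a set \<Rightarrow> bool" where
  "affine_domain M V \<longleftrightarrow>
     subspace V \<and> (\<exists>a. openin (top_of_set ((\<lambda>v. a + v) ` V)) M)"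

primrec Ck_on :: "nat \<Rightarrow> 'a::euclidean_space set \<Rightarrow> 'a set \<Rightarrow> ('a \<Rightarrow> 'b::euclidean_space) \<Rightarrow> bool" where
  "Ck_on 0 M V f \<longleftrightarrow> continuous_on M f"
| "Ck_on (Suc k) M V f \<longleftrightarrow>
     (\<forall>p\<in>M. f differentiable (at p within M)) \<and>
     (\<forall>v\<in>V. Ck_on k M V (\<lambda>p. frechet_derivative f (at p within M) v))"

definition smooth_on :: "'a::euclidean_space set \<Rightarrow> 'a set \<Rightarrow> ('a \<Rightarrow> 'b::euclidean_space) \<Rightarrow> bool" where
  "smooth_on M V f \<longleftrightarrow> (\<forall>k. Ck_on k M V f)"

definition vector_field :: "'a::euclidean_space set \<Rightarrow> 'a set \<Rightarrow> ('a \<Rightarrow> 'a) \<Rightarrow> bool" where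
  "vector_field M V X \<longleftrightarrow> X ` M \<subseteq> V \<and> smooth_on M V X"

definition bilinear_on :: "'a::real_vector set \<Rightarrow> ('a \<Rightarrow> 'a \<Rightarrow> 'b::real_vector) \<Rightarrow> bool" where
  "bilinear_on V B \<longleftrightarrow>
     (\<forall>x\<in>V. \<forall>y\<in>V. \<forall>z\<in>V. B (x + y) z = B x z + B y z \<and> B z (x + y) = B z x + B z y) \<and>
     (\<forall>c. \<forall>x\<in>V. \<forall>y\<in>V. B (c *\<^sub>R x) y = c *\<^sub>R B x y \<and> B x (c *\<^sub>R y) = c *\<^sub>R B x y)"

definition inner_product_on :: "'a::real_vector set \<Rightarrow> ('a \<Rightarrow> 'a \<Rightarrow> real) \<Rightarrow> bool" where
  "inner_product_on V b \<longleftrightarrow>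
     bilinear_on V b \<and> (\<forall>x\<in>V. \<forall>y\<in>V. b x y = b y x) \<and> (\<forall>x\<in>V. x \<noteq> 0 \<longrightarrow> 0 < b x x)"

definition riemannian_metric ::
  "'a::euclidean_space set \<Rightarrow> 'a set \<Rightarrow> ('a \<Rightarrow> 'a \<Rightarrow> 'a \<Rightarrow> real) \<Rightarrow> bool" where
  "riemannian_metric M V g \<longleftrightarrow>
     affine_domain M V \<and> (\<forall>p\<in>M. inner_product_on V (g p)) \<and>
     (\<forall>X\<in>V. \<forall>Y\<in>V. smooth_on M V (\<lambda>p. g p X Y))"

text \<open>
  Since \<open>M\<close> has a global affine chart, every affine connection on \<open>M\<close> is
  \<open>(\<nabla>\<^sub>X Y)(p) = dY\<^sub>p(X(p)) + \<Gamma>\<^sub>p(X(p), Y(p))\<close> for a unique smooth field \<open>\<Gamma>\<close> of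
  bilinear maps \<open>V \<times> V \<rightarrow> V\<close>. A connection is represented by this \<open>\<Gamma>\<close>.
\<close>

definition connection :: "'a::euclidean_space set \<Rightarrow> 'a set \<Rightarrow> ('a \<Rightarrow> 'a \<Rightarrow> 'a \<Rightarrow> 'a) \<Rightarrow> bool" where
  "connection M V \<Gamma> \<longleftrightarrow>
     (\<forall>p\<in>M. bilinear_on V (\<Gamma> p) \<and> (\<forall>X\<in>V. \<forall>Y\<in>V. \<Gamma> p X Y \<in> V)) \<and>
     (\<forall>X\<in>V. \<forall>Y\<in>V. smooth_on M V (\<lambda>p. \<Gamma> p X Y))"

definition cov_deriv ::
  "'a::euclidean_space set \<Rightarrow> ('a \<Rightarrow> 'a \<Rightarrow> 'a \<Rightarrow> 'a) \<Rightarrow> ('a \<Rightarrow> 'a) \<Rightarrow> ('a \<Rightarrow> 'a) \<Rightarrow> 'a \<Rightarrow> 'a" where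
  "cov_deriv M \<Gamma> X Y = (\<lambda>p. frechet_derivative Y (at p within M) (X p) + \<Gamma> p (X p) (Y p))"

definition lie_bracket :: "'a::euclidean_space set \<Rightarrow> ('a \<Rightarrow> 'a) \<Rightarrow> ('a \<Rightarrow> 'a) \<Rightarrow> 'a \<Rightarrow> 'a" where
  "lie_bracket M X Y =
     (\<lambda>p. frechet_derivative Y (at p within M) (X p) - frechet_derivative X (at p within M) (Y p))"

definition is_levi_civita ::
  "'a::euclidean_space set \<Rightarrow> 'a set \<Rightarrow> ('a \<Rightarrow> 'a \<Rightarrow> 'a \<Rightarrow> real) \<Rightarrow> ('a \<Rightarrow> 'a \<Rightarrow> 'a \<Rightarrow> 'a) \<Rightarrow> bool" where
  "is_levi_civita M V g \<Gamma> \<longleftrightarrow>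
     connection M V \<Gamma> \<and>
     (\<forall>X Y. vector_field M V X \<longrightarrow> vector_field M V Y \<longrightarrow>
        (\<forall>p\<in>M. cov_deriv M \<Gamma> X Y p - cov_deriv M \<Gamma> Y X p = lie_bracket M X Y p)) \<and>
     (\<forall>X Y Z. vector_field M V X \<longrightarrow> vector_field M V Y \<longrightarrow> vector_field M V Z \<longrightarrow>
        (\<forall>p\<in>M. frechet_derivative (\<lambda>q. g q (Y q) (Z q)) (at p within M) (X p) =
           g p (cov_deriv M \<Gamma> X Y p) (Z p) + g p (Y p) (cov_deriv M \<Gamma> X Z p)))"

text \<open>The choice is unique in its values \<open>\<Gamma> p X Y\<close> with \<open>p \<in> M\<close> and \<open>X, Y \<in> V\<close>.\<close>

definition levi_civita ::
  "'a::euclidean_space set \<Rightarrow> 'a set \<Rightarrow> ('a \<Rightarrow> 'a \<Rightarrow> 'a \<Rightarrow> real) \<Rightarrow> 'a \<Rightarrow> 'a \<Rightarrow> 'a \<Rightarrow> 'a" where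
  "levi_civita M V g = (SOME \<Gamma>. is_levi_civita M V g \<Gamma>)"

definition curvature ::
  "'a::euclidean_space set \<Rightarrow> 'a set \<Rightarrow> ('a \<Rightarrow> 'a \<Rightarrow> 'a \<Rightarrow> real) \<Rightarrow>
     ('a \<Rightarrow> 'a) \<Rightarrow> ('a \<Rightarrow> 'a) \<Rightarrow> ('a \<Rightarrow> 'a) \<Rightarrow> 'a \<Rightarrow> 'a" where
  "curvature M V g X Y Z =
     (let D = cov_deriv M (levi_civita M V g)
      in (\<lambda>p. D X (D Y Z) p - D Y (D X Z) p - D (lie_bracket M X Y) Z p))"

definition parallel_along ::
  "'a::euclidean_space set \<Rightarrow> ('a \<Rightarrow> 'a \<Rightarrow> 'a \<Rightarrow> 'a) \<Rightarrow> real set \<Rightarrow> (real \<Rightarrow> 'a) \<Rightarrow> (real \<Rightarrow> 'a) \<Rightarrow> bool" where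
  "parallel_along V \<Gamma> I \<gamma> W \<longleftrightarrow>
     W ` I \<subseteq> V \<and>
     (\<exists>\<gamma>' W'. \<forall>t\<in>I. (\<gamma> has_vector_derivative \<gamma>' t) (at t within I) \<and>
                     (W has_vector_derivative W' t) (at t within I) \<and>
                     W' t + \<Gamma> (\<gamma> t) (\<gamma>' t) (W t) = 0)"

definition geodesic_on ::
  "'a::euclidean_space set \<Rightarrow> 'a set \<Rightarrow> ('a \<Rightarrow> 'a \<Rightarrow> 'a \<Rightarrow> real) \<Rightarrow> real set \<Rightarrow> (real \<Rightarrow> 'a) \<Rightarrow> bool" where
  "geodesic_on M V g I \<gamma> \<longleftrightarrow>
     is_interval I \<and> interior I \<noteq> {} \<and> \<gamma> ` I \<subseteq> M \<and>
     (\<exists>v. (\<forall>t\<in>I. (\<gamma> has_vector_derivative v t) (at t within I)) \<and>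
          parallel_along V (levi_civita M V g) I \<gamma> v)"

definition riem_exp ::
  "'a::euclidean_space set \<Rightarrow> 'a set \<Rightarrow> ('a \<Rightarrow> 'a \<Rightarrow> 'a \<Rightarrow> real) \<Rightarrow> 'a \<Rightarrow> 'a \<Rightarrow> 'a" where
  "riem_exp M V g p X =
     (THE q. \<exists>\<gamma>. geodesic_on M V g {0..1} \<gamma> \<and> \<gamma> 0 = p \<and>
                 (\<gamma> has_vector_derivative X) (at 0 within {0..1}) \<and> \<gamma> 1 = q)"

text \<open>
  Meaningful when \<open>riem_exp M V g p\<close> is a bijection from \<open>V\<close> onto \<open>M\<close>, i.e. when no
  restriction to an injectivity domain is needed.
\<close>

definition riem_log ::
  "'a::euclidean_space set \<Rightarrow> 'a set \<Rightarrow> ('a \<Rightarrow> 'a \<Rightarrow> 'a \<Rightarrow> real) \<Rightarrow> 'a \<Rightarrow> 'a \<Rightarrow> 'a" where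
  "riem_log M V g p = the_inv_into V (riem_exp M V g p)"

text \<open>
  The predicate \<open>valid_path\<close> imposes no one-sided limits on the velocity at the finitely many
  exceptional parameters, so the speed of such a path need not be integrable. Requiring
  \<open>has_integral\<close> excludes the paths of infinite length (\<open>integral\<close> would return \<open>0\<close> on them).
\<close>

definition riem_dist ::
  "'a::euclidean_space set \<Rightarrow> ('a \<Rightarrow> 'a \<Rightarrow> 'a \<Rightarrow> real) \<Rightarrow> 'a \<Rightarrow> 'a \<Rightarrow> real" where
  "riem_dist M g p q =
     Inf {L. \<exists>\<gamma>. valid_path \<gamma> \<and> path_image \<gamma> \<subseteq> M \<and> pathstart \<gamma> = p \<and> pathfinish \<gamma> = q \<and>
               ((\<lambda>t. let v = vector_derivative \<gamma> (at t) in sqrt (g (\<gamma> t) v v)) has_integral L) {0..1}}"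

text \<open>Parallel transport along the geodesic from \<open>p\<close> to \<open>q\<close>, assumed unique.\<close>

definition parallel_transport ::
  "'a::euclidean_space set \<Rightarrow> 'a set \<Rightarrow> ('a \<Rightarrow> 'a \<Rightarrow> 'a \<Rightarrow> real) \<Rightarrow> 'a \<Rightarrow> 'a \<Rightarrow> 'a \<Rightarrow> 'a" where
  "parallel_transport M V g p q X =
     (THE Y. \<exists>\<gamma> W. geodesic_on M V g {0..1} \<gamma> \<and> \<gamma> 0 = p \<and> \<gamma> 1 = q \<and>
                   parallel_along V (levi_civita M V g) {0..1} \<gamma> W \<and> W 0 = X \<and> W 1 = Y)"

definition frechet_means ::
  "'a::euclidean_space set \<Rightarrow> ('a \<Rightarrow> 'a \<Rightarrow> 'a \<Rightarrow> real) \<Rightarrow> nat \<Rightarrow> (nat \<Rightarrow> 'a) \<Rightarrow> 'a set" where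
  "frechet_means M g k P =
     {C\<in>M. \<forall>C'\<in>M. (\<Sum>i=1..k. (riem_dist M g C (P i))\<^sup>2) \<le> (\<Sum>i=1..k. (riem_dist M g C' (P i))\<^sup>2)}"

definition geodesically_complete ::
  "'a::euclidean_space set \<Rightarrow> 'a set \<Rightarrow> ('a \<Rightarrow> 'a \<Rightarrow> 'a \<Rightarrow> real) \<Rightarrow> bool" where
  "geodesically_complete M V g \<longleftrightarrow>
     (\<forall>p\<in>M. \<forall>X\<in>V. \<exists>\<gamma>. geodesic_on M V g UNIV \<gamma> \<and> \<gamma> 0 = p \<and>
                         (\<gamma> has_vector_derivative X) (at 0))"


section \<open>Correlation matrices and the log-Euclidean-Cholesky metric\<close>

text \<open>
  The index type is an arbitrary finite linear order, of cardinality \<open>n \<ge> 1\<close>; the order on it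
  is the one of the rows and columns.
\<close>

type_synonym 'n sqmat = "((real, 'n) vec, 'n) vec"

definition Cor_plus :: "('n::{finite,linorder} sqmat) set" where
  "Cor_plus = {C. transpose C = C \<and> (\<forall>x. x \<noteq> 0 \<longrightarrow> 0 < x \<bullet> (C *v x)) \<and> (\<forall>i. C $ i $ i = 1)}"

definition Hol :: "('n::{finite,linorder} sqmat) set" where
  "Hol = {X. transpose X = X \<and> (\<forall>i. X $ i $ i = 0)}"

definition LT0 :: "('n::{finite,linorder} sqmat) set" where
  "LT0 = {A. \<forall>i j. i \<le> j \<longrightarrow> A $ i $ j = 0}"

definition LT1 :: "('n::{finite,linorder} sqmat) set" where
  "LT1 = (\<lambda>A. mat 1 + A) ` LT0"

definition Diag :: "'n::{finite,linorder} sqmat \<Rightarrow> 'n sqmat" where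
  "Diag A = (\<chi> i j. if i = j then A $ i $ i else 0)"

definition Chol :: "'n::{finite,linorder} sqmat \<Rightarrow> 'n sqmat" where
  "Chol C = (THE L. (\<forall>i j. i < j \<longrightarrow> L $ i $ j = 0) \<and> (\<forall>i. 0 < L $ i $ i) \<and> C = L ** transpose L)"

definition Theta :: "'n::{finite,linorder} sqmat \<Rightarrow> 'n sqmat" where
  "Theta C = matrix_inv (Diag (Chol C)) ** Chol C"

definition Theta_inv :: "'n::{finite,linorder} sqmat \<Rightarrow> 'n sqmat" where
  "Theta_inv = the_inv_into Cor_plus Theta"

primrec mpow :: "'n::{finite,linorder} sqmat \<Rightarrow> nat \<Rightarrow> 'n sqmat" where
  "mpow A 0 = mat 1"
| "mpow A (Suc k) = A ** mpow A k"

text \<open>On \<open>LT0\<close> and \<open>LT1\<close> respectively the full series terminate after \<open>n\<close> terms.\<close>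

definition mexp :: "'n::{finite,linorder} sqmat \<Rightarrow> 'n sqmat" where
  "mexp A = (\<Sum>k = 0..CARD('n) - 1. (1 / fact k) *\<^sub>R mpow A k)"

definition mlog :: "'n::{finite,linorder} sqmat \<Rightarrow> 'n sqmat" where
  "mlog Z = (\<Sum>k = 1..CARD('n) - 1. ((-1) ^ (k - 1) / real k) *\<^sub>R mpow (Z - mat 1) k)"

definition d_Theta :: "'n::{finite,linorder} sqmat \<Rightarrow> 'n sqmat \<Rightarrow> 'n sqmat" where
  "d_Theta C = frechet_derivative Theta (at C within Cor_plus)"

definition d_mlog :: "'n::{finite,linorder} sqmat \<Rightarrow> 'n sqmat \<Rightarrow> 'n sqmat" where
  "d_mlog Z = frechet_derivative mlog (at Z within LT1)"

definition d_log_Theta :: "'n::{finite,linorder} sqmat \<Rightarrow> 'n sqmat \<Rightarrow> 'n sqmat" where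
  "d_log_Theta C = frechet_derivative (mlog \<circ> Theta) (at C within Cor_plus)"

definition d_log_Theta_inv :: "'n::{finite,linorder} sqmat \<Rightarrow> 'n sqmat \<Rightarrow> 'n sqmat" where
  "d_log_Theta_inv C = the_inv_into Hol (d_log_Theta C)"

definition lec_metric ::
  "('n sqmat \<Rightarrow> 'n sqmat \<Rightarrow> real) \<Rightarrow>
     'n::{finite,linorder} sqmat \<Rightarrow> 'n sqmat \<Rightarrow> 'n sqmat \<Rightarrow> real" where
  "lec_metric ip C X Y = ip (d_log_Theta C X) (d_log_Theta C Y)"

end

theory Submission imports Defs begin

text \<open>
  The map \<open>mlog \<circ> Theta\<close> is a global diffeomorphism onto the vector space \<open>LT0\<close>, and the
  metric is the pullback of a constant inner product. So everything reduces to Euclidean geometry: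
  in this chart \<open>F\<close> with inverse \<open>G\<close>, the Christoffel field is \<open>dG (D(dF \<cdot> Y) X)\<close> (symmetric because
  second derivatives commute), a field is parallel along a curve iff \<open>dF\<close> maps it to a constant,
  geodesics are the images of straight lines, and Cauchy--Schwarz against the chord bounds the
  length of a curve from below.

  That the chart is smooth with smooth inverse rests on two facts. The entries of the Cholesky
  factor are given, column by column, by subtractions, square roots and divisions of positive
  quantities. The truncated series \<open>mexp\<close> and \<open>mlog\<close> are evaluations of formal power series at
  nilpotent matrices, where evaluation is compatible with products and composition.
\<close>

section \<open>Differential calculus on open subsets of affine subspaces\<close>

text \<open>Two objects in the statement are arbitrary choices. \<open>frechet_derivative\<close>
  within \<open>M\<close> is fixed only on \<open>V\<close>, and \<open>levi_civita\<close> only at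
  points of \<open>M\<close> and on vectors of \<open>V\<close>. Hence most facts carry memberships
  in \<open>M\<close>, \<open>V\<close> and \<open>W\<close>, derivatives are shown to land in the
  right direction space before another derivative or an inverse is applied, and the chosen
  connection is compared with the explicit one through the Koszul formula. A second obstacle is that
  \<open>Ck_on\<close> differentiates in fixed directions, while covariant derivatives apply a
  differential to a vector that moves with the point. Expanding that vector in \<open>Basis\<close>
  reduces this case to products of functions already known to be smooth. The inner product is given
  on \<open>LT0\<close> only, and the distance admits paths with unbounded velocity. The former is
  extended by a projection, the latter is handled by a fundamental theorem that tolerates finitely
  many exceptional parameters.\<close>

definition proj_onto :: "'a::euclidean_space set \<Rightarrow> 'a \<Rightarrow> 'a" where
  "proj_onto V = (SOME g. linear g \<and> range g \<subseteq> V \<and> (\<forall>v\<in>V. g v = v))"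

lemma
  assumes "subspace V"
  shows linear_proj_onto: "linear (proj_onto V)"
    and proj_onto_in: "proj_onto V v \<in> V"
    and proj_onto_id: "v \<in> V \<Longrightarrow> proj_onto V v = v"
proof -
  have "\<exists>g. linear g \<and> range g \<subseteq> V \<and> (\<forall>v\<in>V. g v = v)"
    using linear_exists_left_inverse_on[OF linear_id assms] by auto
  then have *: "linear (proj_onto V) \<and> range (proj_onto V) \<subseteq> V \<and> (\<forall>v\<in>V. proj_onto V v = v)"
    unfolding proj_onto_def by (rule someI_ex)
  then show "linear (proj_onto V)" "proj_onto V v \<in> V" "v \<in> V \<Longrightarrow> proj_onto V v = v"
    by auto
qed

text \<open>
  The derivative within \<open>M\<close> is determined on \<open>V\<close> only; precomposing it with a projection onto \<open>V\<close>
  makes it a uniquely determined linear map on the whole space.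
\<close>

definition dder :: "'a::euclidean_space set \<Rightarrow> 'a set \<Rightarrow> ('a \<Rightarrow> 'b::euclidean_space) \<Rightarrow> 'a \<Rightarrow> 'a \<Rightarrow> 'b" where
  "dder M V f p v = frechet_derivative f (at p within M) (proj_onto V v)"

lemma affine_domain_subspace: "affine_domain M V \<Longrightarrow> subspace V"
  by (simp add: affine_domain_def)

lemma affine_domain_diff:
  assumes "affine_domain M V" "p \<in> M" "q \<in> M"
  shows "q - p \<in> V"
proof -
  obtain a where "M \<subseteq> (\<lambda>v. a + v) ` V" and V: "subspace V"
    using assms(1) openin_imp_subset unfolding affine_domain_def by blast
  then obtain v w where "p = a + v" "q = a + w" "v \<in> V" "w \<in> V"
    using assms by blast
  then show ?thesis using V by (simp add: subspace_diff)
qed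

lemma affine_domain_ball:
  assumes "affine_domain M V" "p \<in> M"
  obtains e where "e > 0" "\<And>v. v \<in> V \<Longrightarrow> norm v < e \<Longrightarrow> p + v \<in> M"
proof -
  obtain a T where T: "open T" and M: "M = (\<lambda>v. a + v) ` V \<inter> T" and V: "subspace V"
    using assms(1) unfolding affine_domain_def openin_open by blast
  obtain e where e: "e > 0" "ball p e \<subseteq> T"
    using T M assms(2) open_contains_ball by blast
  have "p + v \<in> M" if "v \<in> V" "norm v < e" for v
  proof -
    have "p + v \<in> ball p e" using that by (simp add: dist_norm)
    moreover obtain w where "p = a + w" "w \<in> V" using M assms(2) by blast
    then have "p + v \<in> (\<lambda>v. a + v) ` V"
      using V that by (auto intro!: image_eqI[where x="w + v"] simp: subspace_add)
    ultimately show ?thesis using M e by blast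
  qed
  then show ?thesis using that e by blast
qed

lemma affine_domain_line_nhds:
  assumes "affine_domain M V" "q + s *\<^sub>R v \<in> M" "v \<in> V"
  shows "\<forall>\<^sub>F r in nhds s. q + r *\<^sub>R v \<in> M"
proof -
  obtain e where e: "e > 0" "\<And>w. w \<in> V \<Longrightarrow> norm w < e \<Longrightarrow> q + s *\<^sub>R v + w \<in> M"
    using affine_domain_ball[OF assms(1,2)] by metis
  have "((\<lambda>r. norm ((r - s) *\<^sub>R v)) \<longlongrightarrow> norm ((s - s) *\<^sub>R v)) (nhds s)"
    by (intro tendsto_intros filterlim_ident)
  then have "\<forall>\<^sub>F r in nhds s. norm ((r - s) *\<^sub>R v) < e"
    using e(1) by (intro order_tendstoD(2)) auto
  then show ?thesis
  proof eventually_elim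
    case (elim r)
    have "(r - s) *\<^sub>R v \<in> V"
      using assms affine_domain_subspace subspace_scale by blast
    from e(2)[OF this elim] show ?case by (simp add: algebra_simps)
  qed
qed

text \<open>Relative openness keeps the line inside \<open>M\<close> near \<open>s\<close>, so a
  derivative within \<open>M\<close> becomes a two-sided derivative in one real variable, where
  uniqueness and the mean value theorem are available.\<close>

lemma has_derivative_line:
  assumes "affine_domain M V" "q + s *\<^sub>R v \<in> M" "v \<in> V"
    and "(f has_derivative f') (at (q + s *\<^sub>R v) within M)"
  shows "((\<lambda>r. f (q + r *\<^sub>R v)) has_vector_derivative f' v) (at s)"
proof -
  obtain T where T: "open T" "s \<in> T" "\<And>r. r \<in> T \<Longrightarrow> q + r *\<^sub>R v \<in> M"
    using affine_domain_line_nhds[OF assms(1-3)] unfolding eventually_nhds by blast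
  have "((\<lambda>r. q + r *\<^sub>R v) has_derivative (\<lambda>r. r *\<^sub>R v)) (at s within T)"
    by (auto intro!: derivative_eq_intros)
  moreover have "(f has_derivative f') (at (q + s *\<^sub>R v) within (\<lambda>r. q + r *\<^sub>R v) ` T)"
    using assms(4) by (rule has_derivative_subset) (use T in auto)
  ultimately have "((\<lambda>r. f (q + r *\<^sub>R v)) has_derivative (\<lambda>r. f' (r *\<^sub>R v))) (at s within T)"
    by (rule has_derivative_in_compose)
  then have "((\<lambda>r. f (q + r *\<^sub>R v)) has_derivative (\<lambda>r. f' (r *\<^sub>R v))) (at s)"
    using T at_within_open by metis
  then show ?thesis
    using has_derivative_linear[OF assms(4)] by (simp add: has_vector_derivative_def linear_cmul)
qed

text \<open>Both candidates give the derivative of \<open>f\<close> along the line through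
  \<open>p\<close> with direction \<open>v\<close>.\<close>

lemma has_derivative_unique_on:
  assumes "affine_domain M V" "p \<in> M" "v \<in> V"
    and "(f has_derivative f1) (at p within M)" "(f has_derivative f2) (at p within M)"
  shows "f1 v = f2 v"
  using has_derivative_line[of M V p 0 v f f1] has_derivative_line[of M V p 0 v f f2] assms
  by (auto intro: vector_derivative_unique_at)

lemma frechet_derivative_within:
  "f differentiable (at p within M) \<Longrightarrow>
    (f has_derivative frechet_derivative f (at p within M)) (at p within M)"
  by (simp add: frechet_derivative_works)

lemma dder_eq:
  assumes "affine_domain M V" "p \<in> M" "(f has_derivative f') (at p within M)"
  shows "dder M V f p v = f' (proj_onto V v)"
  unfolding dder_def
  using has_derivative_unique_on[OF assms(1,2) proj_onto_in[OF affine_domain_subspace[OF assms(1)]]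
     frechet_derivative_within assms(3)] assms(3)
  by (auto simp: differentiable_def)

lemma dder_eq_on:
  assumes "affine_domain M V" "p \<in> M" "(f has_derivative f') (at p within M)" "v \<in> V"
  shows "dder M V f p v = f' v"
  using dder_eq[OF assms(1-3)] assms(4) affine_domain_subspace[OF assms(1)] by (simp add: proj_onto_id)

lemma dder_on: "affine_domain M V \<Longrightarrow> v \<in> V \<Longrightarrow> dder M V f p v = frechet_derivative f (at p within M) v"
  by (simp add: dder_def proj_onto_id affine_domain_subspace)

lemma dder_proj: "affine_domain M V \<Longrightarrow> dder M V f p (proj_onto V v) = dder M V f p v"
  by (simp add: dder_def proj_onto_id proj_onto_in affine_domain_subspace)

lemma has_derivative_dder:
  assumes "affine_domain M V" "p \<in> M" "f differentiable (at p within M)"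
  shows "(f has_derivative dder M V f p) (at p within M)"
proof -
  note V = affine_domain_subspace[OF assms(1)]
  \<comment> \<open>An affine map that fixes \<open>M\<close> pointwise: precomposing
    \<open>f\<close> with it changes nothing on \<open>M\<close> and puts the projection into the
    derivative.\<close>
  let ?g = "\<lambda>q. p + proj_onto V (q - p)"
  have "bounded_linear (proj_onto V)"
    using linear_proj_onto[OF V] linear_conv_bounded_linear by blast
  then have "(proj_onto V has_derivative proj_onto V) F" for F
    by (rule bounded_linear_imp_has_derivative)
  then have "((\<lambda>q. proj_onto V (q - p)) has_derivative proj_onto V) (at p within M)"
    by (rule has_derivative_compose[rotated]) (auto intro!: derivative_eq_intros)
  then have 1: "(?g has_derivative proj_onto V) (at p within M)"
    by (auto intro!: derivative_eq_intros)
  have g: "?g q = q" if "q \<in> M" for q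
    using that affine_domain_diff[OF assms(1,2)] V by (simp add: proj_onto_id)
  then have im: "?g ` M = M" by auto
  have "((\<lambda>q. f (?g q)) has_derivative (\<lambda>v. frechet_derivative f (at p within M) (proj_onto V v))) (at p within M)"
    by (rule has_derivative_in_compose[OF 1])
       (unfold g[OF assms(2)] im, rule frechet_derivative_within[OF assms(3)])
  then have "((\<lambda>q. f (?g q)) has_derivative dder M V f p) (at p within M)"
    by (simp add: dder_def[abs_def])
  then show ?thesis
    by (rule has_derivative_transform[rotated 2]) (use g assms in auto)
qed

text \<open>Smoothness is known for derivatives in constant directions; this expansion reduces a
  direction that varies with the point to those.\<close>

lemma linear_eq_sum_Basis:
  fixes f :: "'a::euclidean_space \<Rightarrow> 'b::real_vector"
  assumes "linear f"
  shows "f x = (\<Sum>b\<in>Basis. (x \<bullet> b) *\<^sub>R f b)"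
proof -
  have "f x = f (\<Sum>b\<in>Basis. (x \<bullet> b) *\<^sub>R b)" by (simp add: euclidean_representation)
  also have "\<dots> = (\<Sum>b\<in>Basis. (x \<bullet> b) *\<^sub>R f b)"
    using assms by (simp add: linear_sum linear_cmul)
  finally show ?thesis .
qed

lemma frechet_derivative_within_cong:
  assumes "p \<in> M" "\<And>q. q \<in> M \<Longrightarrow> f q = g q"
  shows "frechet_derivative f (at p within M) = frechet_derivative g (at p within M)"
proof -
  have "(f has_derivative f') (at p within M) \<longleftrightarrow> (g has_derivative f') (at p within M)" for f'
    using assms has_derivative_transform[of p M f g] has_derivative_transform[of p M g f] by auto
  then show ?thesis unfolding frechet_derivative_def by simp
qed

lemma dder_cong:
  assumes "p \<in> M" "\<And>q. q \<in> M \<Longrightarrow> f q = g q"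
  shows "dder M V f p v = dder M V g p v"
  using frechet_derivative_within_cong[OF assms] by (simp add: dder_def)

section \<open>Closure properties of iterated differentiability\<close>

lemma Ck_on_cong:
  "(\<And>p. p \<in> M \<Longrightarrow> f p = g p) \<Longrightarrow> Ck_on k M V f \<longleftrightarrow> Ck_on k M V g"
proof (induction k arbitrary: f g)
  case 0
  then show ?case by (simp cong: continuous_on_cong)
next
  case (Suc k)
  have "f differentiable (at p within M) \<longleftrightarrow> g differentiable (at p within M)" if "p \<in> M" for p
    using Suc.prems that has_derivative_transform[of p M f g] has_derivative_transform[of p M g f]
    unfolding differentiable_def by metis
  moreover have "Ck_on k M V (\<lambda>p. frechet_derivative f (at p within M) v)
      \<longleftrightarrow> Ck_on k M V (\<lambda>p. frechet_derivative g (at p within M) v)" for v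
    using frechet_derivative_within_cong[of _ M f g] Suc.prems by (intro Suc.IH) metis
  ultimately show ?case by simp
qed

text \<open>The derivative selected by \<open>frechet_derivative\<close> agrees on \<open>V\<close>
  with any explicit one, so the next order can be tested on the formula \<open>f'\<close>.\<close>

lemma Ck_on_SucI:
  assumes "affine_domain M V"
    and f': "\<And>p. p \<in> M \<Longrightarrow> (f has_derivative f' p) (at p within M)"
    and "\<And>v. v \<in> V \<Longrightarrow> Ck_on k M V (\<lambda>p. f' p v)"
  shows "Ck_on (Suc k) M V f"
proof -
  have diff: "f differentiable (at p within M)" if "p \<in> M" for p
    using f'[OF that] by (auto simp: differentiable_def)
  have "frechet_derivative f (at p within M) v = f' p v" if "p \<in> M" "v \<in> V" for p v
    using has_derivative_unique_on[OF assms(1) that frechet_derivative_within[OF diff] f'] that by blast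
  then have "Ck_on k M V (\<lambda>p. frechet_derivative f (at p within M) v)" if "v \<in> V" for v
    using assms(3)[OF that] that by (simp cong: Ck_on_cong)
  then show ?thesis using diff by simp
qed

lemma Ck_on_Suc_dder:
  assumes "affine_domain M V" "Ck_on (Suc k) M V f"
  shows "p \<in> M \<Longrightarrow> (f has_derivative dder M V f p) (at p within M)"
    and "Ck_on k M V (\<lambda>p. dder M V f p v)"
  using assms has_derivative_dder[OF assms(1)] proj_onto_in[OF affine_domain_subspace[OF assms(1)]]
  by (auto simp: dder_def[abs_def])

lemma Ck_on_continuous:
  assumes "affine_domain M V" "Ck_on k M V f"
  shows "continuous_on M f"
  using assms(2) by (cases k) (auto simp: continuous_on_eq_continuous_within differentiable_imp_continuous_within)

lemma Ck_on_Suc_imp: "affine_domain M V \<Longrightarrow> Ck_on (Suc k) M V f \<Longrightarrow> Ck_on k M V f"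
proof (induction k arbitrary: f)
  case 0
  then show ?case using Ck_on_continuous[OF 0(1,2)] by simp
next
  case (Suc k)
  have "Ck_on k M V (\<lambda>p. frechet_derivative f (at p within M) v)" if "v \<in> V" for v
    by (rule Suc.IH[OF Suc.prems(1)]) (use Suc.prems(2) that in auto)
  then show ?case using Suc.prems(2) by auto
qed

lemma Ck_on_const: "affine_domain M V \<Longrightarrow> Ck_on k M V (\<lambda>_. c)"
proof (induction k arbitrary: c)
  case (Suc k)
  then show ?case by (intro Ck_on_SucI[where f'="\<lambda>_ _. 0"]) auto
qed auto

lemma Ck_on_bounded_linear:
  assumes "affine_domain M V" "bounded_linear f"
  shows "Ck_on k M V f"
proof (cases k)
  case 0
  then show ?thesis using assms(2) by (simp add: linear_continuous_on)
next
  case (Suc l)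
  then show ?thesis
    using Ck_on_SucI[OF assms(1), of f "\<lambda>_. f"] assms(2) Ck_on_const[OF assms(1)]
    by (auto simp: bounded_linear_imp_has_derivative)
qed

lemma Ck_on_linear_compose:
  assumes "affine_domain M V" "bounded_linear L"
  shows "Ck_on k M V f \<Longrightarrow> Ck_on k M V (\<lambda>p. L (f p))"
proof (induction k arbitrary: f)
  case 0
  then show ?case using bounded_linear.continuous_on[OF assms(2)] by simp
next
  case (Suc k)
  note d = Ck_on_Suc_dder[OF assms(1) Suc.prems]
  show ?case
    by (rule Ck_on_SucI[OF assms(1) bounded_linear.has_derivative[OF assms(2) d(1)]])
       (use d(2) Suc.IH in auto)
qed

lemma Ck_on_add:
  assumes "affine_domain M V"
  shows "Ck_on k M V f \<Longrightarrow> Ck_on k M V g \<Longrightarrow> Ck_on k M V (\<lambda>p. f p + g p)"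
proof (induction k arbitrary: f g)
  case 0
  then show ?case by (simp add: continuous_on_add)
next
  case (Suc k)
  note d = Ck_on_Suc_dder[OF assms(1) Suc.prems(1)] Ck_on_Suc_dder[OF assms(1) Suc.prems(2)]
  show ?case
    by (rule Ck_on_SucI[OF assms(1) has_derivative_add[OF d(1,3)]])
       (use d(2,4) Suc.IH in auto)
qed

lemma Ck_on_sum:
  assumes "affine_domain M V" "\<And>i. i \<in> I \<Longrightarrow> Ck_on k M V (f i)"
  shows "Ck_on k M V (\<lambda>p. \<Sum>i\<in>I. f i p)"
  using assms(2)
  by (induction I rule: infinite_finite_induct) (simp_all add: Ck_on_const[OF assms(1)] Ck_on_add[OF assms(1)])

lemma Ck_on_bilinear:
  assumes "affine_domain M V" "bounded_bilinear B"
  shows "Ck_on k M V f \<Longrightarrow> Ck_on k M V g \<Longrightarrow> Ck_on k M V (\<lambda>p. B (f p) (g p))"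
proof (induction k arbitrary: f g)
  case 0
  then show ?case using bounded_bilinear.continuous_on[OF assms(2)] by simp
next
  case (Suc k)
  note d = Ck_on_Suc_dder[OF assms(1) Suc.prems(1)] Ck_on_Suc_dder[OF assms(1) Suc.prems(2)]
  \<comment> \<open>The product rule leaves one factor undifferentiated in each term; its regularity
    is lowered by one order to match the induction hypothesis.\<close>
  have "Ck_on k M V f" "Ck_on k M V g"
    using Suc.prems by (auto intro: Ck_on_Suc_imp[OF assms(1)] simp del: Ck_on.simps)
  then show ?case
    by (intro Ck_on_SucI[OF assms(1) bounded_bilinear.FDERIV[OF assms(2) d(1,3)]]
        Ck_on_add[OF assms(1)] Suc.IH d(2,4))
qed

lemma Ck_on_scaleR:
  assumes "affine_domain M V" "Ck_on k M V f" "Ck_on k M V g"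
  shows "Ck_on k M V (\<lambda>p. f p *\<^sub>R g p)"
  using Ck_on_bilinear[OF assms(1) bounded_bilinear_scaleR assms(2,3)] .

lemma Ck_on_mult:
  fixes f g :: "'a::euclidean_space \<Rightarrow> real"
  assumes "affine_domain M V" "Ck_on k M V f" "Ck_on k M V g"
  shows "Ck_on k M V (\<lambda>p. f p * g p)"
  using Ck_on_bilinear[OF assms(1) bounded_bilinear_mult assms(2,3)] .

lemma Ck_on_diff:
  assumes "affine_domain M V" "Ck_on k M V f" "Ck_on k M V g"
  shows "Ck_on k M V (\<lambda>p. f p - g p)"
  using Ck_on_add[OF assms(1,2) Ck_on_linear_compose[OF assms(1) bounded_linear_minus[OF bounded_linear_ident] assms(3)]]
  by simp

lemma Ck_on_componentwise:
  assumes "affine_domain M V" "\<And>b. b \<in> Basis \<Longrightarrow> Ck_on k M V (\<lambda>p. f p \<bullet> b)"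
  shows "Ck_on k M V f"
proof -
  have "Ck_on k M V (\<lambda>p. \<Sum>b\<in>Basis. (f p \<bullet> b) *\<^sub>R b)"
    using assms by (intro Ck_on_sum Ck_on_scaleR Ck_on_const)
  then show ?thesis by (simp add: euclidean_representation)
qed

text \<open>The derivative is a product of the derivative of \<open>f\<close> and copies of the
  inverse itself, so the claim one order lower closes the induction.\<close>

lemma Ck_on_inverse:
  fixes f :: "'a::euclidean_space \<Rightarrow> real"
  assumes "affine_domain M V" "\<And>p. p \<in> M \<Longrightarrow> f p \<noteq> 0"
  shows "Ck_on k M V f \<Longrightarrow> Ck_on k M V (\<lambda>p. inverse (f p))"
proof (induction k)
  case 0
  then show ?case using assms(2) by (simp add: continuous_on_inverse)
next
  case (Suc k)
  note d = Ck_on_Suc_dder[OF assms(1) Suc.prems]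
  have i: "Ck_on k M V (\<lambda>p. inverse (f p))" using Suc Ck_on_Suc_imp[OF assms(1)] by blast
  have *: "((\<lambda>p. inverse (f p)) has_derivative (\<lambda>v. (-1) *\<^sub>R (inverse (f p) * dder M V f p v * inverse (f p)))) (at p within M)"
    if "p \<in> M" for p
    using Deriv.has_derivative_inverse[OF _ d(1)] assms(2) that by auto
  show ?case
    by (rule Ck_on_SucI[OF assms(1) *], assumption)
      (intro Ck_on_scaleR[OF assms(1)] Ck_on_mult[OF assms(1)] Ck_on_const[OF assms(1)] d(2) i)
qed

lemma Ck_on_sqrt:
  fixes f :: "'a::euclidean_space \<Rightarrow> real"
  assumes "affine_domain M V" "\<And>p. p \<in> M \<Longrightarrow> 0 < f p"
  shows "Ck_on k M V f \<Longrightarrow> Ck_on k M V (\<lambda>p. sqrt (f p))"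
proof (induction k)
  case 0
  then show ?case by (simp add: continuous_on_real_sqrt)
next
  case (Suc k)
  note d = Ck_on_Suc_dder[OF assms(1) Suc.prems]
  have i: "Ck_on k M V (\<lambda>p. sqrt (f p))" using Suc Ck_on_Suc_imp[OF assms(1)] by blast
  have "((\<lambda>p. sqrt (f p)) has_derivative (\<lambda>v. (1 / 2) * (inverse (sqrt (f p)) * dder M V f p v))) (at p within M)"
    if "p \<in> M" for p
    using d(1)[OF that] assms(2)[OF that]
    by (auto intro!: derivative_eq_intros simp: field_simps)
  \<comment> \<open>The derivative of the root contains the reciprocal of the root, whose regularity
    follows from the induction hypothesis.\<close>
  moreover have "Ck_on k M V (\<lambda>p. inverse (sqrt (f p)))"
    by (rule Ck_on_inverse[OF assms(1) _ i]) (use assms(2) in force)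
  ultimately show ?case
    by (intro Ck_on_SucI[OF assms(1), where f'="\<lambda>p v. (1 / 2) * (inverse (sqrt (f p)) * dder M V f p v)"]
        Ck_on_mult[OF assms(1)] Ck_on_const[OF assms(1)] d(2))
qed

lemma has_derivative_compose_on:
  assumes "(f has_derivative f') (at p within M)" "(h has_derivative h') (at (f p) within N)"
    and "f ` M \<subseteq> N"
  shows "((\<lambda>q. h (f q)) has_derivative (\<lambda>v. h' (f' v))) (at p within M)"
  by (rule has_derivative_in_compose[OF assms(1) has_derivative_subset[OF assms(2,3)]])

text \<open>The chain rule evaluates the derivative of \<open>h\<close> at \<open>f p\<close> in a
  direction depending on \<open>p\<close>. In basis coordinates only the functions
  \<open>dder N U h (f p) b\<close> remain, and these are compositions again, so \<open>h\<close>
  has to be general in the induction.\<close>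

lemma Ck_on_compose:
  assumes "affine_domain M V" "affine_domain N U" "f ` M \<subseteq> N"
  shows "Ck_on k M V f \<Longrightarrow> Ck_on k N U h \<Longrightarrow> Ck_on k M V (\<lambda>p. h (f p))"
proof (induction k arbitrary: h)
  case 0
  then show ?case using assms(3) continuous_on_compose2[of N h M f] by simp
next
  case (Suc k)
  note d = Ck_on_Suc_dder[OF assms(1) Suc.prems(1)]
  note e = Ck_on_Suc_dder[OF assms(2) Suc.prems(2)]
  have fN: "f p \<in> N" if "p \<in> M" for p using assms(3) that by blast
  have "((\<lambda>p. h (f p)) has_derivative (\<lambda>v. dder N U h (f p) (dder M V f p v))) (at p within M)"
    if "p \<in> M" for p
    by (rule has_derivative_compose_on[OF d(1)[OF that] e(1)[OF fN[OF that]] assms(3)])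
  moreover have "dder N U h (f p) w = (\<Sum>b\<in>Basis. (w \<bullet> b) *\<^sub>R dder N U h (f p) b)" if "p \<in> M" for p w
    by (rule linear_eq_sum_Basis) (use e(1)[OF fN[OF that]] has_derivative_linear in blast)
  ultimately have
    "((\<lambda>p. h (f p)) has_derivative
       (\<lambda>v. \<Sum>b\<in>Basis. (dder M V f p v \<bullet> b) *\<^sub>R dder N U h (f p) b)) (at p within M)"
    if "p \<in> M" for p
    using that by simp
  moreover have "Ck_on k M V (\<lambda>p. dder N U h (f p) b)" for b
    by (rule Suc.IH) (use Suc.prems(1) Ck_on_Suc_imp[OF assms(1)] e(2) in auto)
  ultimately show ?case
    by (intro Ck_on_SucI[OF assms(1)])
      (auto intro!: Ck_on_sum[OF assms(1)] Ck_on_scaleR[OF assms(1)] d(2)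
         Ck_on_linear_compose[OF assms(1) bounded_linear_inner_left])
qed

section \<open>Second derivatives and their symmetry\<close>

lemma smooth_on_dder: "affine_domain M V \<Longrightarrow> smooth_on M V f \<Longrightarrow> smooth_on M V (\<lambda>p. dder M V f p v)"
  unfolding smooth_on_def using Ck_on_Suc_dder(2) by blast

lemma smooth_on_has_derivative:
  "affine_domain M V \<Longrightarrow> smooth_on M V f \<Longrightarrow> p \<in> M \<Longrightarrow> (f has_derivative dder M V f p) (at p within M)"
  unfolding smooth_on_def using Ck_on_Suc_dder(1) by blast

lemma smooth_on_linear_dder:
  "affine_domain M V \<Longrightarrow> smooth_on M V f \<Longrightarrow> p \<in> M \<Longrightarrow> linear (dder M V f p)"
  using smooth_on_has_derivative has_derivative_linear by blast

lemma dder_dder_sum_Basis: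
  assumes "affine_domain M V" "smooth_on M V F" "p \<in> M"
  shows "dder M V (\<lambda>q. dder M V F q y) p x = (\<Sum>b\<in>Basis. (y \<bullet> b) *\<^sub>R dder M V (\<lambda>q. dder M V F q b) p x)"
proof -
  have "((\<lambda>q. \<Sum>b\<in>Basis. (y \<bullet> b) *\<^sub>R dder M V F q b) has_derivative
      (\<lambda>w. \<Sum>b\<in>Basis. (y \<bullet> b) *\<^sub>R dder M V (\<lambda>q. dder M V F q b) p w)) (at p within M)"
    by (intro has_derivative_sum has_derivative_scaleR_right
        smooth_on_has_derivative smooth_on_dder assms)
  then have "((\<lambda>q. dder M V F q y) has_derivative
      (\<lambda>w. \<Sum>b\<in>Basis. (y \<bullet> b) *\<^sub>R dder M V (\<lambda>q. dder M V F q b) p w)) (at p within M)"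
    by (rule has_derivative_transform[rotated 2])
       (use assms linear_eq_sum_Basis[OF smooth_on_linear_dder[OF assms(1,2)], of _ y] in auto)
  from dder_eq[OF assms(1,3) this, of x] show ?thesis by (simp add: dder_proj assms(1))
qed

text \<open>Product rule for a differential applied to a moving vector at a moving point. The second
  summand is what becomes the Christoffel term, both for vector fields and for fields along
  curves.\<close>

lemma has_derivative_dder_apply:
  assumes "affine_domain M V" "smooth_on M V F" "h ` S \<subseteq> M" "t \<in> S"
    and h: "(h has_derivative h') (at t within S)"
    and y: "(y has_derivative y') (at t within S)"
  shows "((\<lambda>s. dder M V F (h s) (y s)) has_derivative
     (\<lambda>\<tau>. dder M V F (h t) (y' \<tau>) + dder M V (\<lambda>q. dder M V F q (y t)) (h t) (h' \<tau>))) (at t within S)"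
proof -
  have hM: "h s \<in> M" if "s \<in> S" for s using that assms(3) by auto
  have D: "((\<lambda>s. dder M V F (h s) b) has_derivative (\<lambda>\<tau>. dder M V (\<lambda>q. dder M V F q b) (h t) (h' \<tau>))) (at t within S)" for b
    by (rule has_derivative_compose_on[OF h smooth_on_has_derivative[OF assms(1) smooth_on_dder[OF assms(1,2)] hM[OF \<open>t \<in> S\<close>]] assms(3)])
  have eq: "dder M V F (h s) w = (\<Sum>b\<in>Basis. (w \<bullet> b) *\<^sub>R dder M V F (h s) b)" if "s \<in> S" for s w
    by (rule linear_eq_sum_Basis[OF smooth_on_linear_dder[OF assms(1,2) hM[OF that]]])
  have "((\<lambda>s. \<Sum>b\<in>Basis. (y s \<bullet> b) *\<^sub>R dder M V F (h s) b) has_derivative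
      (\<lambda>\<tau>. \<Sum>b\<in>Basis. (y t \<bullet> b) *\<^sub>R dder M V (\<lambda>q. dder M V F q b) (h t) (h' \<tau>) + (y' \<tau> \<bullet> b) *\<^sub>R dder M V F (h t) b))
      (at t within S)"
    by (intro has_derivative_sum has_derivative_scaleR D has_derivative_inner_left y)
  moreover have "(\<Sum>b\<in>Basis. (y t \<bullet> b) *\<^sub>R dder M V (\<lambda>q. dder M V F q b) (h t) (h' \<tau>) + (y' \<tau> \<bullet> b) *\<^sub>R dder M V F (h t) b)
     = dder M V F (h t) (y' \<tau>) + dder M V (\<lambda>q. dder M V F q (y t)) (h t) (h' \<tau>)" for \<tau>
    using dder_dder_sum_Basis[OF assms(1,2) hM[OF \<open>t \<in> S\<close>], of "y t"] eq[OF \<open>t \<in> S\<close>, of "y' \<tau>"]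
    by (simp add: sum.distrib)
  ultimately have "((\<lambda>s. \<Sum>b\<in>Basis. (y s \<bullet> b) *\<^sub>R dder M V F (h s) b) has_derivative
      (\<lambda>\<tau>. dder M V F (h t) (y' \<tau>) + dder M V (\<lambda>q. dder M V F q (y t)) (h t) (h' \<tau>))) (at t within S)"
    by simp
  then show ?thesis
    by (rule has_derivative_transform[rotated 2]) (use assms(4) eq in auto)
qed

text \<open>Mean value theorem twice: for the increment in direction \<open>Y\<close> as a function
  of the \<open>X\<close> coordinate, then for the resulting \<open>X\<close> derivative along
  \<open>Y\<close>.\<close>

lemma second_difference_mean_value:
  fixes f :: "'a::euclidean_space \<Rightarrow> real"
  assumes M: "affine_domain M V" and f: "smooth_on M V f" and "X \<in> V" "Y \<in> V" "0 < h"
    and in_M: "\<And>s t. 0 \<le> s \<Longrightarrow> s \<le> h \<Longrightarrow> 0 \<le> t \<Longrightarrow> t \<le> h \<Longrightarrow> p + s *\<^sub>R X + t *\<^sub>R Y \<in> M"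
  obtains s t where "0 < s" "s < h" "0 < t" "t < h"
    "f (p + h *\<^sub>R X + h *\<^sub>R Y) - f (p + h *\<^sub>R X) - f (p + h *\<^sub>R Y) + f p
       = h * (h * dder M V (\<lambda>q. dder M V f q X) (p + s *\<^sub>R X + t *\<^sub>R Y) Y)"
proof -
  note d = smooth_on_has_derivative[OF M f]
  note dd = smooth_on_has_derivative[OF M smooth_on_dder[OF M f]]
  let ?u = "\<lambda>s. f ((p + h *\<^sub>R Y) + s *\<^sub>R X) - f (p + s *\<^sub>R X)"
  have "(?u has_real_derivative dder M V f ((p + h *\<^sub>R Y) + s *\<^sub>R X) X - dder M V f (p + s *\<^sub>R X) X) (at s)"
    if "0 \<le> s" "s \<le> h" for s
  proof -
    have "(p + h *\<^sub>R Y) + s *\<^sub>R X \<in> M" "p + s *\<^sub>R X \<in> M"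
      using in_M[of s h] in_M[of s 0] that \<open>0 < h\<close> by (auto simp: algebra_simps)
    then show ?thesis
      unfolding has_real_derivative_iff_has_vector_derivative
      by (intro has_vector_derivative_diff has_derivative_line[OF M _ \<open>X \<in> V\<close>] d)
  qed
  from MVT2[OF \<open>0 < h\<close> this] obtain s where s: "0 < s" "s < h" and
    u: "?u h - ?u 0 = h * (dder M V f ((p + h *\<^sub>R Y) + s *\<^sub>R X) X - dder M V f (p + s *\<^sub>R X) X)"
    by auto
  let ?w = "\<lambda>t. dder M V f ((p + s *\<^sub>R X) + t *\<^sub>R Y) X"
  have "(?w has_real_derivative dder M V (\<lambda>q. dder M V f q X) ((p + s *\<^sub>R X) + t *\<^sub>R Y) Y) (at t)"
    if "0 \<le> t" "t \<le> h" for t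
    unfolding has_real_derivative_iff_has_vector_derivative
    using in_M[of s t] s that by (intro has_derivative_line[OF M _ \<open>Y \<in> V\<close>] dd) auto
  from MVT2[OF \<open>0 < h\<close> this] obtain t where t: "0 < t" "t < h" and
    w: "?w h - ?w 0 = h * dder M V (\<lambda>q. dder M V f q X) ((p + s *\<^sub>R X) + t *\<^sub>R Y) Y"
    by auto
  have "?u h - ?u 0 = h * (?w h - ?w 0)" using u by (simp add: algebra_simps)
  then show ?thesis using w s t by (intro that[of s t]) (simp_all add: algebra_simps)
qed

text \<open>The second difference over a parallelogram does not depend on the order of its sides, so
  the two mixed derivatives take a common value at two possibly different points of it. Shrinking
  the parallelogram and continuity carry this to \<open>p\<close>.\<close>

lemma dder_commute_real:
  fixes f :: "'a::euclidean_space \<Rightarrow> real"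
  assumes M: "affine_domain M V" and f: "smooth_on M V f" and "X \<in> V" "Y \<in> V" "p \<in> M"
  shows "dder M V (\<lambda>q. dder M V f q Y) p X = dder M V (\<lambda>q. dder M V f q X) p Y"
proof -
  define A where "A X Y q = dder M V (\<lambda>q. dder M V f q X) q Y" for X Y q
  have V: "subspace V" using M by (rule affine_domain_subspace)
  obtain e where e: "e > 0" "\<And>v. v \<in> V \<Longrightarrow> norm v < e \<Longrightarrow> p + v \<in> M"
    using affine_domain_ball[OF M \<open>p \<in> M\<close>] by blast
  have cont: "continuous (at p within M) (A X Y)" for X Y
    using smooth_on_dder[OF M smooth_on_dder[OF M f]] \<open>p \<in> M\<close> Ck_on_continuous[OF M]
    unfolding A_def smooth_on_def continuous_on_eq_continuous_within by blast
  have "\<bar>A X Y p - A Y X p\<bar> \<le> \<epsilon>" if "\<epsilon> > 0" for \<epsilon>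
  proof -
    from cont obtain d1 where d1: "d1 > 0" "\<And>q. q \<in> M \<Longrightarrow> dist q p < d1 \<Longrightarrow> dist (A X Y q) (A X Y p) < \<epsilon> / 2"
      using \<open>\<epsilon> > 0\<close> unfolding continuous_within_eps_delta by (meson half_gt_zero)
    from cont obtain d2 where d2: "d2 > 0" "\<And>q. q \<in> M \<Longrightarrow> dist q p < d2 \<Longrightarrow> dist (A Y X q) (A Y X p) < \<epsilon> / 2"
      using \<open>\<epsilon> > 0\<close> unfolding continuous_within_eps_delta by (meson half_gt_zero)
    define d where "d = min e (min d1 d2)"
    \<comment> \<open>Every point of the parallelogram with sides \<open>h *\<^sub>R X\<close> and
      \<open>h *\<^sub>R Y\<close> is at distance at most \<open>h * c = d / 2\<close> from
      \<open>p\<close>; the summand 1 keeps \<open>c\<close> positive when both vectors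
      vanish.\<close>
    define c where "c = norm X + norm Y + 1"
    define h where "h = d / (2 * c)"
    have N: "c > 0" by (simp add: c_def add_nonneg_pos)
    have d: "d > 0" using e d1 d2 by (simp add: d_def)
    have h: "h > 0" using d N by (simp add: h_def)
    have small: "norm (s *\<^sub>R X + t *\<^sub>R Y) < d" if "0 \<le> s" "s \<le> h" "0 \<le> t" "t \<le> h" for s t
    proof -
      have "norm (s *\<^sub>R X + t *\<^sub>R Y) \<le> s * norm X + t * norm Y"
        using norm_triangle_ineq[of "s *\<^sub>R X" "t *\<^sub>R Y"] that by simp
      also have "\<dots> \<le> h * norm X + h * norm Y"
        using that by (intro add_mono mult_right_mono) auto
      also have "\<dots> \<le> h * c" using h by (simp add: c_def algebra_simps)
      also have "\<dots> = d / 2" using N by (simp add: h_def)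
      also have "\<dots> < d" using d by simp
      finally show ?thesis .
    qed
    have sM: "p + s *\<^sub>R X + t *\<^sub>R Y \<in> M" if "0 \<le> s" "s \<le> h" "0 \<le> t" "t \<le> h" for s t
    proof -
      have "s *\<^sub>R X + t *\<^sub>R Y \<in> V" using V assms by (simp add: subspace_add subspace_scale)
      then show ?thesis using e(2)[of "s *\<^sub>R X + t *\<^sub>R Y"] small[OF that] by (simp add: d_def add.assoc)
    qed
    then have sM': "p + s *\<^sub>R Y + t *\<^sub>R X \<in> M" if "0 \<le> s" "s \<le> h" "0 \<le> t" "t \<le> h" for s t
      using that by (metis add.assoc add.commute)
    obtain s t where st: "0 < s" "s < h" "0 < t" "t < h" and
     1: "f (p + h *\<^sub>R X + h *\<^sub>R Y) - f (p + h *\<^sub>R X) - f (p + h *\<^sub>R Y) + f p = h * (h * A X Y (p + s *\<^sub>R X + t *\<^sub>R Y))"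
      using second_difference_mean_value[OF M f \<open>X \<in> V\<close> \<open>Y \<in> V\<close> h sM] unfolding A_def by blast
    obtain s' t' where st': "0 < s'" "s' < h" "0 < t'" "t' < h" and
     2: "f (p + h *\<^sub>R Y + h *\<^sub>R X) - f (p + h *\<^sub>R Y) - f (p + h *\<^sub>R X) + f p = h * (h * A Y X (p + s' *\<^sub>R Y + t' *\<^sub>R X))"
      using second_difference_mean_value[OF M f \<open>Y \<in> V\<close> \<open>X \<in> V\<close> h sM'] unfolding A_def by blast
    have YX: "p + h *\<^sub>R Y + h *\<^sub>R X = p + h *\<^sub>R X + h *\<^sub>R Y" by simp
    have "h * (h * A X Y (p + s *\<^sub>R X + t *\<^sub>R Y)) = h * (h * A Y X (p + s' *\<^sub>R Y + t' *\<^sub>R X))"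
      using 1 2[unfolded YX] by linarith
    then have eq: "A X Y (p + s *\<^sub>R X + t *\<^sub>R Y) = A Y X (p + s' *\<^sub>R Y + t' *\<^sub>R X)"
      using h by simp
    have "dist (A X Y (p + s *\<^sub>R X + t *\<^sub>R Y)) (A X Y p) < \<epsilon> / 2"
      using small[of s t] st by (intro d1(2) sM) (auto simp: dist_norm d_def add.assoc)
    moreover have "dist (A Y X (p + s' *\<^sub>R Y + t' *\<^sub>R X)) (A Y X p) < \<epsilon> / 2"
      using small[of t' s'] st' by (intro d2(2) sM') (auto simp: dist_norm d_def add.assoc add.commute)
    ultimately show ?thesis unfolding eq dist_real_def by linarith
  qed
  then have "\<bar>A X Y p - A Y X p\<bar> \<le> 0" by (rule field_le_epsilon) simp
  then show ?thesis by (simp add: A_def)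
qed

lemma dder_inner:
  assumes "affine_domain M V" "smooth_on M V f" "p \<in> M"
  shows "dder M V (\<lambda>q. f q \<bullet> b) p v = dder M V f p v \<bullet> b"
  using dder_eq[OF assms(1,3) has_derivative_inner_left[OF smooth_on_has_derivative[OF assms]], of b v]
  by (simp add: dder_proj assms(1))

text \<open>Inner products with basis vectors reduce to the real-valued case, and since
  \<open>dder\<close> projects its direction, \<open>X\<close> and \<open>Y\<close> may lie outside
  \<open>V\<close>.\<close>

lemma dder_commute:
  assumes M: "affine_domain M V" and f: "smooth_on M V f" and "p \<in> M"
  shows "dder M V (\<lambda>q. dder M V f q Y) p X = dder M V (\<lambda>q. dder M V f q X) p Y"
proof (rule euclidean_eqI)
  fix b :: 'b
  have fb: "smooth_on M V (\<lambda>q. f q \<bullet> b)"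
    using f Ck_on_linear_compose[OF M bounded_linear_inner_left] by (auto simp: smooth_on_def)
  let ?P = "proj_onto V"
  have P: "?P X \<in> V" "?P Y \<in> V" using proj_onto_in affine_domain_subspace[OF M] by auto
  have *: "dder M V (\<lambda>q. dder M V (\<lambda>q. f q \<bullet> b) q Y) p X = dder M V (\<lambda>q. dder M V f q Y) p X \<bullet> b" for X Y
    using dder_inner[OF M smooth_on_dder[OF M f] \<open>p \<in> M\<close>, of Y b X]
      dder_cong[of p M "\<lambda>q. dder M V (\<lambda>q. f q \<bullet> b) q Y" "\<lambda>q. dder M V f q Y \<bullet> b" V X]
      dder_inner[OF M f] \<open>p \<in> M\<close> by simp
  show "dder M V (\<lambda>q. dder M V f q Y) p X \<bullet> b = dder M V (\<lambda>q. dder M V f q X) p Y \<bullet> b"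
    using dder_commute_real[OF M fb P \<open>p \<in> M\<close>] by (simp add: * dder_proj[OF M])
qed

section \<open>Maps between affine domains and curves in them\<close>

lemma affine_domain_self: "subspace W \<Longrightarrow> affine_domain W W"
  unfolding affine_domain_def by (auto intro!: exI[of _ 0])

lemma smooth_on_ident: "affine_domain M V \<Longrightarrow> smooth_on M V (\<lambda>q. q)"
  by (simp add: smooth_on_def Ck_on_bounded_linear bounded_linear_ident)

lemma smooth_on_dder_apply:
  assumes M: "affine_domain M V" and N: "affine_domain N U" and f: "smooth_on N U f"
    and h: "h ` M \<subseteq> N" "smooth_on M V h" and y: "smooth_on M V y"
  shows "smooth_on M V (\<lambda>q. dder N U f (h q) (y q))"
proof -
  have 1: "Ck_on k M V (\<lambda>q. dder N U f (h q) b)" for k b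
    using Ck_on_compose[OF M N h(1)] h(2) smooth_on_dder[OF N f] unfolding smooth_on_def by blast
  have 2: "Ck_on k M V (\<lambda>q. y q \<bullet> b)" for k b
    using Ck_on_linear_compose[OF M bounded_linear_inner_left] y unfolding smooth_on_def by blast
  have "Ck_on k M V (\<lambda>q. \<Sum>b\<in>Basis. (y q \<bullet> b) *\<^sub>R dder N U f (h q) b)" for k
    by (intro Ck_on_sum[OF M] Ck_on_scaleR[OF M] 1 2)
  moreover have "(\<Sum>b\<in>Basis. (y q \<bullet> b) *\<^sub>R dder N U f (h q) b) = dder N U f (h q) (y q)" if "q \<in> M" for q
    by (rule linear_eq_sum_Basis[symmetric, OF smooth_on_linear_dder[OF N f]]) (use h(1) that in auto)
  ultimately show ?thesis
    unfolding smooth_on_def by (simp cong: Ck_on_cong)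
qed

text \<open>Increments of a map into \<open>N\<close> lie in \<open>U\<close>, so projecting them
  changes nothing; the projected derivative then shows that derivatives take values in
  \<open>U\<close>.\<close>

lemma has_derivative_proj_onto:
  assumes N: "affine_domain N U" and "f ` S \<subseteq> N" "p \<in> S" "(f has_derivative f') (at p within S)"
  shows "(f has_derivative (\<lambda>v. proj_onto U (f' v))) (at p within S)"
proof -
  have U: "subspace U" using N by (rule affine_domain_subspace)
  then have "bounded_linear (proj_onto U)"
    using linear_proj_onto linear_conv_bounded_linear by blast
  from has_derivative_add[OF has_derivative_const bounded_linear.has_derivative[OF this
        has_derivative_diff[OF assms(4) has_derivative_const]], of "f p" "f p"]
  have D: "((\<lambda>q. f p + proj_onto U (f q - f p)) has_derivative (\<lambda>v. proj_onto U (f' v))) (at p within S)"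
    by simp
  have E: "f q = f p + proj_onto U (f q - f p)" if "q \<in> S" for q
  proof -
    have "f p \<in> N" "f q \<in> N" using assms that by auto
    then show ?thesis using proj_onto_id[OF U affine_domain_diff[OF N]] by simp
  qed
  show ?thesis by (rule has_derivative_transform[OF \<open>p \<in> S\<close> E D])
qed

lemma dder_in:
  assumes M: "affine_domain M V" and N: "affine_domain N U" and "f ` M \<subseteq> N" "smooth_on M V f" "p \<in> M"
  shows "dder M V f p v \<in> U"
proof -
  have "dder M V f p v = proj_onto U (dder M V f p (proj_onto V v))"
    by (rule dder_eq[OF M \<open>p \<in> M\<close> has_derivative_proj_onto[OF N assms(3,5) smooth_on_has_derivative[OF M assms(4,5)]]])
  then show ?thesis
    using proj_onto_in[OF affine_domain_subspace[OF N], of "dder M V f p (proj_onto V v)"] by simp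
qed

lemma has_vector_derivative_in:
  assumes N: "affine_domain N U" and "f ` S \<subseteq> N" "t \<in> S" "(f has_vector_derivative v) (at t within S)"
    and "at t within S \<noteq> bot"
  shows "v \<in> U"
proof -
  have U: "subspace U" using N by (rule affine_domain_subspace)
  have "(f has_derivative (\<lambda>x. proj_onto U (x *\<^sub>R v))) (at t within S)"
    by (rule has_derivative_proj_onto[OF N assms(2,3) assms(4)[unfolded has_vector_derivative_def]])
  then have "(f has_vector_derivative proj_onto U v) (at t within S)"
    unfolding has_vector_derivative_def by (simp add: linear_cmul[OF linear_proj_onto[OF U]])
  then have "v = proj_onto U v"
    using vector_derivative_unique_within[OF assms(5,4)] by blast
  then show ?thesis using proj_onto_in[OF U, of v] by simp
qed

text \<open>A nondegenerate interval has no isolated points, so one-sided derivatives at its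
  endpoints are unique.\<close>

lemma at_within_interval_not_bot:
  fixes I :: "real set"
  assumes "is_interval I" "interior I \<noteq> {}" "t \<in> I"
  shows "at t within I \<noteq> bot"
proof -
  have "I \<noteq> {x}" for x using assms(2) by auto
  then have "t islimpt I"
    using connected_imp_perfect[of I t] assms is_interval_connected by blast
  then show ?thesis by (simp add: trivial_limit_within)
qed

lemma frechet_derivative_eq_on:
  fixes f :: "'a::euclidean_space \<Rightarrow> 'b::euclidean_space"
  assumes "affine_domain M V" "p \<in> M" "(f has_derivative f') (at p within M)" "v \<in> V"
  shows "frechet_derivative f (at p within M) v = f' v"
  using dder_eq_on[OF assms] by (simp add: dder_on[OF assms(1,4)])

lemma zero_vector_derivative_constant:
  fixes f :: "real \<Rightarrow> 'c::real_normed_vector"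
  assumes "is_interval I" "\<And>t. t \<in> I \<Longrightarrow> (f has_vector_derivative 0) (at t within I)"
  shows "\<exists>c. \<forall>t\<in>I. f t = c"
  by (rule has_derivative_zero_constant)
     (use assms is_interval_convex in \<open>auto simp: has_vector_derivative_def\<close>)

section \<open>Metrics with a global flat chart\<close>

locale flat_chart =
  fixes M :: "'a::euclidean_space set" and V :: "'a set" and W :: "'b::euclidean_space set"
    and F :: "'a \<Rightarrow> 'b" and G :: "'b \<Rightarrow> 'a" and ip :: "'b \<Rightarrow> 'b \<Rightarrow> real"
  assumes M: "affine_domain M V" and W: "subspace W"
    and F_in: "\<And>p. p \<in> M \<Longrightarrow> F p \<in> W" and G_in: "\<And>w. w \<in> W \<Longrightarrow> G w \<in> M"
    and GF: "\<And>p. p \<in> M \<Longrightarrow> G (F p) = p" and FG: "\<And>w. w \<in> W \<Longrightarrow> F (G w) = w"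
    and F: "smooth_on M V F" and G: "smooth_on W W G" and ip: "inner_product_on W ip"
begin

definition g :: "'a \<Rightarrow> 'a \<Rightarrow> 'a \<Rightarrow> real" where
  "g p X Y = ip (frechet_derivative F (at p within M) X) (frechet_derivative F (at p within M) Y)"

abbreviation dF :: "'a \<Rightarrow> 'a \<Rightarrow> 'b" where "dF \<equiv> dder M V F"
abbreviation dG :: "'b \<Rightarrow> 'b \<Rightarrow> 'a" where "dG \<equiv> dder W W G"

section \<open>Differentials of the chart and its inverse\<close>

lemma V: "subspace V" using M by (rule affine_domain_subspace)
lemma WW: "affine_domain W W" using W by (rule affine_domain_self)
lemma VV: "affine_domain V V" using V by (rule affine_domain_self)
lemma FM: "F ` M \<subseteq> W" using F_in by auto
lemma GW: "G ` W \<subseteq> M" using G_in by auto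

lemma linear_dF: "p \<in> M \<Longrightarrow> linear (dF p)" by (rule smooth_on_linear_dder[OF M F])
lemma linear_dG: "w \<in> W \<Longrightarrow> linear (dG w)" by (rule smooth_on_linear_dder[OF WW G])

lemma dF_in: "p \<in> M \<Longrightarrow> dF p X \<in> W" by (rule dder_in[OF M WW FM F])
lemma dG_in: "w \<in> W \<Longrightarrow> dG w y \<in> V" by (rule dder_in[OF WW M GW G])

text \<open>Differentiating \<open>G (F q) = q\<close> along \<open>M\<close>; the two derivatives
  can be identified on \<open>V\<close> only.\<close>

lemma dG_dF: assumes "p \<in> M" "X \<in> V" shows "dG (F p) (dF p X) = X"
proof -
  have "((\<lambda>q. G (F q)) has_derivative (\<lambda>v. dG (F p) (dF p v))) (at p within M)"
    by (rule has_derivative_compose_on[OF smooth_on_has_derivative[OF M F] smooth_on_has_derivative[OF WW G] FM])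
       (use assms F_in in auto)
  then have "((\<lambda>q. q) has_derivative (\<lambda>v. dG (F p) (dF p v))) (at p within M)"
    by (rule has_derivative_transform[rotated 2]) (use assms GF in auto)
  from has_derivative_unique_on[OF M assms this has_derivative_ident] show ?thesis .
qed

lemma dF_dG: assumes "p \<in> M" "y \<in> W" shows "dF p (dG (F p) y) = y"
proof -
  have p: "F p \<in> W" "p = G (F p)" using assms F_in GF by auto
  have "((\<lambda>w. F (G w)) has_derivative (\<lambda>v. dF (G (F p)) (dG (F p) v))) (at (F p) within W)"
    by (rule has_derivative_compose_on[OF smooth_on_has_derivative[OF WW G] smooth_on_has_derivative[OF M F] GW])
       (use p assms in auto)
  then have "((\<lambda>w. w) has_derivative (\<lambda>v. dF (G (F p)) (dG (F p) v))) (at (F p) within W)"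
    by (rule has_derivative_transform[rotated 2]) (use p assms FG in auto)
  from has_derivative_unique_on[OF WW p(1) assms(2) this has_derivative_ident] show ?thesis
    using p by simp
qed

lemma dF_eq_iff: "p \<in> M \<Longrightarrow> X \<in> V \<Longrightarrow> Y \<in> V \<Longrightarrow> dF p X = dF p Y \<longleftrightarrow> X = Y"
  using dG_dF by metis

lemma g_eq: "X \<in> V \<Longrightarrow> Y \<in> V \<Longrightarrow> g p X Y = ip (dF p X) (dF p Y)"
  by (simp add: g_def dder_on[OF M])

text \<open>\<open>ip\<close> is bilinear on \<open>W\<close> only. Precomposing with the projection
  yields a form that is bilinear on the whole space, to which the calculus of bounded bilinear maps
  applies; definiteness is claimed on \<open>W\<close> alone.\<close>

definition ipe :: "'b \<Rightarrow> 'b \<Rightarrow> real" where "ipe x y = ip (proj_onto W x) (proj_onto W y)"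

lemma ipe_eq: "x \<in> W \<Longrightarrow> y \<in> W \<Longrightarrow> ipe x y = ip x y"
  by (simp add: ipe_def proj_onto_id[OF W])

lemma ipe_commute: "ipe x y = ipe y x"
  using ip proj_onto_in[OF W] by (simp add: ipe_def inner_product_on_def)

lemma ipe_pos: "x \<in> W \<Longrightarrow> x \<noteq> 0 \<Longrightarrow> ipe x x > 0"
  using ip by (simp add: ipe_eq inner_product_on_def)

lemma bounded_bilinear_ipe: "bounded_bilinear ipe"
proof -
  note P = linear_add[OF linear_proj_onto[OF W]] linear_cmul[OF linear_proj_onto[OF W]] proj_onto_in[OF W]
  have "bilinear ipe"
    unfolding bilinear_def linear_iff
    using ip by (simp add: ipe_def P inner_product_on_def bilinear_on_def)
  then show ?thesis by (simp add: bilinear_conv_bounded_bilinear)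
qed

sublocale B: bounded_bilinear ipe by (rule bounded_bilinear_ipe)

lemma ipe_nonneg: "x \<in> W \<Longrightarrow> ipe x x \<ge> 0"
  using ipe_pos[of x] B.zero_left by (cases "x = 0") auto

lemma ipe_Cauchy_Schwarz:
  assumes "x \<in> W" "y \<in> W"
  shows "ipe x y \<le> sqrt (ipe x x) * sqrt (ipe y y)"
proof (cases "y = 0")
  case True
  then show ?thesis by (simp add: B.zero_right)
next
  case False
  then have pos: "ipe y y > 0" using ipe_pos assms by blast
  \<comment> \<open>\<open>c *\<^sub>R y\<close> is the \<open>ipe\<close>-orthogonal projection of
    \<open>x\<close> to the line spanned by \<open>y\<close>.\<close>
  define c where "c = ipe x y / ipe y y"
  have "0 \<le> ipe (x - c *\<^sub>R y) (x - c *\<^sub>R y)"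
    using assms W by (intro ipe_nonneg) (simp add: subspace_diff subspace_scale)
  also have "\<dots> = ipe x x - 2 * c * ipe x y + c * c * ipe y y"
    using ipe_commute[of y x]
    by (simp add: B.diff_left B.diff_right B.scaleR_left B.scaleR_right algebra_simps)
  also have "\<dots> = ipe x x - (ipe x y)\<^sup>2 / ipe y y"
    using pos by (simp add: c_def power2_eq_square field_simps)
  finally have "(ipe x y)\<^sup>2 \<le> ipe x x * ipe y y"
    using pos by (simp add: field_simps)
  then have "\<bar>ipe x y\<bar> \<le> sqrt (ipe x x * ipe y y)"
    using real_sqrt_le_mono[of "(ipe x y)\<^sup>2"] by simp
  then show ?thesis by (simp add: real_sqrt_mult)
qed

lemma inner_product_g:
  assumes "p \<in> M" shows "inner_product_on V (g p)"
proof -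
  note dFlin = linear_add[OF linear_dF[OF assms]] linear_cmul[OF linear_dF[OF assms]]
  have g: "g p X Y = ipe (dF p X) (dF p Y)" if "X \<in> V" "Y \<in> V" for X Y
    using that dF_in assms by (simp add: g_eq ipe_eq)
  have "dF p X \<noteq> 0" if "X \<in> V" "X \<noteq> 0" for X
    using dF_eq_iff[OF assms that(1) subspace_0[OF V]] that linear_0[OF linear_dF[OF assms]] by simp
  then show ?thesis
    using ipe_commute ipe_pos dF_in[OF assms] V
    by (simp add: inner_product_on_def bilinear_on_def g subspace_add subspace_scale dFlin
        B.add_left B.add_right B.scaleR_left B.scaleR_right)
qed

lemma smooth_dF: "smooth_on M V (\<lambda>q. dF q Y)"
  by (rule smooth_on_dder[OF M F])

lemma riemannian: "riemannian_metric M V g"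
proof -
  have "smooth_on M V (\<lambda>p. g p X Y)" if "X \<in> V" "Y \<in> V" for X Y
  proof -
    have "Ck_on k M V (\<lambda>p. ipe (dF p X) (dF p Y))" for k
      using smooth_dF by (intro Ck_on_bilinear[OF M bounded_bilinear_ipe]) (auto simp: smooth_on_def)
    moreover have "g p X Y = ipe (dF p X) (dF p Y)" if "p \<in> M" for p
      using \<open>X \<in> V\<close> \<open>Y \<in> V\<close> dF_in that by (simp add: g_eq ipe_eq)
    ultimately show ?thesis unfolding smooth_on_def by (simp cong: Ck_on_cong)
  qed
  then show ?thesis using M inner_product_g by (simp add: riemannian_metric_def)
qed

section \<open>The Levi-Civita connection\<close>

definition Gam :: "'a \<Rightarrow> 'a \<Rightarrow> 'a \<Rightarrow> 'a" where
  "Gam p X Y = dG (F p) (dder M V (\<lambda>q. dF q Y) p X)"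

lemma Gam_in: "p \<in> M \<Longrightarrow> Gam p X Y \<in> V"
  by (simp add: Gam_def dG_in F_in)

lemma dF_Gam: "p \<in> M \<Longrightarrow> dF p (Gam p X Y) = dder M V (\<lambda>q. dF q Y) p X"
  unfolding Gam_def by (intro dF_dG dder_in[OF M WW _ smooth_dF]) (auto simp: dF_in)

lemma Gam_commute: "p \<in> M \<Longrightarrow> Gam p X Y = Gam p Y X"
  by (simp add: Gam_def dder_commute[OF M F])

lemma linear_Gam: assumes "p \<in> M" shows "linear (\<lambda>X. Gam p X Y)"
proof -
  have "linear (dG (F p) \<circ> dder M V (\<lambda>q. dF q Y) p)"
    by (rule linear_compose[OF smooth_on_linear_dder[OF M smooth_dF assms] linear_dG[OF F_in[OF assms]]])
  then show ?thesis by (simp add: Gam_def o_def)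
qed

lemma connection_Gam: "connection M V Gam"
proof -
  have "bilinear_on V (Gam p)" if "p \<in> M" for p
  proof -
    have 1: "Gam p (x + y) z = Gam p x z + Gam p y z" "Gam p (c *\<^sub>R x) y = c *\<^sub>R Gam p x y" for x y z c
      using linear_add[OF linear_Gam[OF that]] linear_cmul[OF linear_Gam[OF that]] by auto
    \<comment> \<open>Symmetry turns linearity in the first argument into linearity in the
      second.\<close>
    have 2: "Gam p z (x + y) = Gam p z x + Gam p z y" "Gam p x (c *\<^sub>R y) = c *\<^sub>R Gam p x y" for x y z c
      by (simp_all only: 1 Gam_commute[OF that, of z] Gam_commute[OF that, of x "c *\<^sub>R y"] Gam_commute[OF that, of x y])
    show ?thesis unfolding bilinear_on_def using 1 2 by blast
  qed
  moreover have "smooth_on M V (\<lambda>p. Gam p X Y)" for X Y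
    unfolding Gam_def
    by (rule smooth_on_dder_apply[OF M WW G FM F smooth_on_dder[OF M smooth_dF]])
  ultimately show ?thesis using Gam_in by (simp add: connection_def)
qed

lemma vf_in: "vector_field M V X \<Longrightarrow> p \<in> M \<Longrightarrow> X p \<in> V"
  by (auto simp: vector_field_def)

lemma vf_smooth: "vector_field M V X \<Longrightarrow> smooth_on M V X"
  by (simp add: vector_field_def)

lemma vf_dder_in: "vector_field M V Y \<Longrightarrow> p \<in> M \<Longrightarrow> dder M V Y p v \<in> V"
  by (rule dder_in[OF M VV]) (auto simp: vector_field_def)

text \<open>The chart representative of a field; covariant derivatives of the field are ordinary
  derivatives of it.\<close>

definition hat :: "('a \<Rightarrow> 'a) \<Rightarrow> 'a \<Rightarrow> 'b" where "hat Y p = dF p (Y p)"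

lemma smooth_hat: "vector_field M V Y \<Longrightarrow> smooth_on M V (hat Y)"
  unfolding hat_def[abs_def]
  by (rule smooth_on_dder_apply[OF M M F]) (auto simp: vector_field_def smooth_on_ident[OF M])

lemma cov_deriv_eq:
  "vector_field M V X \<Longrightarrow> p \<in> M \<Longrightarrow> cov_deriv M Gam X Y p = dder M V Y p (X p) + Gam p (X p) (Y p)"
  by (simp add: cov_deriv_def dder_on[OF M] vf_in)

lemma cov_deriv_in:
  "vector_field M V X \<Longrightarrow> vector_field M V Y \<Longrightarrow> p \<in> M \<Longrightarrow> cov_deriv M Gam X Y p \<in> V"
  by (simp add: cov_deriv_eq subspace_add[OF V] vf_dder_in Gam_in)

text \<open>The product rule for \<open>dF q (Y q)\<close> yields \<open>dF\<close> of the
  derivative of \<open>Y\<close> plus a second derivative of \<open>F\<close>, and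
  \<open>Gam\<close> is built so that \<open>dF\<close> maps it to exactly that term. Flatness and
  metric compatibility thus become statements about ordinary derivatives.\<close>

lemma dF_cov_deriv:
  assumes "vector_field M V X" "vector_field M V Y" "p \<in> M"
  shows "dF p (cov_deriv M Gam X Y p) = dder M V (hat Y) p (X p)"
proof -
  have "((\<lambda>q. dF q (Y q)) has_derivative
      (\<lambda>v. dF p (dder M V Y p v) + dder M V (\<lambda>q. dF q (Y p)) p v)) (at p within M)"
    by (rule has_derivative_dder_apply[OF M F _ \<open>p \<in> M\<close> has_derivative_ident
          smooth_on_has_derivative[OF M vf_smooth[OF assms(2)] \<open>p \<in> M\<close>]]) simp
  from dder_eq_on[OF M \<open>p \<in> M\<close> this vf_in[OF assms(1,3)]]
  show ?thesis
    using assms by (simp add: cov_deriv_eq hat_def[abs_def] linear_add[OF linear_dF] dF_Gam)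
qed

text \<open>Torsion vanishes because \<open>Gam\<close> is symmetric. Compatibility is the product
  rule for the constant form \<open>ipe\<close> applied to the chart representatives.\<close>

lemma is_levi_civita_Gam: "is_levi_civita M V g Gam"
  unfolding is_levi_civita_def
proof (intro conjI allI impI ballI connection_Gam)
  fix X Y p assume "vector_field M V X" "vector_field M V Y" "p \<in> M"
  then show "cov_deriv M Gam X Y p - cov_deriv M Gam Y X p = lie_bracket M X Y p"
    using Gam_commute[of p "X p" "Y p"] by (simp add: cov_deriv_def lie_bracket_def)
next
  fix X Y Z p assume *: "vector_field M V X" "vector_field M V Y" "vector_field M V Z" "p \<in> M"
  have "((\<lambda>q. ipe (hat Y q) (hat Z q)) has_derivative
     (\<lambda>v. ipe (hat Y p) (dder M V (hat Z) p v) + ipe (dder M V (hat Y) p v) (hat Z p))) (at p within M)"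
    by (intro B.FDERIV smooth_on_has_derivative[OF M] smooth_hat *)
  then have "((\<lambda>q. g q (Y q) (Z q)) has_derivative
     (\<lambda>v. ipe (hat Y p) (dder M V (hat Z) p v) + ipe (dder M V (hat Y) p v) (hat Z p))) (at p within M)"
    by (rule has_derivative_transform[rotated 2])
       (use * in \<open>auto simp: g_eq vf_in ipe_eq dF_in hat_def\<close>)
  from frechet_derivative_eq_on[OF M \<open>p \<in> M\<close> this vf_in[OF *(1,4)]]
  show "frechet_derivative (\<lambda>q. g q (Y q) (Z q)) (at p within M) (X p)
      = g p (cov_deriv M Gam X Y p) (Z p) + g p (Y p) (cov_deriv M Gam X Z p)"
    using * dF_cov_deriv[OF *(1,2,4)] dF_cov_deriv[OF *(1,3,4)]
      ipe_eq[OF dF_in[OF *(4)] dF_in[OF *(4)], of "cov_deriv M Gam X Y p" "Z p"]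
      ipe_eq[OF dF_in[OF *(4)] dF_in[OF *(4)], of "Y p" "cov_deriv M Gam X Z p"]
    by (simp add: g_eq vf_in cov_deriv_in hat_def)
qed

lemma vector_field_const: "X \<in> V \<Longrightarrow> vector_field M V (\<lambda>_. X)"
  by (auto simp: vector_field_def smooth_on_def Ck_on_const[OF M])

text \<open>Koszul formula on constant fields: their brackets and derivatives vanish, so the metric
  coefficients alone determine \<open>2 * g p (\<Gamma> p X Y) Z\<close>.\<close>

lemma levi_civita_unique:
  assumes "is_levi_civita M V g \<Gamma>" "p \<in> M" "X \<in> V" "Y \<in> V"
  shows "\<Gamma> p X Y = Gam p X Y"
proof -
  have c0: "frechet_derivative (\<lambda>_. A) (at p within M) B = 0" if "B \<in> V" for A B :: 'a
    by (rule frechet_derivative_eq_on[OF M assms(2) has_derivative_const that])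
  have comm: "\<Delta> p A B = \<Delta> p B A" if "is_levi_civita M V g \<Delta>" "A \<in> V" "B \<in> V" for \<Delta> A B
  proof -
    have "cov_deriv M \<Delta> (\<lambda>_. A) (\<lambda>_. B) p - cov_deriv M \<Delta> (\<lambda>_. B) (\<lambda>_. A) p = lie_bracket M (\<lambda>_. A) (\<lambda>_. B) p"
      using that assms(2) vector_field_const unfolding is_levi_civita_def by blast
    then show ?thesis using that by (simp add: cov_deriv_def lie_bracket_def c0)
  qed
  have compat: "frechet_derivative (\<lambda>q. g q B C) (at p within M) A = g p (\<Delta> p A B) C + g p B (\<Delta> p A C)"
    if "is_levi_civita M V g \<Delta>" "A \<in> V" "B \<in> V" "C \<in> V" for \<Delta> A B C
  proof -
    have "frechet_derivative (\<lambda>q. g q B C) (at p within M) A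
       = g p (cov_deriv M \<Delta> (\<lambda>_. A) (\<lambda>_. B) p) C + g p B (cov_deriv M \<Delta> (\<lambda>_. A) (\<lambda>_. C) p)"
      using that assms(2) vector_field_const unfolding is_levi_civita_def by blast
    then show ?thesis using that by (simp add: cov_deriv_def c0)
  qed
  have inV: "\<Delta> p A B \<in> V" if "is_levi_civita M V g \<Delta>" "A \<in> V" "B \<in> V" for \<Delta> A B
    using that assms(2) by (auto simp: is_levi_civita_def connection_def)
  have gsym: "g p A B = g p B A" if "A \<in> V" "B \<in> V" for A B
    using inner_product_g[OF assms(2)] that by (auto simp: inner_product_on_def)
  let ?S = "\<lambda>A B C. frechet_derivative (\<lambda>q. g q B C) (at p within M) A"
  have koszul: "2 * g p (\<Delta> p X Y) Z = ?S X Y Z + ?S Y Z X - ?S Z X Y"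
    if LC: "is_levi_civita M V g \<Delta>" and "Z \<in> V" for \<Delta> Z
    using compat[OF LC] comm[OF LC, of X Y] comm[OF LC, of X Z] comm[OF LC, of Y Z]
      gsym[OF inV[OF LC]] assms(3,4) that(2) by simp
  \<comment> \<open>The difference of the two connections also serves as the test vector, so
    equality of the Koszul expressions makes its own norm vanish.\<close>
  let ?D = "\<Gamma> p X Y - Gam p X Y"
  have D: "\<Gamma> p X Y \<in> V" "Gam p X Y \<in> V" "?D \<in> V"
    using inV assms is_levi_civita_Gam by (auto simp: subspace_diff[OF V])
  have "g p (\<Gamma> p X Y) ?D = g p (Gam p X Y) ?D"
    using koszul[OF assms(1) D(3)] koszul[OF is_levi_civita_Gam D(3)] by linarith
  moreover have "g p (?D + Gam p X Y) ?D = g p ?D ?D + g p (Gam p X Y) ?D"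
    using inner_product_g[OF assms(2)] D unfolding inner_product_on_def bilinear_on_def by blast
  ultimately have "g p ?D ?D = 0" by simp
  then have "?D = 0"
    using inner_product_g[OF assms(2)] D unfolding inner_product_on_def by (metis less_irrefl)
  then show ?thesis by simp
qed

lemma is_levi_civita_levi_civita: "is_levi_civita M V g (levi_civita M V g)"
  unfolding levi_civita_def by (rule someI[of _ Gam]) (rule is_levi_civita_Gam)

lemma levi_civita_eq: "p \<in> M \<Longrightarrow> X \<in> V \<Longrightarrow> Y \<in> V \<Longrightarrow> levi_civita M V g p X Y = Gam p X Y"
  by (rule levi_civita_unique[OF is_levi_civita_levi_civita])

lemma cov_deriv_levi_civita:
  "vector_field M V X \<Longrightarrow> vector_field M V Y \<Longrightarrow> p \<in> M \<Longrightarrow>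
    cov_deriv M (levi_civita M V g) X Y p = cov_deriv M Gam X Y p"
  by (simp add: cov_deriv_def levi_civita_eq vf_in)

section \<open>Curvature\<close>

lemma vector_field_cong:
  "(\<And>p. p \<in> M \<Longrightarrow> X p = Y p) \<Longrightarrow> vector_field M V X \<longleftrightarrow> vector_field M V Y"
  unfolding vector_field_def smooth_on_def by (simp cong: Ck_on_cong image_cong)

text \<open>Curvature differentiates covariant derivatives again, so they have to be smooth fields
  with values in \<open>V\<close>. Smoothness is read off the chart expression.\<close>

lemma vector_field_cov_deriv:
  assumes "vector_field M V X" "vector_field M V Y"
  shows "vector_field M V (cov_deriv M (levi_civita M V g) X Y)"
proof -
  have "cov_deriv M (levi_civita M V g) X Y p = dG (F p) (dder M V (hat Y) p (X p))" if "p \<in> M" for p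
    using assms that cov_deriv_levi_civita dF_cov_deriv cov_deriv_in dG_dF by metis
  moreover have "smooth_on M V (\<lambda>p. dder M V (hat Y) p (X p))"
    using assms
    by (intro smooth_on_dder_apply[OF M M smooth_hat _ smooth_on_ident[OF M]]) (auto simp: vf_smooth)
  then have "vector_field M V (\<lambda>p. dG (F p) (dder M V (hat Y) p (X p)))"
    using dG_in F_in by (auto simp: vector_field_def intro!: smooth_on_dder_apply[OF M WW G FM F])
  ultimately show ?thesis by (simp cong: vector_field_cong)
qed

lemma lie_bracket_eq:
  "vector_field M V X \<Longrightarrow> vector_field M V Y \<Longrightarrow> p \<in> M \<Longrightarrow>
    lie_bracket M X Y p = dder M V Y p (X p) - dder M V X p (Y p)"
  by (simp add: lie_bracket_def dder_on[OF M] vf_in)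

lemma vector_field_lie_bracket:
  assumes "vector_field M V X" "vector_field M V Y"
  shows "vector_field M V (lie_bracket M X Y)"
proof -
  have "smooth_on M V (\<lambda>p. dder M V Y p (X p))" if "vector_field M V X" "vector_field M V Y" for X Y
    using that
    by (intro smooth_on_dder_apply[OF M M _ _ smooth_on_ident[OF M]]) (auto simp: vf_smooth)
  from this[OF assms] this[OF assms(2,1)]
  have "vector_field M V (\<lambda>p. dder M V Y p (X p) - dder M V X p (Y p))"
    using subspace_diff[OF V vf_dder_in[OF assms(2)] vf_dder_in[OF assms(1)]]
    by (auto simp: vector_field_def smooth_on_def intro!: Ck_on_diff[OF M])
  then show ?thesis using assms by (simp add: lie_bracket_eq cong: vector_field_cong)
qed

text \<open>The direction \<open>Y q\<close> moves with the point, hence the first-order term next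
  to the second derivative of \<open>hat Z\<close>.\<close>

lemma dder_hat_cov_deriv:
  assumes "vector_field M V X" "vector_field M V Y" "vector_field M V Z" "p \<in> M"
  shows "dder M V (hat (cov_deriv M (levi_civita M V g) Y Z)) p (X p)
    = dder M V (hat Z) p (dder M V Y p (X p)) + dder M V (\<lambda>q. dder M V (hat Z) q (Y p)) p (X p)"
proof -
  have "hat (cov_deriv M (levi_civita M V g) Y Z) q = dder M V (hat Z) q (Y q)" if "q \<in> M" for q
    using assms that by (simp add: hat_def[of "cov_deriv _ _ _ _"] cov_deriv_levi_civita dF_cov_deriv)
  then have "dder M V (hat (cov_deriv M (levi_civita M V g) Y Z)) p (X p)
     = dder M V (\<lambda>q. dder M V (hat Z) q (Y q)) p (X p)"
    by (intro dder_cong assms)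
  also have "\<dots> = dder M V (hat Z) p (dder M V Y p (X p)) + dder M V (\<lambda>q. dder M V (hat Z) q (Y p)) p (X p)"
    by (rule dder_eq_on[OF M \<open>p \<in> M\<close> has_derivative_dder_apply[OF M smooth_hat[OF assms(3)] _ \<open>p \<in> M\<close> has_derivative_ident
          smooth_on_has_derivative[OF M vf_smooth[OF assms(2)] \<open>p \<in> M\<close>]]])
       (use assms in \<open>auto simp: vf_in\<close>)
  finally show ?thesis .
qed

text \<open>Under \<open>dF\<close> the second derivatives of \<open>hat Z\<close> cancel by
  symmetry, and the first-order terms that remain are the derivative of \<open>hat Z\<close> along
  the bracket.\<close>

lemma curvature_zero:
  assumes "vector_field M V X" "vector_field M V Y" "vector_field M V Z" "p \<in> M"
  shows "curvature M V g X Y Z p = 0"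
proof -
  define D where "D = cov_deriv M (levi_civita M V g)"
  have vf: "vector_field M V (D A B)" if "vector_field M V A" "vector_field M V B" for A B
    using that by (simp add: D_def vector_field_cov_deriv)
  have dFD: "dF p (D A B p) = dder M V (hat B) p (A p)" if "vector_field M V A" "vector_field M V B" for A B
    using that assms by (simp add: D_def cov_deriv_levi_civita dF_cov_deriv)
  note lin = smooth_on_linear_dder[OF M smooth_hat[OF assms(3)] assms(4)]
  let ?R = "D X (D Y Z) p - D Y (D X Z) p - D (lie_bracket M X Y) Z p"
  note L = vector_field_lie_bracket[OF assms(1,2)]
  have "?R \<in> V" using vf assms L by (intro subspace_diff[OF V] vf_in) auto
  moreover have "dF p ?R = 0"
    using dder_hat_cov_deriv[OF assms] dder_hat_cov_deriv[OF assms(2,1,3,4)]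
      dder_commute[OF M smooth_hat[OF assms(3)] assms(4), of "Y p" "X p"] assms
    by (simp add: linear_diff[OF linear_dF] dFD vf L lie_bracket_eq linear_diff[OF lin] flip: D_def)
  ultimately have "?R = 0"
    using dF_eq_iff[OF assms(4) _ subspace_0[OF V]] linear_0[OF linear_dF[OF assms(4)]] by metis
  then show ?thesis by (simp add: curvature_def D_def Let_def)
qed

section \<open>Parallel fields and geodesics\<close>

lemma dF_0: "p \<in> M \<Longrightarrow> dF p 0 = 0"
  using linear_0[OF linear_dF] .

lemma curve_velocity_in:
  assumes "is_interval I" "interior I \<noteq> {}" "\<gamma> ` I \<subseteq> M" "t \<in> I" "(\<gamma> has_vector_derivative v) (at t within I)"
  shows "v \<in> V"
  by (rule has_vector_derivative_in[OF M assms(3-5) at_within_interval_not_bot[OF assms(1,2,4)]])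

text \<open>The covariant derivative along a curve becomes an ordinary derivative under
  \<open>dF\<close>. Working within \<open>I\<close> includes the one-sided derivatives at its
  endpoints.\<close>

lemma has_vector_derivative_dF_curve:
  assumes "\<gamma> ` I \<subseteq> M" "t \<in> I" "(\<gamma> has_vector_derivative v) (at t within I)"
    and "(Y has_vector_derivative y) (at t within I)"
  shows "((\<lambda>s. dF (\<gamma> s) (Y s)) has_vector_derivative dF (\<gamma> t) (y + Gam (\<gamma> t) v (Y t))) (at t within I)"
proof -
  have t: "\<gamma> t \<in> M" using assms by auto
  have "((\<lambda>s. dF (\<gamma> s) (Y s)) has_derivative
     (\<lambda>\<tau>. dF (\<gamma> t) (\<tau> *\<^sub>R y) + dder M V (\<lambda>q. dF q (Y t)) (\<gamma> t) (\<tau> *\<^sub>R v))) (at t within I)"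
    by (rule has_derivative_dder_apply[OF M F assms(1,2) assms(3,4)[unfolded has_vector_derivative_def]])
  then show ?thesis
    unfolding has_vector_derivative_def
    by (simp add: linear_add[OF linear_dF] linear_cmul[OF linear_dF] linear_cmul[OF smooth_on_linear_dder[OF M smooth_dF]]
       dF_Gam t scaleR_add_right)
qed

lemma has_vector_derivative_F_curve:
  assumes "\<gamma> ` I \<subseteq> M" "t \<in> I" "(\<gamma> has_vector_derivative v) (at t within I)"
  shows "((\<lambda>s. F (\<gamma> s)) has_vector_derivative dF (\<gamma> t) v) (at t within I)"
proof -
  have t: "\<gamma> t \<in> M" using assms by auto
  have "((\<lambda>s. F (\<gamma> s)) has_derivative (\<lambda>\<tau>. dF (\<gamma> t) (\<tau> *\<^sub>R v))) (at t within I)"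
    by (rule has_derivative_compose_on[OF assms(3)[unfolded has_vector_derivative_def] smooth_on_has_derivative[OF M F t] assms(1)])
  then show ?thesis
    unfolding has_vector_derivative_def by (simp add: linear_cmul[OF linear_dF[OF t]])
qed

lemma parallel_along_iff:
  assumes I: "is_interval I" "interior I \<noteq> {}" and \<gamma>: "\<gamma> ` I \<subseteq> M"
    and v: "\<And>t. t \<in> I \<Longrightarrow> (\<gamma> has_vector_derivative v t) (at t within I)"
  shows "parallel_along V (levi_civita M V g) I \<gamma> Y \<longleftrightarrow>
    Y ` I \<subseteq> V \<and> (\<exists>c\<in>W. \<forall>t\<in>I. dF (\<gamma> t) (Y t) = c)"
proof safe
  assume "parallel_along V (levi_civita M V g) I \<gamma> Y"
  then obtain \<gamma>' Y' where Y: "Y ` I \<subseteq> V" and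
    *: "\<And>t. t \<in> I \<Longrightarrow> (\<gamma> has_vector_derivative \<gamma>' t) (at t within I)"
       "\<And>t. t \<in> I \<Longrightarrow> (Y has_vector_derivative Y' t) (at t within I)"
       "\<And>t. t \<in> I \<Longrightarrow> Y' t + levi_civita M V g (\<gamma> t) (\<gamma>' t) (Y t) = 0"
    unfolding parallel_along_def by blast
  show "Y t \<in> V" if "t \<in> I" for t using Y that by auto
  have "((\<lambda>s. dF (\<gamma> s) (Y s)) has_vector_derivative 0) (at t within I)" if "t \<in> I" for t
  proof -
    have "\<gamma> t \<in> M" "Y t \<in> V" "\<gamma>' t \<in> V" using that \<gamma> Y curve_velocity_in[OF I \<gamma> that *(1)] by auto
    then show ?thesis
      using has_vector_derivative_dF_curve[OF \<gamma> that *(1,2)[OF that]] *(3)[OF that]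
      by (simp add: levi_civita_eq dF_0)
  qed
  from zero_vector_derivative_constant[OF I(1) this]
  obtain c where c: "\<And>t. t \<in> I \<Longrightarrow> dF (\<gamma> t) (Y t) = c" by blast
  moreover obtain t0 where "t0 \<in> I" using I(2) interior_subset by blast
  ultimately have "c \<in> W" using dF_in \<gamma> by (metis image_subset_iff)
  then show "\<exists>c\<in>W. \<forall>t\<in>I. dF (\<gamma> t) (Y t) = c" using c by blast
next
  fix c assume Y: "Y ` I \<subseteq> V" and c: "c \<in> W" "\<forall>t\<in>I. dF (\<gamma> t) (Y t) = c"
  \<comment> \<open>Differentiability of \<open>Y\<close> is part of being parallel; it is inherited
    from this expression.\<close>
  have Y_eq: "Y t = dG (F (\<gamma> t)) c" if "t \<in> I" for t
  proof -
    have "\<gamma> t \<in> M" "Y t \<in> V" using Y \<gamma> that by auto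
    from dG_dF[OF this] show ?thesis using c that by simp
  qed
  define Y' where "Y' t = dder W W (\<lambda>w. dG w c) (F (\<gamma> t)) (dF (\<gamma> t) (v t))" for t
  have Y': "(Y has_vector_derivative Y' t) (at t within I)" if "t \<in> I" for t
  proof -
    have t: "F (\<gamma> t) \<in> W" using that \<gamma> F_in by auto
    have im: "(\<lambda>s. F (\<gamma> s)) ` I \<subseteq> W" using \<gamma> F_in by auto
    have "((\<lambda>s. dG (F (\<gamma> s)) c) has_derivative
        (\<lambda>\<tau>. dder W W (\<lambda>w. dG w c) (F (\<gamma> t)) (\<tau> *\<^sub>R dF (\<gamma> t) (v t)))) (at t within I)"
      by (rule has_derivative_compose_on[OF has_vector_derivative_F_curve[OF \<gamma> that v[OF that], unfolded has_vector_derivative_def]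
           smooth_on_has_derivative[OF WW smooth_on_dder[OF WW G] t] im])
    then have "((\<lambda>s. dG (F (\<gamma> s)) c) has_vector_derivative Y' t) (at t within I)"
      unfolding has_vector_derivative_def Y'_def
      by (simp add: linear_cmul[OF smooth_on_linear_dder[OF WW smooth_on_dder[OF WW G] t]])
    then show ?thesis
      unfolding has_vector_derivative_def
      by (rule has_derivative_transform[OF that, rotated]) (rule Y_eq)
  qed
  have "Y' t + levi_civita M V g (\<gamma> t) (v t) (Y t) = 0" if "t \<in> I" for t
  proof -
    note bot = at_within_interval_not_bot[OF I that]
    have t: "\<gamma> t \<in> M" "Y t \<in> V" "v t \<in> V" using that \<gamma> Y curve_velocity_in[OF I \<gamma> that v] by auto
    \<comment> \<open>\<open>dF\<close> is known to be injective on \<open>V\<close> only, so the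
      derivative of \<open>Y\<close> must first be placed in \<open>V\<close>.\<close>
    have Y'V: "Y' t \<in> V" by (rule has_vector_derivative_in[OF VV Y that Y'[OF that] bot])
    have "((\<lambda>s. dF (\<gamma> s) (Y s)) has_vector_derivative 0) (at t within I)"
      unfolding has_vector_derivative_def
      by (rule has_derivative_transform[OF that, where f="\<lambda>_. c"]) (use c in auto)
    then have "dF (\<gamma> t) (Y' t + Gam (\<gamma> t) (v t) (Y t)) = 0"
      by (rule vector_derivative_unique_within[OF bot has_vector_derivative_dF_curve[OF \<gamma> that v[OF that] Y'[OF that]]])
    then have "Y' t + Gam (\<gamma> t) (v t) (Y t) = 0"
      using dF_eq_iff[OF t(1) _ subspace_0[OF V]] Y'V Gam_in[OF t(1)] dF_0[OF t(1)] subspace_add[OF V] by metis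
    then show ?thesis using t by (simp add: levi_civita_eq)
  qed
  then show "parallel_along V (levi_civita M V g) I \<gamma> Y"
    using Y v Y' unfolding parallel_along_def by blast
qed

lemma line_in: "a \<in> W \<Longrightarrow> b \<in> W \<Longrightarrow> a + t *\<^sub>R b \<in> W"
  using W by (simp add: subspace_add subspace_scale)

lemma has_vector_derivative_G_line:
  assumes "a \<in> W" "b \<in> W"
  shows "((\<lambda>t. G (a + t *\<^sub>R b)) has_vector_derivative dG (a + t *\<^sub>R b) b) (at t within S)"
  using has_derivative_line[OF WW line_in[OF assms] assms(2) smooth_on_has_derivative[OF WW G line_in[OF assms]]]
  by (rule has_vector_derivative_at_within)

text \<open>The velocity is parallel exactly when \<open>dF\<close> makes it constant, and then
  \<open>F\<close> composed with the curve has constant velocity \<open>b\<close>.\<close>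

lemma geodesic_on_iff:
  "geodesic_on M V g I \<gamma> \<longleftrightarrow>
    is_interval I \<and> interior I \<noteq> {} \<and> (\<exists>a\<in>W. \<exists>b\<in>W. \<forall>t\<in>I. \<gamma> t = G (a + t *\<^sub>R b))"
proof (intro iffI conjI)
  assume geo: "geodesic_on M V g I \<gamma>"
  then show I: "is_interval I" "interior I \<noteq> {}" by (auto simp: geodesic_on_def)
  from geo obtain v where \<gamma>: "\<gamma> ` I \<subseteq> M" and v: "\<And>t. t \<in> I \<Longrightarrow> (\<gamma> has_vector_derivative v t) (at t within I)"
    and par: "parallel_along V (levi_civita M V g) I \<gamma> v"
    unfolding geodesic_on_def by blast
  obtain b where b: "b \<in> W" "\<And>t. t \<in> I \<Longrightarrow> dF (\<gamma> t) (v t) = b"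
    using parallel_along_iff[THEN iffD1, OF I \<gamma> v par] by blast
  \<comment> \<open>Subtracting the linear motion leaves a constant, which becomes the base point
    \<open>a\<close>.\<close>
  have "((\<lambda>s. F (\<gamma> s) - s *\<^sub>R b) has_vector_derivative 0) (at t within I)" if "t \<in> I" for t
    using has_vector_derivative_F_curve[OF \<gamma> that v[OF that]] b(2)[OF that]
    by (auto intro!: derivative_eq_intros)
  from zero_vector_derivative_constant[OF I(1) this]
  obtain a where a: "\<And>t. t \<in> I \<Longrightarrow> F (\<gamma> t) - t *\<^sub>R b = a" by blast
  have eq: "F (\<gamma> t) = a + t *\<^sub>R b" if "t \<in> I" for t using a[OF that] by (simp add: algebra_simps)
  \<comment> \<open>Nonempty interior provides a parameter at which membership of \<open>a\<close>
    in \<open>W\<close> can be read off.\<close>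
  obtain t0 where t0: "t0 \<in> I" using I(2) interior_subset by blast
  then have "F (\<gamma> t0) - t0 *\<^sub>R b \<in> W"
    using \<gamma> F_in b by (intro subspace_diff[OF W] subspace_scale[OF W]) auto
  then have "a \<in> W" using a t0 by simp
  moreover have "\<gamma> t = G (a + t *\<^sub>R b)" if "t \<in> I" for t
    using eq[OF that] GF[of "\<gamma> t"] \<gamma> that by auto
  ultimately show "\<exists>a\<in>W. \<exists>b\<in>W. \<forall>t\<in>I. \<gamma> t = G (a + t *\<^sub>R b)" using b by blast
next
  assume *: "is_interval I \<and> interior I \<noteq> {} \<and> (\<exists>a\<in>W. \<exists>b\<in>W. \<forall>t\<in>I. \<gamma> t = G (a + t *\<^sub>R b))"
  then obtain a b where I: "is_interval I" "interior I \<noteq> {}" and ab: "a \<in> W" "b \<in> W"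
    and eq: "\<And>t. t \<in> I \<Longrightarrow> \<gamma> t = G (a + t *\<^sub>R b)" by blast
  define v where "v t = dG (a + t *\<^sub>R b) b" for t
  have \<gamma>: "\<gamma> ` I \<subseteq> M" using eq G_in line_in[OF ab] by auto
  have v: "(\<gamma> has_vector_derivative v t) (at t within I)" if "t \<in> I" for t
    unfolding v_def has_vector_derivative_def
    by (rule has_derivative_transform[OF that eq has_vector_derivative_G_line[OF ab, unfolded has_vector_derivative_def]])
  have "dF (\<gamma> t) (v t) = b" if "t \<in> I" for t
    using dF_dG[OF G_in[OF line_in[OF ab]] ab(2)] FG[OF line_in[OF ab]] eq[OF that] by (simp add: v_def)
  moreover have "v ` I \<subseteq> V" using dG_in[OF line_in[OF ab]] by (auto simp: v_def)
  ultimately have "parallel_along V (levi_civita M V g) I \<gamma> v"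
    using ab by (intro parallel_along_iff[THEN iffD2, OF I \<gamma> v]) auto
  then show "geodesic_on M V g I \<gamma>"
    using I \<gamma> v unfolding geodesic_on_def by blast
qed

lemma unit_interval_nondegenerate: "is_interval {0..1::real}" "interior {0..1::real} \<noteq> {}"
  by (auto simp: is_interval_cc)

lemma geodesic_between_iff:
  assumes "p \<in> M" "q \<in> M" "is_interval I" "0 \<in> I" "1 \<in> I"
  shows "geodesic_on M V g I \<gamma> \<and> \<gamma> 0 = p \<and> \<gamma> 1 = q \<longleftrightarrow>
    (\<forall>t\<in>I. \<gamma> t = G ((1 - t) *\<^sub>R F p + t *\<^sub>R F q))"
proof -
  have line: "(1 - t) *\<^sub>R F p + t *\<^sub>R F q = F p + t *\<^sub>R (F q - F p)" for t
    by (simp add: algebra_simps)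
  \<comment> \<open>Containing 0 and 1 already makes the interval nondegenerate.\<close>
  have "{0..1} \<subseteq> I" using mem_is_interval_1_I[OF assms(3-5)] by auto
  then have I: "interior I \<noteq> {}" using interior_mono[of "{0..1}" I] by auto
  show ?thesis
  proof safe
    fix t assume "geodesic_on M V g I \<gamma>" and pq: "p = \<gamma> 0" "q = \<gamma> 1" and "t \<in> I"
    then obtain a b where ab: "a \<in> W" "b \<in> W" and eq: "\<And>t. t \<in> I \<Longrightarrow> \<gamma> t = G (a + t *\<^sub>R b)"
      unfolding geodesic_on_iff by blast
    have "F p = a" "F q = a + b"
      using pq eq[OF \<open>0 \<in> I\<close>] eq[OF \<open>1 \<in> I\<close>] FG[OF line_in[OF ab]] by (metis scale_zero_left add_0_right, metis scaleR_one)
    then show "\<gamma> t = G ((1 - t) *\<^sub>R F (\<gamma> 0) + t *\<^sub>R F (\<gamma> 1))"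
      using eq[OF \<open>t \<in> I\<close>] pq by (simp add: algebra_simps)
  next
    assume *: "\<forall>t\<in>I. \<gamma> t = G ((1 - t) *\<^sub>R F p + t *\<^sub>R F q)"
    have "F p \<in> W" "F q - F p \<in> W" using assms F_in subspace_diff[OF W] by auto
    then show "geodesic_on M V g I \<gamma>"
      unfolding geodesic_on_iff using assms(3) I * by (auto simp: line)
    show "\<gamma> 0 = p" "\<gamma> 1 = q" using * assms GF by auto
  qed
qed

lemma geodesic_from_iff:
  assumes "p \<in> M" "X \<in> V" "is_interval I" "interior I \<noteq> {}" "0 \<in> I"
  shows "geodesic_on M V g I \<gamma> \<and> \<gamma> 0 = p \<and> (\<gamma> has_vector_derivative X) (at 0 within I) \<longleftrightarrow>
    (\<forall>t\<in>I. \<gamma> t = G (F p + t *\<^sub>R dF p X))"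
proof safe
  fix t assume "geodesic_on M V g I \<gamma>" and p: "p = \<gamma> 0" and X: "(\<gamma> has_vector_derivative X) (at 0 within I)" and "t \<in> I"
  then obtain a b where ab: "a \<in> W" "b \<in> W" and eq: "\<And>t. t \<in> I \<Longrightarrow> \<gamma> t = G (a + t *\<^sub>R b)"
    unfolding geodesic_on_iff by blast
  have a: "F p = a"
    using p eq[OF \<open>0 \<in> I\<close>] FG[OF ab(1)] by simp
  have "(\<gamma> has_vector_derivative dG (a + 0 *\<^sub>R b) b) (at 0 within I)"
    unfolding has_vector_derivative_def
    by (rule has_derivative_transform[OF \<open>0 \<in> I\<close> eq has_vector_derivative_G_line[OF ab, unfolded has_vector_derivative_def]])
  \<comment> \<open>Both vectors are derivatives at 0 within \<open>I\<close>. As 0 may be an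
    endpoint, their equality rests on \<open>I\<close> being nondegenerate.\<close>
  then have "X = dG a b"
    using vector_derivative_unique_within[OF at_within_interval_not_bot[OF assms(3-5)] X] by simp
  then have "b = dF p X" using dF_dG[OF assms(1) ab(2)] a by simp
  then show "\<gamma> t = G (F (\<gamma> 0) + t *\<^sub>R dF (\<gamma> 0) X)" using eq[OF \<open>t \<in> I\<close>] a p by simp
next
  assume *: "\<forall>t\<in>I. \<gamma> t = G (F p + t *\<^sub>R dF p X)"
  have ab: "F p \<in> W" "dF p X \<in> W" using assms F_in dF_in by auto
  then show "geodesic_on M V g I \<gamma>" unfolding geodesic_on_iff using * assms by blast
  show "\<gamma> 0 = p" using * assms GF by auto
  have "(\<gamma> has_vector_derivative dG (F p + 0 *\<^sub>R dF p X) (dF p X)) (at 0 within I)"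
    unfolding has_vector_derivative_def
    by (rule has_derivative_transform[OF \<open>0 \<in> I\<close> _ has_vector_derivative_G_line[OF ab, unfolded has_vector_derivative_def]])
       (use * in blast)
  then show "(\<gamma> has_vector_derivative X) (at 0 within I)" using dG_dF[OF assms(1,2)] by simp
qed

section \<open>Exponential map, logarithm and parallel transport\<close>

lemma riem_exp_eq:
  assumes "p \<in> M" "X \<in> V"
  shows "riem_exp M V g p X = G (F p + dF p X)"
proof -
  note iff = geodesic_from_iff[OF assms unit_interval_nondegenerate, simplified]
  show ?thesis
    unfolding riem_exp_def
  proof (rule the_equality)
    show "\<exists>\<gamma>. geodesic_on M V g {0..1} \<gamma> \<and> \<gamma> 0 = p \<and>
        (\<gamma> has_vector_derivative X) (at 0 within {0..1}) \<and> \<gamma> 1 = G (F p + dF p X)"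
      using iff[of "\<lambda>t. G (F p + t *\<^sub>R dF p X)"] by (intro exI[of _ "\<lambda>t. G (F p + t *\<^sub>R dF p X)"]) simp
  next
    fix q assume "\<exists>\<gamma>. geodesic_on M V g {0..1} \<gamma> \<and> \<gamma> 0 = p \<and>
        (\<gamma> has_vector_derivative X) (at 0 within {0..1}) \<and> \<gamma> 1 = q"
    then obtain \<gamma> where \<gamma>: "\<forall>t\<in>{0..1}. \<gamma> t = G (F p + t *\<^sub>R dF p X)" "\<gamma> 1 = q" using iff by blast
    from \<gamma>(1)[rule_format, of 1] \<gamma>(2) show "q = G (F p + dF p X)" by simp
  qed
qed

lemma riem_log_eq:
  assumes "p \<in> M" "q \<in> M"
  shows "riem_log M V g p q = dG (F p) (F q - F p)"
  unfolding riem_log_def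
proof (rule the_inv_into_f_eq)
  show "inj_on (riem_exp M V g p) V"
  proof (rule inj_onI)
    fix X Y assume XY: "X \<in> V" "Y \<in> V" "riem_exp M V g p X = riem_exp M V g p Y"
    then have "F (G (F p + dF p X)) = F (G (F p + dF p Y))" using assms by (simp add: riem_exp_eq)
    then have "dF p X = dF p Y" using assms F_in dF_in by (simp add: FG subspace_add[OF W])
    then show "X = Y" using dF_eq_iff assms XY by blast
  qed
  have *: "F q - F p \<in> W" using assms F_in subspace_diff[OF W] by blast
  show V: "dG (F p) (F q - F p) \<in> V" using dG_in F_in assms by blast
  show "riem_exp M V g p (dG (F p) (F q - F p)) = q"
    using assms dF_dG[OF assms(1) *] V by (simp add: riem_exp_eq GF)
qed

lemma the_inv_into_frechet:
  assumes "p \<in> M" "y \<in> W"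
  shows "the_inv_into V (frechet_derivative F (at p within M)) y = dG (F p) y"
proof (rule the_inv_into_f_eq)
  show "inj_on (frechet_derivative F (at p within M)) V"
    using dF_eq_iff[OF assms(1)] by (auto simp: inj_on_def dder_on[OF M])
  show "dG (F p) y \<in> V" using dG_in F_in assms by blast
  then show "frechet_derivative F (at p within M) (dG (F p) y) = y"
    using dF_dG[OF assms] by (simp add: dder_on[OF M])
qed

lemma parallel_transport_eq:
  assumes "p \<in> M" "q \<in> M" "X \<in> V"
  shows "parallel_transport M V g p q X = dG (F q) (dF p X)"
  unfolding parallel_transport_def
proof (rule the_equality)
  let ?\<gamma> = "\<lambda>t. G ((1 - t) *\<^sub>R F p + t *\<^sub>R F q)"
  \<comment> \<open>The field along the geodesic whose image under \<open>dF\<close> is constantly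
    \<open>dF p X\<close>.\<close>
  let ?Y = "\<lambda>t. dG ((1 - t) *\<^sub>R F p + t *\<^sub>R F q) (dF p X)"
  have in_W: "(1 - t) *\<^sub>R F p + t *\<^sub>R F q \<in> W" for t
    using assms F_in W by (simp add: subspace_add subspace_scale)
  have geo: "geodesic_on M V g {0..1} ?\<gamma> \<and> ?\<gamma> 0 = p \<and> ?\<gamma> 1 = q"
    by (rule geodesic_between_iff[OF assms(1,2) unit_interval_nondegenerate(1), THEN iffD2]) auto
  then obtain v where \<gamma>: "?\<gamma> ` {0..1} \<subseteq> M" and
    v: "\<And>t. t \<in> {0..1} \<Longrightarrow> (?\<gamma> has_vector_derivative v t) (at t within {0..1})"
    unfolding geodesic_on_def by blast
  have "?Y ` {0..1} \<subseteq> V" using dG_in[OF in_W] by blast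
  moreover have "dF (?\<gamma> t) (?Y t) = dF p X" for t
    using dF_dG[OF G_in[OF in_W] dF_in[OF assms(1)]] FG[OF in_W] by simp
  ultimately have "parallel_along V (levi_civita M V g) {0..1} ?\<gamma> ?Y"
    using dF_in[OF assms(1)] by (intro parallel_along_iff[THEN iffD2, OF unit_interval_nondegenerate \<gamma> v]) auto
  moreover have "?Y 0 = X" "?Y 1 = dG (F q) (dF p X)" using dG_dF assms by auto
  ultimately show "\<exists>\<gamma> Y. geodesic_on M V g {0..1} \<gamma> \<and> \<gamma> 0 = p \<and> \<gamma> 1 = q \<and>
     parallel_along V (levi_civita M V g) {0..1} \<gamma> Y \<and> Y 0 = X \<and> Y 1 = dG (F q) (dF p X)"
    using geo by blast
next
  fix Z assume "\<exists>\<gamma> Y. geodesic_on M V g {0..1} \<gamma> \<and> \<gamma> 0 = p \<and> \<gamma> 1 = q \<and>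
     parallel_along V (levi_civita M V g) {0..1} \<gamma> Y \<and> Y 0 = X \<and> Y 1 = Z"
  then obtain \<gamma> Y where geo: "geodesic_on M V g {0..1} \<gamma>" and pq: "\<gamma> 0 = p" "\<gamma> 1 = q"
    and par: "parallel_along V (levi_civita M V g) {0..1} \<gamma> Y" and Y: "Y 0 = X" "Y 1 = Z" by blast
  from geo obtain v where \<gamma>: "\<gamma> ` {0..1} \<subseteq> M" and
    v: "\<And>t. t \<in> {0..1} \<Longrightarrow> (\<gamma> has_vector_derivative v t) (at t within {0..1})"
    unfolding geodesic_on_def by blast
  obtain c where "Y ` {0..1} \<subseteq> V" "\<And>t. t \<in> {0..1} \<Longrightarrow> dF (\<gamma> t) (Y t) = c"
    using parallel_along_iff[THEN iffD1, OF unit_interval_nondegenerate \<gamma> v par] by blast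
  from this(1) this(2)[of 0] this(2)[of 1] have "Z \<in> V" "dF p X = dF q Z" using pq Y by auto
  then show "Z = dG (F q) (dF p X)" using dG_dF assms by simp
qed

lemma geodesically_complete: "geodesically_complete M V g"
  unfolding geodesically_complete_def
proof (intro ballI)
  fix p X assume "p \<in> M" "X \<in> V"
  from geodesic_from_iff[OF this, of UNIV "\<lambda>t. G (F p + t *\<^sub>R dF p X)"]
  show "\<exists>\<gamma>. geodesic_on M V g UNIV \<gamma> \<and> \<gamma> 0 = p \<and> (\<gamma> has_vector_derivative X) (at 0)"
    by (intro exI[of _ "\<lambda>t. G (F p + t *\<^sub>R dF p X)"]) simp
qed

section \<open>Length of curves and distance\<close>

lemma has_vector_derivative_ipe:
  "(f has_vector_derivative f') net \<Longrightarrow> ((\<lambda>t. ipe e (f t)) has_vector_derivative ipe e f') net"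
  by (rule bounded_linear.has_vector_derivative[OF B.bounded_linear_right])

text \<open>Integrating the slope of \<open>ipe e (F (\<gamma> t))\<close> gives
  \<open>ipe e e\<close>, while this slope is at most \<open>sqrt (ipe e e)\<close> times the
  speed.\<close>

lemma curve_length_ge:
  assumes \<gamma>: "valid_path \<gamma>" "path_image \<gamma> \<subseteq> M" and pq: "pathstart \<gamma> = p" "pathfinish \<gamma> = q"
    and L: "((\<lambda>t. let v = vector_derivative \<gamma> (at t) in sqrt (g (\<gamma> t) v v)) has_integral L) {0..1}"
  shows "sqrt (ipe (F q - F p) (F q - F p)) \<le> L"
proof -
  define e where "e = F q - F p"
  have im: "\<gamma> ` {0..1} \<subseteq> M" using \<gamma>(2) by (simp add: path_image_def)
  have "p \<in> M" "q \<in> M" using \<gamma>(2) pq pathstart_in_path_image pathfinish_in_path_image by blast+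
  then have e: "e \<in> W" by (simp add: e_def F_in subspace_diff[OF W])
  obtain S D where S: "finite S" and D: "\<And>t. t \<in> {0..1} - S \<Longrightarrow> (\<gamma> has_vector_derivative D t) (at t)"
    using \<gamma>(1) unfolding valid_path_def piecewise_C1_differentiable_on_def C1_differentiable_on_def by blast
  have cont: "continuous_on {0..1} \<gamma>"
    using \<gamma>(1) unfolding valid_path_def piecewise_C1_differentiable_on_def by blast
  let ?good = "\<lambda>t. t \<in> {0<..<1} - S"
  let ?speed = "\<lambda>t. sqrt (ipe (dF (\<gamma> t) (D t)) (dF (\<gamma> t) (D t)))"
  let ?slope = "\<lambda>t. ipe e (dF (\<gamma> t) (D t))"
  have good: "\<gamma> t \<in> M" "(\<gamma> has_vector_derivative D t) (at t within {0..1})" "D t \<in> V" if "?good t" for t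
  proof -
    show "\<gamma> t \<in> M" using im that by auto
    show 1: "(\<gamma> has_vector_derivative D t) (at t within {0..1})"
      by (rule has_vector_derivative_at_within, rule D) (use that in auto)
    show "D t \<in> V" by (rule curve_velocity_in[OF unit_interval_nondegenerate im _ 1]) (use that in auto)
  qed
  \<comment> \<open>Resetting the integrand to 0 at finitely many parameters keeps the integral and
    lets the comparison of slope and speed hold at every parameter.\<close>
  have "((\<lambda>t. if ?good t then ?speed t else 0) has_integral L) {0..1}"
  proof (rule has_integral_spike_finite[OF _ _ L])
    show "finite (S \<union> {0, 1})" using S by simp
    fix t :: real assume t: "t \<in> {0..1} - (S \<union> {0, 1})"
    then have "vector_derivative \<gamma> (at t) = D t"
      using D by (intro vector_derivative_at) auto
    moreover have "?good t" using t by auto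
    ultimately show "(if ?good t then ?speed t else 0) = (let v = vector_derivative \<gamma> (at t) in sqrt (g (\<gamma> t) v v))"
      using good[of t] dF_in[of "\<gamma> t"] by (simp add: Let_def g_eq ipe_eq)
  qed
  from has_integral_mult_right[OF this, of "sqrt (ipe e e)"]
  have len: "((\<lambda>t. sqrt (ipe e e) * (if ?good t then ?speed t else 0)) has_integral sqrt (ipe e e) * L) {0..1}" .
  have contF: "continuous_on {0..1} (\<lambda>t. F (\<gamma> t))"
    using continuous_on_compose2[OF _ cont im] F Ck_on_continuous[OF M] unfolding smooth_on_def by blast
  have "((\<lambda>t. if ?good t then ?slope t else 0) has_integral ipe e (F (\<gamma> 1)) - ipe e (F (\<gamma> 0))) {0..1}"
  \<comment> \<open>Only continuity is required on \<open>S\<close>, so the slope is integrable even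
    when the velocity has no limits there.\<close>
  proof (rule fundamental_theorem_of_calculus_interior_strong[OF S])
    show "continuous_on {0..1} (\<lambda>t. ipe e (F (\<gamma> t)))"
      by (rule B.continuous_on[OF continuous_on_const contF])
    fix t assume t: "?good t"
    then have "((\<lambda>t. ipe e (F (\<gamma> t))) has_vector_derivative ?slope t) (at t within {0..1})"
      by (intro has_vector_derivative_ipe has_vector_derivative_F_curve[OF im _ good(2)[OF t]]) auto
    then show "((\<lambda>t. ipe e (F (\<gamma> t))) has_vector_derivative (if ?good t then ?slope t else 0)) (at t)"
      using t by (simp add: at_within_Icc_at)
  qed simp
  moreover have "F (\<gamma> 1) - F (\<gamma> 0) = e" using pq by (simp add: e_def pathstart_def pathfinish_def)
  ultimately have "((\<lambda>t. if ?good t then ?slope t else 0) has_integral ipe e e) {0..1}"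
    by (simp flip: B.diff_right)
  then have le: "ipe e e \<le> sqrt (ipe e e) * L"
    using ipe_Cauchy_Schwarz[OF e] good dF_in by (intro has_integral_le[OF _ len]) auto
  \<comment> \<open>Needed for coinciding endpoints, where the inequality cannot be divided by
    \<open>sqrt (ipe e e)\<close>.\<close>
  have "0 \<le> L"
    using good dF_in ipe_nonneg
    by (intro has_integral_nonneg[OF \<open>((\<lambda>t. if ?good t then ?speed t else 0) has_integral L) {0..1}\<close>]) auto
  have "sqrt (ipe e e) \<le> L"
  proof (cases "ipe e e = 0")
    case False
    then have "0 < sqrt (ipe e e)" using ipe_nonneg[OF e] by simp
    moreover have "sqrt (ipe e e) * sqrt (ipe e e) \<le> sqrt (ipe e e) * L"
      using le ipe_nonneg[OF e] by simp
    ultimately show ?thesis by (rule mult_left_le_imp_le[rotated])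
  qed (use \<open>0 \<le> L\<close> in simp)
  then show ?thesis by (simp add: e_def)
qed

text \<open>The infimum is attained by the image of the straight segment, whose speed is
  constant.\<close>

lemma riem_dist_eq:
  assumes "p \<in> M" "q \<in> M"
  shows "riem_dist M g p q = sqrt (ipe (F q - F p) (F q - F p))"
  unfolding riem_dist_def
proof (rule cInf_eq_minimum)
  define b where "b = F q - F p"
  define \<gamma> where "\<gamma> t = G (F p + t *\<^sub>R b)" for t
  have ab: "F p \<in> W" "b \<in> W" using assms by (auto simp: b_def F_in subspace_diff[OF W])
  note W_line = line_in[OF ab]
  have D: "(\<gamma> has_vector_derivative dG (F p + t *\<^sub>R b) b) (at t)" for t
    unfolding \<gamma>_def by (rule has_vector_derivative_G_line[OF ab])
  have "continuous_on W (\<lambda>w. dG w b)"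
    using smooth_on_dder[OF WW G] Ck_on_continuous[OF WW] unfolding smooth_on_def by blast
  then have "continuous_on {0..1} (\<lambda>t::real. dG (F p + t *\<^sub>R b) b)"
    by (rule continuous_on_compose2) (use W_line in \<open>auto intro!: continuous_intros\<close>)
  then have "\<gamma> C1_differentiable_on {0..1}"
    using D unfolding C1_differentiable_on_def by (intro exI[of _ "\<lambda>t. dG (F p + t *\<^sub>R b) b"]) simp
  then have "valid_path \<gamma>" unfolding valid_path_def by (rule C1_differentiable_imp_piecewise)
  moreover have "path_image \<gamma> \<subseteq> M" using G_in W_line by (auto simp: path_image_def \<gamma>_def)
  moreover have "pathstart \<gamma> = p" "pathfinish \<gamma> = q"
    using assms by (auto simp: pathstart_def pathfinish_def \<gamma>_def GF b_def)
  moreover have "(let v = vector_derivative \<gamma> (at t) in sqrt (g (\<gamma> t) v v)) = sqrt (ipe b b)" for t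
    using vector_derivative_at[OF D, of t] dG_in[OF W_line] dF_dG[OF G_in[OF W_line[of t]] ab(2)] FG[OF W_line] ab
    by (simp add: Let_def g_eq ipe_eq \<gamma>_def)
  then have "((\<lambda>t. let v = vector_derivative \<gamma> (at t) in sqrt (g (\<gamma> t) v v)) has_integral sqrt (ipe b b)) {0..1}"
    using has_integral_const_real[of "sqrt (ipe b b)" 0 1] by simp
  ultimately show "sqrt (ipe (F q - F p) (F q - F p)) \<in> {L. \<exists>\<gamma>. valid_path \<gamma> \<and> path_image \<gamma> \<subseteq> M \<and> pathstart \<gamma> = p \<and> pathfinish \<gamma> = q \<and>
       ((\<lambda>t. let v = vector_derivative \<gamma> (at t) in sqrt (g (\<gamma> t) v v)) has_integral L) {0..1}}"
    unfolding b_def by blast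
qed (use curve_length_ge in blast)

section \<open>Frechet means\<close>

lemma frechet_means_eq:
  assumes "k \<ge> 1" "\<And>i. i \<in> {1..k} \<Longrightarrow> P i \<in> M"
  shows "frechet_means M g k P = {G ((1 / real k) *\<^sub>R (\<Sum>i=1..k. F (P i)))}"
proof -
  define m where "m = (1 / real k) *\<^sub>R (\<Sum>i=1..k. F (P i))"
  have mW: "m \<in> W"
    using assms F_in unfolding m_def by (intro subspace_scale[OF W] subspace_sum[OF W]) auto
  define V0 where "V0 = (\<Sum>i=1..k. ipe (F (P i) - m) (F (P i) - m))"
  have km: "(\<Sum>i=1..k. F (P i) - m) = 0"
    using assms(1) by (simp add: m_def sum_subtractf sum_constant_scaleR del: One_nat_def)
  \<comment> \<open>Decomposition of the total squared distance around the mean \<open>m\<close>: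
    the cross terms sum to zero by \<open>km\<close>, so the dependence on \<open>C\<close> is
    \<open>k\<close> times a squared distance from \<open>m\<close>.\<close>
  have var: "(\<Sum>i=1..k. (riem_dist M g C (P i))\<^sup>2) = V0 + real k * ipe (m - F C) (m - F C)" if "C \<in> M" for C
  proof -
    have "(\<Sum>i=1..k. (riem_dist M g C (P i))\<^sup>2) = (\<Sum>i=1..k. ipe (F (P i) - F C) (F (P i) - F C))"
    proof (rule sum.cong[OF refl])
      fix i assume "i \<in> {1..k}"
      then have "F (P i) - F C \<in> W" using assms that by (simp add: F_in subspace_diff[OF W])
      then show "(riem_dist M g C (P i))\<^sup>2 = ipe (F (P i) - F C) (F (P i) - F C)"
        using assms(2)[OF \<open>i \<in> {1..k}\<close>] that ipe_nonneg by (simp add: riem_dist_eq)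
    qed
    also have "\<dots> = (\<Sum>i=1..k. ipe (F (P i) - m) (F (P i) - m) + 2 * ipe (F (P i) - m) (m - F C) + ipe (m - F C) (m - F C))"
    proof (rule sum.cong[OF refl])
      fix i
      have "F (P i) - F C = (F (P i) - m) + (m - F C)" by simp
      then show "ipe (F (P i) - F C) (F (P i) - F C) = ipe (F (P i) - m) (F (P i) - m) + 2 * ipe (F (P i) - m) (m - F C) + ipe (m - F C) (m - F C)"
        using ipe_commute[of "m - F C" "F (P i) - m"] by (simp only: B.add_left B.add_right)
    qed
    also have "\<dots> = V0 + 2 * ipe (\<Sum>i=1..k. F (P i) - m) (m - F C) + real k * ipe (m - F C) (m - F C)"
      by (simp add: sum.distrib V0_def B.sum_left sum_distrib_left)
    finally show ?thesis using km by (simp add: B.zero_left)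
  qed
  have GmM: "G m \<in> M" and FGm: "F (G m) = m" using G_in FG mW by auto
  have diffW: "m - F C \<in> W" if "C \<in> M" for C using that mW by (simp add: F_in subspace_diff[OF W])
  have "C \<in> frechet_means M g k P \<longleftrightarrow> C = G m" for C
  proof
    assume "C \<in> frechet_means M g k P"
    then have C: "C \<in> M" and "V0 + real k * ipe (m - F C) (m - F C) \<le> V0 + real k * ipe (m - F (G m)) (m - F (G m))"
      using GmM var by (auto simp: frechet_means_def)
    then have "real k * ipe (m - F C) (m - F C) \<le> 0" by (simp add: FGm B.zero_left)
    then have "ipe (m - F C) (m - F C) \<le> 0" using assms(1) by (simp add: mult_le_0_iff)
    then have "m - F C = 0" using ipe_pos[OF diffW[OF C]] by fastforce
    then show "C = G m" using GF[OF C] by simp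
  next
    assume "C = G m"
    then show "C \<in> frechet_means M g k P"
      using GmM ipe_nonneg[OF diffW] by (auto simp: frechet_means_def var FGm B.zero_left simp del: One_nat_def)
  qed
  then show ?thesis unfolding m_def by blast
qed

end

section \<open>Matrix exponential and logarithm on triangular matrices\<close>

text \<open>Strong induction along the order, measured by the number of smaller indices. It drives
  forward substitution and the column recursion of the Cholesky factor.\<close>

lemma linorder_finite_induct:
  fixes j :: "'n::{finite,linorder}"
  assumes "\<And>j. (\<And>k. k < j \<Longrightarrow> P k) \<Longrightarrow> P j"
  shows "P j"
proof (induction j rule: measure_induct_rule[of "\<lambda>j. card {..<j}"])
  case (less j)
  show ?case
  proof (rule assms)
    fix k assume "k < j"
    then have "card {..<k} < card {..<j}" by (intro psubset_card_mono) auto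
    then show "P k" by (rule less)
  qed
qed

lemma matrix_mult_component: "(A ** B) $ i $ j = (\<Sum>k\<in>UNIV. A $ i $ k * B $ k $ j)"
  by (simp add: matrix_matrix_mult_def)

lemma matrix_add_rdistrib: "(A + B) ** C = A ** C + (B ** C :: real^'n^'m)"
  by (simp add: vec_eq_iff matrix_mult_component distrib_right sum.distrib)

lemma bounded_bilinear_matrix_mult:
  "bounded_bilinear ((**) :: real^'n^'m \<Rightarrow> real^'k^'n \<Rightarrow> real^'k^'m)"
proof -
  have "bilinear ((**) :: real^'n^'m \<Rightarrow> real^'k^'n \<Rightarrow> real^'k^'m)"
    unfolding bilinear_def linear_iff
    by (simp add: matrix_add_ldistrib matrix_add_rdistrib matrix_scalar_ac flip: scalar_matrix_assoc)
  then show ?thesis by (simp add: bilinear_conv_bounded_bilinear)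
qed

section \<open>Nilpotency of strictly lower triangular matrices\<close>

lemma subspace_LT0: "subspace LT0"
  by (auto simp: subspace_def LT0_def)

lemma LT1_iff: "Z \<in> LT1 \<longleftrightarrow> Z - mat 1 \<in> LT0"
  by (auto simp: LT1_def image_iff intro!: bexI[of _ "Z - mat 1"])

lemma LT1_iff_components: "Z \<in> LT1 \<longleftrightarrow> (\<forall>i. Z $ i $ i = 1) \<and> (\<forall>i j. i < j \<longrightarrow> Z $ i $ j = 0)"
  by (auto simp: LT1_iff LT0_def mat_def le_less)

lemma mpow_add: "mpow A (i + j) = mpow A i ** mpow A j"
  by (induction i) (simp_all add: matrix_mul_assoc)

text \<open>A nonzero entry of the power comes from a chain of \<open>k\<close> strict descents from
  \<open>i\<close> to \<open>j\<close>, each lowering the number of smaller indices by at least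
  one.\<close>

lemma mpow_LT0_nonzero:
  assumes "A \<in> LT0" "mpow A k $ i $ j \<noteq> 0"
  shows "card {..<j} + k \<le> card {..<i}"
  using assms(2)
proof (induction k arbitrary: i)
  case 0
  then show ?case by (auto simp: mat_def split: if_splits)
next
  case (Suc k)
  then obtain l where "A $ i $ l * mpow A k $ l $ j \<noteq> 0"
    by (auto simp: matrix_mult_component intro: sum.not_neutral_contains_not_neutral)
  then have l: "A $ i $ l \<noteq> 0" "mpow A k $ l $ j \<noteq> 0" by auto
  then have "l < i" using assms(1) by (auto simp: LT0_def not_le[symmetric])
  then have "card {..<l} < card {..<i}" by (intro psubset_card_mono) auto
  then show ?case using Suc.IH[OF l(2)] by simp
qed

lemma mpow_LT0_eq_0:
  fixes A :: "'n::{finite,linorder} sqmat"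
  assumes "A \<in> LT0" "CARD('n) \<le> k"
  shows "mpow A k = 0"
proof -
  have "card {..<i} < CARD('n)" for i :: 'n by (intro psubset_card_mono) auto
  then have "mpow A k $ i $ j = 0" for i j
    using mpow_LT0_nonzero[OF assms(1), of k i j] assms(2) by (metis add_leD2 leD le_trans)
  then show ?thesis by (simp add: vec_eq_iff)
qed

lemma mpow_in_LT0:
  assumes "A \<in> LT0" "0 < k"
  shows "mpow A k \<in> LT0"
proof -
  have "mpow A k $ i $ j = 0" if "i \<le> j" for i j
  proof (rule ccontr)
    assume "mpow A k $ i $ j \<noteq> 0"
    then have "card {..<j} + k \<le> card {..<i}" by (rule mpow_LT0_nonzero[OF assms(1)])
    moreover have "card {..<i} \<le> card {..<j}" using that by (intro card_mono) auto
    ultimately show False using assms(2) by simp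
  qed
  then show ?thesis by (auto simp: LT0_def)
qed

text \<open>Evaluation of the series truncated below degree \<open>n\<close>. At elements of
  \<open>LT0\<close> the omitted powers vanish, which makes this an algebra homomorphism and
  transfers identities between formal series to matrices.\<close>

definition fev :: "real fps \<Rightarrow> 'n::{finite,linorder} sqmat \<Rightarrow> 'n sqmat" where
  "fev f A = (\<Sum>k<CARD('n). fps_nth f k *\<^sub>R mpow A k)"

lemma fev_diff: "fev (f - g) A = fev f A - fev g A"
  by (simp add: fev_def scaleR_diff_left sum_subtractf)

lemma fev_1:
  fixes A :: "'n::{finite,linorder} sqmat"
  shows "fev 1 A = mat 1"
proof -
  have "fev 1 A = (\<Sum>k<CARD('n). if k = 0 then mat 1 else 0)"
    unfolding fev_def by (rule sum.cong) auto
  then show ?thesis by simp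
qed

lemma fev_X:
  fixes A :: "'n::{finite,linorder} sqmat"
  assumes "A \<in> LT0"
  shows "fev fps_X A = A"
proof (cases "1 < CARD('n)")
  case True
  have "fev fps_X A = (\<Sum>k<CARD('n). if k = 1 then A else 0)"
    unfolding fev_def by (rule sum.cong) auto
  then show ?thesis using True by simp
next
  case False
  \<comment> \<open>For a single index the truncation drops the linear term, but then
    \<open>A\<close> itself is zero.\<close>
  then have "fev fps_X A = 0" by (auto simp: fev_def)
  moreover have "mpow A 1 = 0" using False by (intro mpow_LT0_eq_0[OF assms]) simp
  ultimately show ?thesis by simp
qed

lemma fev_in_LT0: "A \<in> LT0 \<Longrightarrow> fps_nth f 0 = 0 \<Longrightarrow> fev f A \<in> LT0"
  unfolding fev_def
  by (intro subspace_sum[OF subspace_LT0])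
     (metis mpow_in_LT0 neq0_conv scale_zero_left subspace_0 subspace_LT0 subspace_scale)

lemma fev_mult:
  fixes A :: "'n::{finite,linorder} sqmat"
  assumes "A \<in> LT0"
  shows "fev (f * g) A = fev f A ** fev g A"
proof -
  let ?n = "CARD('n)"
  interpret mm: bounded_bilinear "(**) :: 'n sqmat \<Rightarrow> 'n sqmat \<Rightarrow> 'n sqmat"
    by (rule bounded_bilinear_matrix_mult)
  have lt: "k < CARD('n)" if "mpow A k \<noteq> 0" for k
    using mpow_LT0_eq_0[OF assms] that not_less by blast
  let ?t = "\<lambda>i j. (fps_nth f i * fps_nth g j) *\<^sub>R mpow A (i + j)"
  have "fev f A ** fev g A = (\<Sum>i<?n. \<Sum>j<?n. ?t i j)"
    unfolding fev_def mm.sum_left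
    by (simp add: mm.sum_right mm.scaleR_left mm.scaleR_right mpow_add mult.commute)
  also have "\<dots> = (\<Sum>(i, j)\<in>{..<?n} \<times> {..<?n}. ?t i j)"
    by (rule sum.cartesian_product)
  \<comment> \<open>Terms with \<open>i + j\<close> at least \<open>n\<close> vanish by nilpotency,
    so the square reduces to the triangle of the Cauchy product.\<close>
  also have "\<dots> = (\<Sum>(i, j)\<in>{(i, j). i + j < ?n}. ?t i j)"
    by (rule sum.mono_neutral_right) (auto intro: lt)
  also have "\<dots> = (\<Sum>k<?n. \<Sum>i\<le>k. ?t i (k - i))"
    by (rule sum.triangle_reindex)
  also have "\<dots> = (\<Sum>k<?n. (\<Sum>i\<le>k. fps_nth f i * fps_nth g (k - i)) *\<^sub>R mpow A k)"
    by (simp add: scaleR_sum_left)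
  also have "\<dots> = fev (f * g) A"
    by (simp add: fev_def fps_mult_nth atLeast0AtMost)
  finally show ?thesis by simp
qed

lemma fev_power: "A \<in> LT0 \<Longrightarrow> fev (f ^ k) A = mpow (fev f A) k"
  by (induction k) (simp_all add: fev_1 fev_mult)

text \<open>The zero constant term of \<open>g\<close> keeps \<open>g ^ k\<close> free of
  coefficients below degree \<open>k\<close>, so each retained coefficient of the composition is a
  finite sum that the truncation does not cut.\<close>

lemma fev_compose:
  fixes A :: "'n::{finite,linorder} sqmat"
  assumes "A \<in> LT0" "fps_nth g 0 = 0"
  shows "fev f (fev g A) = fev (f oo g) A"
proof -
  let ?n = "CARD('n)"
  have "fev f (fev g A) = (\<Sum>k<?n. \<Sum>m<?n. (fps_nth f k * fps_nth (g ^ k) m) *\<^sub>R mpow A m)"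
    by (subst fev_def, simp flip: fev_power[OF assms(1)], simp add: fev_def scaleR_sum_right)
  also have "\<dots> = (\<Sum>m<?n. (\<Sum>k<?n. fps_nth f k * fps_nth (g ^ k) m) *\<^sub>R mpow A m)"
    by (subst sum.swap) (simp add: scaleR_sum_left)
  also have "\<dots> = (\<Sum>m<?n. fps_nth (f oo g) m *\<^sub>R mpow A m)"
  proof (rule sum.cong[OF refl])
    fix m assume m: "m \<in> {..<?n}"
    have "(\<Sum>k<?n. fps_nth f k * fps_nth (g ^ k) m) = (\<Sum>k=0..m. fps_nth f k * fps_nth (g ^ k) m)"
      using m startsby_zero_power_prefix[OF assms(2)] by (intro sum.mono_neutral_right) auto
    then show "(\<Sum>k<?n. fps_nth f k * fps_nth (g ^ k) m) *\<^sub>R mpow A m = fps_nth (f oo g) m *\<^sub>R mpow A m"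
      by (simp add: fps_compose_nth)
  qed
  finally show ?thesis by (simp add: fev_def)
qed

section \<open>Exponential and logarithm as inverse bijections\<close>

lemma mexp_eq_fev:
  fixes A :: "'n::{finite,linorder} sqmat"
  shows "mexp A = fev (fps_exp 1) A"
proof -
  \<comment> \<open>Natural subtraction: the two index ranges agree only because \<open>n\<close> is
    positive.\<close>
  have "0 < CARD('n)" by simp
  then have "{0..CARD('n) - 1} = {..<CARD('n)}" by (auto simp del: zero_less_card_finite)
  then show "mexp A = fev (fps_exp 1) A"
    by (simp add: mexp_def fev_def)
qed

lemma mlog_eq_fev:
  fixes Z :: "'n::{finite,linorder} sqmat"
  shows "mlog Z = fev (fps_ln 1) (Z - mat 1)"
proof -
  have "0 < CARD('n)" by simp
  then have "{1..CARD('n) - 1} = {..<CARD('n)} - {0}" by (auto simp del: zero_less_card_finite)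
  \<comment> \<open>The sum on the left starts at 1; the coefficient of \<open>fps_ln 1\<close> at 0
    vanishes.\<close>
  then show "mlog Z = fev (fps_ln 1) (Z - mat 1)"
    unfolding mlog_def fev_def by (intro sum.mono_neutral_cong_left) (auto simp: fps_ln_nth)
qed

text \<open>Removing the identity gives a series without constant term, the form required for
  substitution into the logarithm.\<close>

lemma mexp_diff: "mexp A - mat 1 = fev (fps_exp 1 - 1) A"
  by (simp add: mexp_eq_fev fev_diff fev_1)

lemma mexp_in_LT1: "A \<in> LT0 \<Longrightarrow> mexp A \<in> LT1"
  by (simp add: LT1_iff mexp_diff fev_in_LT0)

lemma mlog_in_LT0: "Z \<in> LT1 \<Longrightarrow> mlog Z \<in> LT0"
  by (simp add: LT1_iff mlog_eq_fev fev_in_LT0)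

text \<open>\<open>fps_ln 1\<close> is the compositional inverse of \<open>fps_exp 1 - 1\<close>, so
  the composite series is \<open>fps_X\<close>.\<close>

lemma mlog_mexp: "A \<in> LT0 \<Longrightarrow> mlog (mexp A) = A"
  by (simp add: mlog_eq_fev mexp_diff fev_compose fps_ln_fps_exp_inv fps_inv_fps_exp_compose fev_X)

lemma mexp_mlog:
  assumes "Z \<in> LT1"
  shows "mexp (mlog Z) = Z"
proof -
  have "mexp (mlog Z) - mat 1 = Z - mat 1"
    using assms
    by (simp add: mlog_eq_fev mexp_diff fev_compose LT1_iff)
       (simp add: fps_ln_fps_exp_inv fps_inv_fps_exp_compose fev_X)
  then show ?thesis by simp
qed

lemma affine_domain_LT0: "affine_domain LT0 LT0"
  by (rule affine_domain_self[OF subspace_LT0])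

lemma affine_domain_LT1: "affine_domain LT1 LT0"
  unfolding affine_domain_def LT1_def by (auto simp: subspace_LT0 intro!: exI[of _ "mat 1"])

lemma Ck_on_mpow:
  assumes "affine_domain M V" "Ck_on l M V f"
  shows "Ck_on l M V (\<lambda>p. mpow (f p) k)"
proof (induction k)
  case 0
  then show ?case by (simp add: Ck_on_const[OF assms(1)])
next
  case (Suc k)
  then show ?case using Ck_on_bilinear[OF assms(1) bounded_bilinear_matrix_mult assms(2)] by simp
qed

lemma Ck_on_fev:
  assumes "affine_domain M V" "Ck_on l M V f"
  shows "Ck_on l M V (\<lambda>p. fev h (f p))"
  unfolding fev_def
  by (intro Ck_on_sum[OF assms(1)] Ck_on_scaleR[OF assms(1)] Ck_on_const[OF assms(1)] Ck_on_mpow assms)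

lemma smooth_on_mexp: "smooth_on LT0 LT0 mexp"
  unfolding smooth_on_def mexp_eq_fev[abs_def]
  by (intro allI Ck_on_fev affine_domain_LT0 Ck_on_bounded_linear bounded_linear_ident)

lemma smooth_on_mlog: "smooth_on LT1 LT0 mlog"
  unfolding smooth_on_def mlog_eq_fev[abs_def]
  by (intro allI Ck_on_fev Ck_on_diff Ck_on_const affine_domain_LT1 Ck_on_bounded_linear bounded_linear_ident)

section \<open>Cholesky decomposition\<close>

definition lower_pos :: "'n::{finite,linorder} sqmat \<Rightarrow> bool" where
  "lower_pos L \<longleftrightarrow> (\<forall>i j. i < j \<longrightarrow> L $ i $ j = 0) \<and> (\<forall>i. 0 < L $ i $ i)"

lemma inner_matrix_transpose: "(A *v x) \<bullet> y = x \<bullet> (transpose A *v (y :: real^'n))"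
  by (metis dot_lmul_matrix inner_commute transpose_matrix_vector)

declare transpose_matrix_vector [simp del]

lemma matrix_vector_component: "(A *v x) $ i = (\<Sum>j\<in>UNIV. A $ i $ j * x $ j)"
  by (simp add: matrix_vector_mult_def)

lemma matrix_mult_transpose_component: "(A ** transpose B) $ i $ j = (\<Sum>k\<in>UNIV. A $ i $ k * B $ j $ k)"
  by (simp add: matrix_mult_component transpose_def)

text \<open>Forward substitution: in row \<open>j\<close> the entries right of the diagonal are zero
  and the earlier coordinates of \<open>x\<close> vanish by induction, so the kernel is
  trivial.\<close>

lemma lower_pos_inverse:
  assumes "lower_pos L"
  obtains K where "K ** L = mat 1" "L ** K = mat 1"
proof -
  have "x = 0" if x: "L *v x = 0" for x
  proof -
    have "x $ j = 0" for j
    proof (induction j rule: linorder_finite_induct)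
      case (1 j)
      have "0 = (\<Sum>k\<in>UNIV. L $ j $ k * x $ k)"
        using x matrix_vector_component[of L x j] by simp
      also have "\<dots> = (\<Sum>k\<in>{j}. L $ j $ k * x $ k)"
      proof (rule sum.mono_neutral_right)
        show "\<forall>k\<in>UNIV - {j}. L $ j $ k * x $ k = 0"
          using 1 assms by (metis DiffD2 lower_pos_def mult_eq_0_iff neqE singletonI)
      qed auto
      finally show ?case using assms by (simp add: lower_pos_def) (metis less_irrefl)
    qed
    then show ?thesis by (simp add: vec_eq_iff)
  qed
  then obtain K where "K ** L = mat 1" using matrix_left_invertible_ker by blast
  then show ?thesis using that matrix_left_right_inverse by blast
qed

definition pos_def :: "'n::{finite,linorder} sqmat \<Rightarrow> bool" where
  "pos_def C \<longleftrightarrow> (\<forall>x. x \<noteq> 0 \<longrightarrow> 0 < x \<bullet> (C *v x))"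

text \<open>Rows are added in increasing order. Keeping the factor equal to the identity outside
  \<open>S\<close> makes it an invertible matrix of full size at each stage, so no submatrices
  occur.\<close>

lemma partial_Cholesky:
  fixes C :: "'n::{finite,linorder} sqmat"
  assumes sym: "transpose C = C" and pos: "pos_def C" and "finite S"
  shows "\<exists>L. lower_pos L \<and> (\<forall>i j. i \<notin> S \<or> j \<notin> S \<longrightarrow> L $ i $ j = (if i = j then 1 else 0)) \<and>
     (\<forall>i\<in>S. \<forall>j\<in>S. (L ** transpose L) $ i $ j = C $ i $ j)"
  using \<open>finite S\<close>
proof (induction S rule: finite_linorder_max_induct)
  case empty
  show ?case by (rule exI[of _ "mat 1"]) (auto simp: lower_pos_def mat_def)
next
  case (insert m S)
  then obtain L where L: "lower_pos L"
    and out: "\<And>i j. i \<notin> S \<or> j \<notin> S \<Longrightarrow> L $ i $ j = (if i = j then 1 else 0)"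
    and LL: "\<And>i j. i \<in> S \<Longrightarrow> j \<in> S \<Longrightarrow> (L ** transpose L) $ i $ j = C $ i $ j"
    by blast
  have m: "m \<notin> S" using insert by auto
  have C_sym: "C $ i $ j = C $ j $ i" for i j
    using sym by (metis transpose_def vec_lambda_beta)
  obtain K where K: "K ** L = mat 1" "L ** K = mat 1" using lower_pos_inverse[OF L] .
  \<comment> \<open>The new row solves \<open>L y = c\<close>. Testing positivity of \<open>C\<close> on \<open>e\<^sub>m - z\<close>, where \<open>z = (L\<^sup>T)\<^sup>-\<^sup>1 y\<close>,
    shows that the Schur complement \<open>C\<^sub>m\<^sub>m - y \<bullet> y\<close> under the new pivot is positive.\<close>
  define c where "c = (\<chi> j. if j \<in> S then C $ j $ m else 0)"
  define y where "y = K *v c"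
  define z where "z = transpose K *v y"
  have Ly: "L *v y = c" by (simp add: y_def matrix_vector_mul_assoc K)
  have LTz: "transpose L *v z = y"
    by (simp add: z_def matrix_vector_mul_assoc K transpose_mat flip: matrix_transpose_mul)
  \<comment> \<open>Outside \<open>S\<close> the rows of \<open>L\<close> are those of the identity,
    so \<open>y\<close> inherits the support of \<open>c\<close>.\<close>
  have y0: "y $ j = 0" if "j \<notin> S" for j
  proof -
    have "(L *v y) $ j = (\<Sum>k\<in>UNIV. if k = j then y $ k else 0)"
      unfolding matrix_vector_component using that by (intro sum.cong) (auto simp: out)
    then show ?thesis using that by (simp add: Ly c_def)
  qed
  have z0: "z $ j = 0" if "j \<notin> S" for j
  proof -
    have "(transpose L *v z) $ j = (\<Sum>k\<in>UNIV. if k = j then z $ k else 0)"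
      unfolding matrix_vector_component transpose_def using that by (intro sum.cong) (auto simp: out)
    then show ?thesis using that by (simp add: LTz y0)
  qed
  \<comment> \<open>\<open>C\<close> and \<open>L ** transpose L\<close> agree on \<open>S\<close>,
    and \<open>z\<close> vanishes outside.\<close>
  have zCz: "z \<bullet> (C *v z) = y \<bullet> y"
  proof -
    have "z \<bullet> (C *v z) = (\<Sum>i\<in>UNIV. \<Sum>j\<in>UNIV. z $ i * (C $ i $ j * z $ j))"
      by (simp add: inner_vec_def matrix_vector_component sum_distrib_left)
    also have "\<dots> = (\<Sum>i\<in>UNIV. \<Sum>j\<in>UNIV. z $ i * ((L ** transpose L) $ i $ j * z $ j))"
      using z0 LL by (intro sum.cong refl) (metis mult_zero_left mult_zero_right)
    also have "\<dots> = z \<bullet> ((L ** transpose L) *v z)"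
      by (simp add: inner_vec_def matrix_vector_component sum_distrib_left)
    also have "\<dots> = z \<bullet> (L *v y)" by (simp add: LTz flip: matrix_vector_mul_assoc)
    also have "\<dots> = y \<bullet> y" using inner_matrix_transpose[of L y z] by (simp add: LTz inner_commute)
    finally show ?thesis .
  qed
  let ?e = "axis m 1 :: (real, 'n) vec"
  have Cz: "(C *v z) $ m = y \<bullet> y"
  proof -
    have "(C *v z) $ m = (\<Sum>j\<in>UNIV. c $ j * z $ j)"
      unfolding matrix_vector_component
      by (intro sum.cong refl) (auto simp: c_def z0 C_sym[of m])
    also have "\<dots> = (L *v y) \<bullet> z" by (simp add: Ly inner_vec_def)
    also have "\<dots> = y \<bullet> y" by (simp add: inner_matrix_transpose LTz)
    finally show ?thesis .
  qed
  have eCz: "?e \<bullet> (C *v z) = y \<bullet> y" using Cz by (simp add: inner_axis')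
  have zCe: "z \<bullet> (C *v ?e) = y \<bullet> y"
    using inner_matrix_transpose[of C z ?e] eCz by (simp add: sym inner_commute)
  have eCe: "?e \<bullet> (C *v ?e) = C $ m $ m"
    by (simp add: inner_axis' matrix_vector_mul_component inner_axis)
  have "(?e - z) $ m \<noteq> 0" using z0[OF m] by simp
  then have "?e - z \<noteq> 0" by auto
  then have "0 < (?e - z) \<bullet> (C *v (?e - z))" using pos by (simp add: pos_def_def)
  also have "\<dots> = C $ m $ m - y \<bullet> y"
    by (simp add: matrix_vector_mult_diff_distrib inner_diff_left inner_diff_right eCz zCe eCe zCz)
  finally have r: "0 < C $ m $ m - y \<bullet> y" .
  \<comment> \<open>Row \<open>m\<close> becomes \<open>y\<close> with the root of the Schur
    complement as its pivot; the other rows are kept.\<close>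
  define N where "N = (\<chi> i j. if i = m then (if j = m then sqrt (C $ m $ m - y \<bullet> y) else y $ j) else L $ i $ j)"
  have Nm: "N $ m $ k = (if k = m then sqrt (C $ m $ m - y \<bullet> y) else y $ k)" for k by (simp add: N_def)
  have Ni: "N $ i $ k = L $ i $ k" if "i \<noteq> m" for i k using that by (simp add: N_def)
  have "lower_pos N"
    unfolding lower_pos_def
  proof (intro conjI allI impI)
    fix i j :: 'n assume "i < j"
    \<comment> \<open>\<open>m\<close> exceeds every element of \<open>S\<close>, so
      \<open>y\<close> vanishes to the right of the pivot.\<close>
    then have "i = m \<Longrightarrow> j \<notin> S" using insert.hyps by force
    then show "N $ i $ j = 0"
      using \<open>i < j\<close> L y0[of j] by (cases "i = m") (auto simp: Nm Ni lower_pos_def)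
  next
    fix i show "0 < N $ i $ i" using r L by (cases "i = m") (auto simp: Nm Ni lower_pos_def)
  qed
  moreover have "N $ i $ j = (if i = j then 1 else 0)" if "i \<notin> insert m S \<or> j \<notin> insert m S" for i j
    using that m by (cases "i = m") (auto simp: Nm Ni out y0)
  moreover have "(N ** transpose N) $ i $ j = C $ i $ j" if "i \<in> insert m S" "j \<in> insert m S" for i j
  proof -
    have Nmj: "(N ** transpose N) $ m $ j = C $ m $ j" if "j \<in> S" for j
    proof -
      have "j \<noteq> m" using that m by auto
      then have "(N ** transpose N) $ m $ j = (\<Sum>k\<in>UNIV. L $ j $ k * y $ k)"
        unfolding matrix_mult_transpose_component using that m
        by (intro sum.cong refl) (auto simp: Nm Ni out y0)
      also have "\<dots> = (L *v y) $ j" by (simp add: matrix_vector_component)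
      also have "\<dots> = C $ m $ j" using that by (simp add: Ly c_def C_sym[of m])
      finally show ?thesis .
    qed
    have Nmm: "(N ** transpose N) $ m $ m = C $ m $ m"
    proof -
      \<comment> \<open>Since \<open>y $ m = 0\<close>, the pivot contributes its square separately
        from \<open>y \<bullet> y\<close>.\<close>
      have "(N ** transpose N) $ m $ m = (\<Sum>k\<in>UNIV. y $ k * y $ k + (if k = m then C $ m $ m - y \<bullet> y else 0))"
        unfolding matrix_mult_transpose_component using r
        by (intro sum.cong refl) (auto simp: Nm y0[OF m] simp flip: power2_eq_square)
      also have "\<dots> = C $ m $ m" by (simp add: sum.distrib inner_vec_def)
      finally show ?thesis .
    qed
    have comm: "(N ** transpose N) $ i $ j = (N ** transpose N) $ j $ i" for i j
      by (simp add: matrix_mult_transpose_component mult.commute)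
    have "(N ** transpose N) $ i $ j = C $ i $ j" if "i \<in> S" "j \<in> S"
    proof -
      have "i \<noteq> m" "j \<noteq> m" using m that by auto
      then show ?thesis
        using LL[OF that] by (simp add: matrix_mult_transpose_component Ni)
    qed
    then show ?thesis using that Nmj Nmm comm C_sym by (metis insertE)
  qed
  ultimately show ?case by blast
qed

section \<open>Existence, column recursion and uniqueness\<close>

lemma Cholesky_exists:
  assumes "transpose C = C" "pos_def C"
  obtains L where "lower_pos L" "C = L ** transpose L"
  using partial_Cholesky[OF assms finite, of UNIV] that by (auto simp: vec_eq_iff)

text \<open>Terms with \<open>k > j\<close> vanish because row \<open>j\<close> of \<open>L\<close>
  ends at the diagonal. Solving for the last summand expresses column \<open>j\<close> through
  earlier columns, which gives both uniqueness and smoothness.\<close>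

lemma Cholesky_component:
  assumes "lower_pos L" "C = L ** transpose L"
  shows "C $ i $ j = (\<Sum>k<j. L $ i $ k * L $ j $ k) + L $ i $ j * L $ j $ j"
proof -
  have "C $ i $ j = (\<Sum>k\<in>UNIV. L $ i $ k * L $ j $ k)"
    by (simp add: assms(2) matrix_mult_transpose_component)
  also have "\<dots> = (\<Sum>k\<in>insert j {..<j}. L $ i $ k * L $ j $ k)"
  proof (rule sum.mono_neutral_right)
    show "\<forall>k\<in>UNIV - insert j {..<j}. L $ i $ k * L $ j $ k = 0"
      using assms(1) by (auto simp: lower_pos_def not_less le_less)
  qed auto
  finally show ?thesis by simp
qed

lemma Cholesky_diag:
  assumes "lower_pos L" "C = L ** transpose L"
  shows "L $ j $ j = sqrt (C $ j $ j - (\<Sum>k<j. L $ j $ k * L $ j $ k))"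
    and "0 < C $ j $ j - (\<Sum>k<j. L $ j $ k * L $ j $ k)"
proof -
  have "C $ j $ j - (\<Sum>k<j. L $ j $ k * L $ j $ k) = (L $ j $ j)\<^sup>2"
    using Cholesky_component[OF assms, of j j] by (simp add: power2_eq_square)
  moreover have "0 < L $ j $ j" using assms(1) by (simp add: lower_pos_def)
  ultimately show "L $ j $ j = sqrt (C $ j $ j - (\<Sum>k<j. L $ j $ k * L $ j $ k))"
    and "0 < C $ j $ j - (\<Sum>k<j. L $ j $ k * L $ j $ k)" by simp_all
qed

text \<open>Valid for every \<open>i\<close>: above the diagonal the formula returns zero, so a
  whole column is treated at once.\<close>

lemma Cholesky_below:
  assumes "lower_pos L" "C = L ** transpose L"
  shows "L $ i $ j = (C $ i $ j - (\<Sum>k<j. L $ i $ k * L $ j $ k)) * inverse (L $ j $ j)"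
proof -
  have "L $ j $ j \<noteq> 0" using assms(1) by (metis lower_pos_def less_irrefl)
  then show ?thesis using Cholesky_component[OF assms, of i j] by (simp add: field_simps)
qed

lemma Cholesky_unique:
  assumes "lower_pos L" "lower_pos K" "L ** transpose L = K ** transpose K"
  shows "L = K"
proof -
  have "\<forall>i. L $ i $ j = K $ i $ j" for j
  proof (induction j rule: linorder_finite_induct)
    case (1 j)
    have s: "(\<Sum>k<j. L $ i $ k * L $ j $ k) = (\<Sum>k<j. K $ i $ k * K $ j $ k)" for i
      using 1 by (intro sum.cong) auto
    have "L $ j $ j = K $ j $ j"
      using Cholesky_diag(1)[OF assms(1) refl, of j] Cholesky_diag(1)[OF assms(2,3), of j] s by simp
    then show ?case
      using Cholesky_below[OF assms(1) refl, of _ j] Cholesky_below[OF assms(2,3), of _ j] s by metis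
  qed
  then show ?thesis by (simp add: vec_eq_iff)
qed

lemma Chol_eqI:
  assumes "lower_pos L" "C = L ** transpose L"
  shows "Chol C = L"
  unfolding Chol_def
proof (rule the_equality)
  show "(\<forall>i j. i < j \<longrightarrow> L $ i $ j = 0) \<and> (\<forall>i. 0 < L $ i $ i) \<and> C = L ** transpose L"
    using assms unfolding lower_pos_def by blast
next
  fix K assume "(\<forall>i j. i < j \<longrightarrow> K $ i $ j = 0) \<and> (\<forall>i. 0 < K $ i $ i) \<and> C = K ** transpose K"
  then have K: "lower_pos K" and "C = K ** transpose K" unfolding lower_pos_def by blast+
  then have "K ** transpose K = L ** transpose L" using assms(2) by (simp only:)
  then show "K = L" by (rule Cholesky_unique[OF K assms(1)])
qed

section \<open>The normalization \<open>Theta\<close> and its inverse\<close>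

lemma Chol:
  assumes "C \<in> Cor_plus"
  shows "lower_pos (Chol C)" and "C = Chol C ** transpose (Chol C)"
proof -
  have "transpose C = C" "pos_def C" using assms by (auto simp: Cor_plus_def pos_def_def)
  then obtain L where "lower_pos L" "C = L ** transpose L" by (rule Cholesky_exists)
  moreover from this have "Chol C = L" by (rule Chol_eqI)
  ultimately show "lower_pos (Chol C)" "C = Chol C ** transpose (Chol C)" by (simp_all only:)
qed

lemma Theta_component:
  assumes "lower_pos (Chol C)"
  shows "Theta C $ i $ j = Chol C $ i $ j * inverse (Chol C $ i $ i)"
proof -
  let ?D = "Diag (Chol C)"
  let ?E = "\<chi> i j. if i = j then inverse (Chol C $ i $ i) else 0"
  have nz: "Chol C $ i $ i \<noteq> 0" for i using assms by (metis lower_pos_def less_irrefl)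
  have D: "(?D ** A) $ i $ j = Chol C $ i $ i * A $ i $ j" for A i j
  proof -
    have "(?D ** A) $ i $ j = (\<Sum>k\<in>UNIV. if k = i then Chol C $ i $ i * A $ i $ j else 0)"
      unfolding matrix_mult_component by (intro sum.cong) (auto simp: Diag_def)
    then show ?thesis by simp
  qed
  have "?D ** ?E = mat 1"
    unfolding vec_eq_iff D by (auto simp: mat_def nz)
  \<comment> \<open>\<open>matrix_inv\<close> selects some two-sided inverse; exhibiting one makes
    its defining property available.\<close>
  then have "?D ** ?E = mat 1 \<and> ?E ** ?D = mat 1" using matrix_left_right_inverse by blast
  then have "?D ** matrix_inv ?D = mat 1" unfolding matrix_inv_def by (rule someI2) simp
  then have "?D ** Theta C = Chol C" by (simp add: Theta_def matrix_mul_assoc)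
  then have "Chol C $ i $ j = Chol C $ i $ i * Theta C $ i $ j" using D by metis
  then show ?thesis using nz[of i] by (simp add: field_simps)
qed

lemma Theta_in_LT1:
  assumes "C \<in> Cor_plus"
  shows "Theta C \<in> LT1"
  using Chol(1)[OF assms]
  by (auto simp: LT1_iff_components Theta_component lower_pos_def intro!: right_inverse) (metis less_irrefl)

text \<open>The rescaled Gram matrix of the rows of \<open>Z\<close>, that is, the cosines between
  them; the explicit formula for the inverse of \<open>Theta\<close>.\<close>

definition normalize_gram :: "'n::{finite,linorder} sqmat \<Rightarrow> 'n sqmat" where
  "normalize_gram Z = (\<chi> i j. (Z ** transpose Z) $ i $ j *
     (inverse (sqrt ((Z ** transpose Z) $ i $ i)) * inverse (sqrt ((Z ** transpose Z) $ j $ j))))"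

text \<open>The diagonal entry 1 of row \<open>i\<close> bounds its squared length from below, which
  keeps the square roots away from zero.\<close>

lemma gram_diag_ge_1:
  assumes "Z \<in> LT1"
  shows "1 \<le> (Z ** transpose Z) $ i $ i"
proof -
  have "Z $ i $ i * Z $ i $ i \<le> (\<Sum>k\<in>UNIV. Z $ i $ k * Z $ i $ k)"
    by (rule member_le_sum) auto
  then show ?thesis using assms by (simp add: LT1_iff_components matrix_mult_transpose_component)
qed

lemma normalize_gram:
  assumes "Z \<in> LT1"
  shows "normalize_gram Z \<in> Cor_plus" and "Theta (normalize_gram Z) = Z"
proof -
  define s where "s i = inverse (sqrt ((Z ** transpose Z) $ i $ i))" for i
  \<comment> \<open>The rows of \<open>Z\<close> scaled to unit length. This is the Cholesky factor
    of the result, and since \<open>Z\<close> has unit diagonal, \<open>Theta\<close> removes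
    exactly the factors \<open>s i\<close>.\<close>
  define K where "K = (\<chi> i j. Z $ i $ j * s i)"
  have P: "0 < (Z ** transpose Z) $ i $ i" for i
    using gram_diag_ge_1[OF assms, of i] by linarith
  then have s: "0 < s i" for i by (simp add: s_def)
  then have K: "lower_pos K" using assms by (simp add: lower_pos_def K_def LT1_iff_components)
  have N: "normalize_gram Z = K ** transpose K"
    by (simp add: vec_eq_iff normalize_gram_def matrix_mult_transpose_component[of K] K_def
        matrix_mult_transpose_component[of Z] sum_distrib_left sum_distrib_right mult_ac flip: s_def)
       (simp add: matrix_mult_transpose_component s_def sum_distrib_left sum_distrib_right mult_ac)
  obtain B where B: "B ** K = mat 1" "K ** B = mat 1" using lower_pos_inverse[OF K] .
  have "0 < x \<bullet> ((K ** transpose K) *v x)" if "x \<noteq> 0" for x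
  proof -
    have "x \<bullet> ((K ** transpose K) *v x) = (transpose K *v x) \<bullet> (transpose K *v x)"
      using inner_matrix_transpose[of K "transpose K *v x" x]
      by (simp add: matrix_vector_mul_assoc inner_commute)
    moreover have "transpose B *v (transpose K *v x) = x"
      by (simp add: matrix_vector_mul_assoc B transpose_mat flip: matrix_transpose_mul)
    then have "transpose K *v x \<noteq> 0" using that by (metis matrix_vector_mult_0_right)
    ultimately show ?thesis by simp
  qed
  moreover have "transpose (normalize_gram Z) = normalize_gram Z"
    by (simp add: N matrix_transpose_mul)
  moreover have "normalize_gram Z $ i $ i = 1" for i
    using P[of i] by (simp add: normalize_gram_def flip: inverse_mult_distrib)
  ultimately show "normalize_gram Z \<in> Cor_plus" by (simp add: Cor_plus_def N)
  have C: "Chol (normalize_gram Z) = K" by (rule Chol_eqI[OF K N])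
  have "Theta (normalize_gram Z) $ i $ j = Z $ i $ j" for i j
    using Theta_component[of "normalize_gram Z" i j] K C assms s[of i]
    by (simp add: K_def LT1_iff_components)
  then show "Theta (normalize_gram Z) = Z" by (simp add: vec_eq_iff)
qed

text \<open>The unit diagonal of \<open>C\<close> makes the length of row \<open>i\<close> of
  \<open>Theta C\<close> the inverse of the Cholesky pivot, so normalization restores what
  \<open>Theta\<close> divided out.\<close>

lemma normalize_gram_Theta:
  assumes "C \<in> Cor_plus"
  shows "normalize_gram (Theta C) = C"
proof -
  note L = Chol[OF assms]
  have pos: "0 < Chol C $ i $ i" for i using L(1) by (simp add: lower_pos_def)
  have P: "(Theta C ** transpose (Theta C)) $ i $ j = C $ i $ j * (inverse (Chol C $ i $ i) * inverse (Chol C $ j $ j))" for i j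
  proof -
    have "C $ i $ j = (\<Sum>k\<in>UNIV. Chol C $ i $ k * Chol C $ j $ k)"
      by (subst L(2)) (simp add: matrix_mult_transpose_component)
    then show ?thesis
      by (simp add: matrix_mult_transpose_component Theta_component[OF L(1)] sum_distrib_right sum_distrib_left mult_ac)
  qed
  have "C $ i $ i = 1" for i using assms by (simp add: Cor_plus_def)
  then have sq: "sqrt ((Theta C ** transpose (Theta C)) $ i $ i) = inverse (Chol C $ i $ i)" for i
    using pos[of i] by (simp add: P)
  have "normalize_gram (Theta C) $ i $ j = C $ i $ j" for i j
  proof -
    have "Chol C $ i $ i \<noteq> 0" "Chol C $ j $ j \<noteq> 0" using pos by (metis less_irrefl)+
    moreover have "normalize_gram (Theta C) $ i $ j
        = (Theta C ** transpose (Theta C)) $ i $ j * (Chol C $ i $ i * Chol C $ j $ j)"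
      by (simp add: normalize_gram_def sq)
    ultimately show ?thesis by (simp add: P field_simps)
  qed
  then show ?thesis by (simp add: vec_eq_iff)
qed

lemma Theta_inv_eq: assumes "Z \<in> LT1" shows "Theta_inv Z = normalize_gram Z"
  unfolding Theta_inv_def
proof (rule the_inv_into_f_eq)
  show "inj_on Theta Cor_plus" by (rule inj_on_inverseI[of _ normalize_gram]) (rule normalize_gram_Theta)
qed (use assms normalize_gram in auto)

section \<open>Openness of the domain and smoothness of the chart\<close>

lemma Ck_on_matrix:
  fixes f :: "'a::euclidean_space \<Rightarrow> real^'n^'m"
  assumes "affine_domain M V" "\<And>i j. Ck_on k M V (\<lambda>p. f p $ i $ j)"
  shows "Ck_on k M V f"
proof (rule Ck_on_componentwise[OF assms(1)])
  fix b :: "real^'n^'m" assume "b \<in> Basis"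
  then obtain i j where "b = axis i (axis j 1)" by (auto simp: Basis_vec_def)
  then show "Ck_on k M V (\<lambda>p. f p \<bullet> b)" using assms(2)[of i j] by (simp add: inner_axis)
qed

lemma Ck_on_entry: "affine_domain M V \<Longrightarrow> Ck_on k M V (\<lambda>p :: real^'n^'m. p $ i $ j)"
  by (intro Ck_on_bounded_linear) (auto intro: bounded_linear_compose bounded_linear_vec_nth)

lemma subspace_Hol: "subspace Hol"
  by (auto simp: subspace_def Hol_def vec_eq_iff transpose_def)

text \<open>By compactness the quadratic form of \<open>A\<close> has a positive minimum on the unit
  sphere, which a small perturbation of \<open>A\<close> cannot use up.\<close>

lemma open_pos_def: "open (Collect pos_def :: ('n::{finite,linorder} sqmat) set)"
  unfolding open_dist
proof (intro ballI)
  fix A :: "'n sqmat" assume A: "A \<in> Collect pos_def"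
  let ?S = "sphere (0 :: (real, 'n) vec) 1"
  have "bilinear ((*v) :: 'n sqmat \<Rightarrow> (real, 'n) vec \<Rightarrow> (real, 'n) vec)"
    unfolding bilinear_def linear_iff
    by (simp add: matrix_vector_right_distrib matrix_vector_mult_add_rdistrib matrix_scaleR_vector_ac
        flip: scaleR_matrix_vector_assoc)
  then interpret mv: bounded_bilinear "(*v) :: 'n sqmat \<Rightarrow> (real, 'n) vec \<Rightarrow> (real, 'n) vec"
    by (simp add: bilinear_conv_bounded_bilinear)
  obtain K where K: "K > 0" "\<And>D x. norm (D *v x) \<le> norm (D :: 'n sqmat) * norm (x :: (real, 'n) vec) * K"
    using mv.pos_bounded by blast
  have "continuous_on ?S (\<lambda>x. x \<bullet> (A *v x))"
    by (intro continuous_intros mv.continuous_on)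
  moreover have "?S \<noteq> {}" by simp
  ultimately obtain x0 where x0: "x0 \<in> ?S" and min: "\<And>x. x \<in> ?S \<Longrightarrow> x0 \<bullet> (A *v x0) \<le> x \<bullet> (A *v x)"
    using continuous_attains_inf[of ?S] compact_sphere by blast
  define m where "m = x0 \<bullet> (A *v x0)"
  have "x0 \<noteq> 0" using x0 by auto
  then have m: "m > 0" using A by (simp add: m_def pos_def_def)
  \<comment> \<open>\<open>K\<close> bounds the matrix-vector product, so within this radius the
    form changes by less than \<open>m\<close> on unit vectors.\<close>
  have "pos_def B" if "dist B A < m / K" for B
    unfolding pos_def_def
  proof (intro allI impI)
    fix x :: "(real, 'n) vec" assume "x \<noteq> 0"
    define u where "u = x /\<^sub>R norm x"
    have u: "norm u = 1" "x = norm x *\<^sub>R u" using \<open>x \<noteq> 0\<close> by (auto simp: u_def)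
    have "\<bar>u \<bullet> ((B - A) *v u)\<bar> \<le> norm u * norm ((B - A) *v u)" by (rule Cauchy_Schwarz_ineq2)
    also have "\<dots> \<le> norm (B - A) * K" using K(2)[of "B - A" u] u by simp
    also have "\<dots> < m" using that K(1) by (simp add: dist_norm field_simps)
    finally have "\<bar>u \<bullet> ((B - A) *v u)\<bar> < m" .
    moreover have "m \<le> u \<bullet> (A *v u)" using min[of u] u by (simp add: m_def)
    moreover have "u \<bullet> (B *v u) = u \<bullet> (A *v u) + u \<bullet> ((B - A) *v u)"
      by (simp add: mv.diff_left inner_diff_right)
    ultimately have "0 < u \<bullet> (B *v u)" by linarith
    moreover have "x \<bullet> (B *v x) = norm x * norm x * (u \<bullet> (B *v u))"
      by (subst (1 2) u(2)) (simp add: mv.scaleR_right)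
    ultimately show "0 < x \<bullet> (B *v x)" using \<open>x \<noteq> 0\<close> by simp
  qed
  then show "\<exists>e>0. \<forall>B. dist B A < e \<longrightarrow> B \<in> Collect pos_def" using m K(1) by (intro exI[of _ "m / K"]) auto
qed

text \<open>Symmetry and unit diagonal cut out the affine space through the identity with direction
  \<open>Hol\<close>, and positivity is an open condition.\<close>

lemma affine_domain_Cor_plus: "affine_domain (Cor_plus :: 'n::{finite,linorder} sqmat set) Hol"
proof -
  have "(Cor_plus :: 'n sqmat set) = (\<lambda>v. mat 1 + v) ` Hol \<inter> Collect pos_def"
  proof (intro set_eqI iffI)
    fix C :: "'n sqmat" assume C: "C \<in> Cor_plus"
    then have "C - mat 1 \<in> Hol"
      by (auto simp: Cor_plus_def Hol_def vec_eq_iff transpose_def mat_def)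
    then show "C \<in> (\<lambda>v. mat 1 + v) ` Hol \<inter> Collect pos_def"
      using C by (auto simp: Cor_plus_def pos_def_def intro!: image_eqI[where x="C - mat 1"])
  next
    fix C :: "'n sqmat" assume "C \<in> (\<lambda>v. mat 1 + v) ` Hol \<inter> Collect pos_def"
    then show "C \<in> Cor_plus"
      by (auto simp: Cor_plus_def Hol_def pos_def_def vec_eq_iff transpose_def mat_def)
  qed
  then show ?thesis
    unfolding affine_domain_def openin_open using subspace_Hol open_pos_def by blast
qed

lemma Ck_on_Chol: "Ck_on k Cor_plus Hol (\<lambda>C. Chol C $ i $ j)"
proof -
  note M = affine_domain_Cor_plus
  \<comment> \<open>All rows together: the sum in column \<open>j\<close> involves rows
    \<open>i\<close> and \<open>j\<close> of the earlier columns.\<close>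
  have "\<forall>i. Ck_on k Cor_plus Hol (\<lambda>C. Chol C $ i $ j)"
  proof (induction j rule: linorder_finite_induct)
    case (1 j)
    have s: "Ck_on k Cor_plus Hol (\<lambda>C. C $ i $ j - (\<Sum>l<j. Chol C $ i $ l * Chol C $ j $ l))" for i
      using 1 by (intro Ck_on_diff[OF M] Ck_on_sum[OF M] Ck_on_mult[OF M] Ck_on_entry[OF M]) auto
    have "Ck_on k Cor_plus Hol (\<lambda>C. sqrt (C $ j $ j - (\<Sum>l<j. Chol C $ j $ l * Chol C $ j $ l)))"
      by (rule Ck_on_sqrt[OF M _ s]) (rule Cholesky_diag(2)[OF Chol])
    then have d: "Ck_on k Cor_plus Hol (\<lambda>C. Chol C $ j $ j)"
      using Cholesky_diag(1)[OF Chol] by (subst Ck_on_cong) auto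
    have nz: "Chol C $ j $ j \<noteq> 0" if "C \<in> Cor_plus" for C
      using Chol(1)[OF that] by (metis lower_pos_def less_irrefl)
    have "Ck_on k Cor_plus Hol (\<lambda>C. (C $ i $ j - (\<Sum>l<j. Chol C $ i $ l * Chol C $ j $ l)) * inverse (Chol C $ j $ j))" for i
      by (intro Ck_on_mult[OF M] s Ck_on_inverse[OF M _ d] nz)
    then have "Ck_on k Cor_plus Hol (\<lambda>C. Chol C $ i $ j)" for i
      by (rule Ck_on_cong[THEN iffD1, rotated]) (rule Cholesky_below[OF Chol, symmetric])
    then show ?case by blast
  qed
  then show ?thesis by blast
qed

lemma smooth_on_Theta: "smooth_on Cor_plus Hol Theta"
  unfolding smooth_on_def
proof (intro allI Ck_on_matrix affine_domain_Cor_plus)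
  fix k i j
  have nz: "Chol C $ i $ i \<noteq> 0" if "C \<in> Cor_plus" for C
    using Chol(1)[OF that] by (metis lower_pos_def less_irrefl)
  have "Ck_on k Cor_plus Hol (\<lambda>C. Chol C $ i $ j * inverse (Chol C $ i $ i))"
    by (intro Ck_on_mult affine_domain_Cor_plus Ck_on_Chol Ck_on_inverse nz)
  then show "Ck_on k Cor_plus Hol (\<lambda>C. Theta C $ i $ j)"
    using Theta_component[OF Chol(1)] by (subst Ck_on_cong) auto
qed

lemma smooth_on_normalize_gram:
  "smooth_on (LT1 :: 'n::{finite,linorder} sqmat set) LT0 normalize_gram"
  unfolding smooth_on_def
proof (intro allI Ck_on_matrix affine_domain_LT1)
  note M = affine_domain_LT1
  fix k and i j :: 'n
  have P: "Ck_on k LT1 LT0 (\<lambda>Z :: 'n sqmat. (Z ** transpose Z) $ i $ j)" for i j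
    unfolding matrix_mult_transpose_component
    by (intro Ck_on_sum[OF M] Ck_on_mult[OF M] Ck_on_entry[OF M])
  have pos: "0 < (Z ** transpose Z) $ i $ i" if "Z \<in> LT1" for Z :: "'n sqmat" and i
    using gram_diag_ge_1[OF that, of i] by linarith
  then have nz: "sqrt ((Z ** transpose Z) $ i $ i) \<noteq> 0" if "Z \<in> LT1" for Z :: "'n sqmat" and i
    using that by (metis less_irrefl real_sqrt_eq_0_iff)
  have "Ck_on k LT1 LT0 (\<lambda>Z :: 'n sqmat. inverse (sqrt ((Z ** transpose Z) $ i $ i)))" for i
    by (rule Ck_on_inverse[OF M nz Ck_on_sqrt[OF M pos P]])
  then show "Ck_on k LT1 LT0 (\<lambda>Z. normalize_gram Z $ i $ j)"
    unfolding normalize_gram_def vec_lambda_beta by (intro Ck_on_mult[OF M] P)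
qed

section \<open>The log-Euclidean-Cholesky metric\<close>

lemma flat_chart_log_Theta:
  assumes "inner_product_on LT0 ip"
  shows "flat_chart Cor_plus Hol LT0 (mlog \<circ> Theta) (Theta_inv \<circ> mexp) ip"
proof
  show "affine_domain Cor_plus Hol" by (rule affine_domain_Cor_plus)
  show "subspace LT0" by (rule subspace_LT0)
  show "(mlog \<circ> Theta) C \<in> LT0" if "C \<in> Cor_plus" for C
    using that by (simp add: mlog_in_LT0 Theta_in_LT1)
  show "(Theta_inv \<circ> mexp) A \<in> Cor_plus" if "A \<in> LT0" for A
    using that by (simp add: Theta_inv_eq mexp_in_LT1 normalize_gram)
  show "(Theta_inv \<circ> mexp) ((mlog \<circ> Theta) C) = C" if "C \<in> Cor_plus" for C
    using that by (simp add: mexp_mlog Theta_in_LT1 Theta_inv_eq normalize_gram_Theta)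
  show "(mlog \<circ> Theta) ((Theta_inv \<circ> mexp) A) = A" if "A \<in> LT0" for A
    using that by (simp add: Theta_inv_eq mexp_in_LT1 normalize_gram mlog_mexp)
  show "smooth_on Cor_plus Hol (mlog \<circ> Theta)"
    using Ck_on_compose[OF affine_domain_Cor_plus affine_domain_LT1, of Theta _ mlog]
      smooth_on_Theta smooth_on_mlog Theta_in_LT1
    by (auto simp: smooth_on_def o_def)
  have "smooth_on LT0 LT0 (normalize_gram \<circ> mexp)"
    using Ck_on_compose[OF affine_domain_LT0 affine_domain_LT1, of mexp _ normalize_gram]
      smooth_on_mexp smooth_on_normalize_gram mexp_in_LT1
    by (auto simp: smooth_on_def o_def)
  \<comment> \<open>\<open>Theta_inv\<close> has been identified with \<open>normalize_gram\<close>
    on \<open>LT1\<close>, which is where \<open>mexp\<close> lands.\<close>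
  then show "smooth_on LT0 LT0 (Theta_inv \<circ> mexp)"
    unfolding smooth_on_def
    by (subst Ck_on_cong[where g="normalize_gram \<circ> mexp"]) (simp_all add: Theta_inv_eq mexp_in_LT1)
qed (rule assms)

lemma d_log_Theta_chain:
  assumes C: "C \<in> Cor_plus" and X: "X \<in> Hol"
  shows "d_log_Theta C X = d_mlog (Theta C) (d_Theta C X)"
proof -
  note M = affine_domain_Cor_plus and N = affine_domain_LT1
  have im: "Theta ` Cor_plus \<subseteq> LT1" using Theta_in_LT1 by blast
  have "((\<lambda>p. mlog (Theta p)) has_derivative
      (\<lambda>v. dder LT1 LT0 mlog (Theta C) (dder Cor_plus Hol Theta C v))) (at C within Cor_plus)"
    by (rule has_derivative_compose_on[OF smooth_on_has_derivative[OF M smooth_on_Theta C]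
          smooth_on_has_derivative[OF N smooth_on_mlog Theta_in_LT1[OF C]] im])
  from frechet_derivative_eq_on[OF M C this X]
  have "d_log_Theta C X = dder LT1 LT0 mlog (Theta C) (dder Cor_plus Hol Theta C X)"
    by (simp add: d_log_Theta_def o_def)
  \<comment> \<open>The value of \<open>d_mlog\<close> is determined on \<open>LT0\<close> only; the
    derivative of \<open>Theta\<close> lies there because \<open>Theta\<close> maps into
    \<open>LT1\<close>.\<close>
  also have "\<dots> = d_mlog (Theta C) (dder Cor_plus Hol Theta C X)"
    unfolding d_mlog_def by (rule dder_on[OF N dder_in[OF M N im smooth_on_Theta C]])
  also have "dder Cor_plus Hol Theta C X = d_Theta C X"
    unfolding d_Theta_def by (rule dder_on[OF M X])
  finally show ?thesis .
qed

theorem theorem4p7: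
  fixes ip :: "'n::{finite,linorder} sqmat \<Rightarrow> 'n sqmat \<Rightarrow> real"
    and nrm :: "'n sqmat \<Rightarrow> real"
  assumes ip: "inner_product_on LT0 ip"
    and nrm: "\<And>\<xi>. \<xi> \<in> LT0 \<Longrightarrow> nrm \<xi> = sqrt (ip \<xi> \<xi>)"
  shows "riemannian_metric Cor_plus Hol (lec_metric ip)
    \<and> is_levi_civita Cor_plus Hol (lec_metric ip) (levi_civita Cor_plus Hol (lec_metric ip))
    \<and> (\<forall>C\<in>Cor_plus. \<forall>X\<in>Hol. \<forall>t::real.
         riem_exp Cor_plus Hol (lec_metric ip) C (t *\<^sub>R X)
           = (Theta_inv \<circ> mexp) (mlog (Theta C) + t *\<^sub>R d_log_Theta C X))
    \<and> (\<forall>C\<in>Cor_plus. \<forall>C'\<in>Cor_plus.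
         riem_log Cor_plus Hol (lec_metric ip) C C'
           = d_log_Theta_inv C (mlog (Theta C') - mlog (Theta C)))
    \<and> (\<forall>C\<in>Cor_plus. \<forall>C'\<in>Cor_plus. \<forall>I \<gamma>. is_interval I \<longrightarrow> 0 \<in> I \<longrightarrow> 1 \<in> I \<longrightarrow>
         (geodesic_on Cor_plus Hol (lec_metric ip) I \<gamma> \<and> \<gamma> 0 = C \<and> \<gamma> 1 = C')
           = (\<forall>t\<in>I. \<gamma> t = (Theta_inv \<circ> mexp) ((1 - t) *\<^sub>R mlog (Theta C) + t *\<^sub>R mlog (Theta C'))))
    \<and> (\<forall>C\<in>Cor_plus. \<forall>C'\<in>Cor_plus.
         riem_dist Cor_plus (lec_metric ip) C C' = nrm (mlog (Theta C') - mlog (Theta C)))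
    \<and> (\<forall>C\<in>Cor_plus. \<forall>C'\<in>Cor_plus. \<forall>X\<in>Hol.
         parallel_transport Cor_plus Hol (lec_metric ip) C C' X
           = d_log_Theta_inv C' (d_log_Theta C X))
    \<and> (\<forall>X Y Z. vector_field Cor_plus Hol X \<longrightarrow> vector_field Cor_plus Hol Y \<longrightarrow>
         vector_field Cor_plus Hol Z \<longrightarrow>
         (\<forall>C\<in>Cor_plus. curvature Cor_plus Hol (lec_metric ip) X Y Z C = 0))
    \<and> (\<forall>k\<ge>1. \<forall>Cs. (\<forall>i\<in>{1..k}. Cs i \<in> Cor_plus) \<longrightarrow>
         frechet_means Cor_plus (lec_metric ip) k Cs
           = {(Theta_inv \<circ> mexp) ((1 / real k) *\<^sub>R (\<Sum>i=1..k. mlog (Theta (Cs i))))})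
    \<and> (\<forall>C\<in>Cor_plus. \<forall>X\<in>(Hol :: ('n sqmat) set). d_log_Theta C X = d_mlog (Theta C) (d_Theta C X))
    \<and> geodesically_complete Cor_plus Hol (lec_metric ip)"
proof -
  interpret flat_chart Cor_plus Hol LT0 "mlog \<circ> Theta" "Theta_inv \<circ> mexp" ip
    by (rule flat_chart_log_Theta[OF ip])
  have metric: "lec_metric ip = g"
    by (simp add: fun_eq_iff lec_metric_def d_log_Theta_def g_def)
  \<comment> \<open>\<open>d_log_Theta\<close> is the unprojected derivative, which agrees with
    \<open>dF\<close> on \<open>Hol\<close>.\<close>
  have d: "d_log_Theta C X = dF C X" if "X \<in> Hol" for C X
    using that by (simp add: d_log_Theta_def dder_on[OF affine_domain_Cor_plus])
  have d_inv: "d_log_Theta_inv C y = dG (mlog (Theta C)) y" if "C \<in> Cor_plus" "y \<in> LT0" for C y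
    using the_inv_into_frechet[OF that] by (simp add: d_log_Theta_inv_def d_log_Theta_def)
  have diff: "mlog (Theta C') - mlog (Theta C) \<in> LT0" if "C \<in> Cor_plus" "C' \<in> Cor_plus" for C C'
    using that by (intro subspace_diff[OF subspace_LT0] mlog_in_LT0 Theta_in_LT1)
  show ?thesis
    unfolding metric
  proof (intro conjI ballI allI impI)
    show "riemannian_metric Cor_plus Hol g" by (rule riemannian)
    show "is_levi_civita Cor_plus Hol g (levi_civita Cor_plus Hol g)" by (rule is_levi_civita_levi_civita)
    show "geodesically_complete Cor_plus Hol g" by (rule geodesically_complete)
  next
    fix C X :: "'n sqmat" and t :: real assume C: "C \<in> Cor_plus" and X: "X \<in> Hol"
    then show "riem_exp Cor_plus Hol g C (t *\<^sub>R X)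
        = (Theta_inv \<circ> mexp) (mlog (Theta C) + t *\<^sub>R d_log_Theta C X)"
      using riem_exp_eq[OF C subspace_scale[OF V X]] linear_cmul[OF linear_dF[OF C]] by (simp add: d)
  next
    fix C C' :: "'n sqmat" assume "C \<in> Cor_plus" "C' \<in> Cor_plus"
    then show "riem_log Cor_plus Hol g C C' = d_log_Theta_inv C (mlog (Theta C') - mlog (Theta C))"
      by (simp add: riem_log_eq d_inv diff)
  next
    fix C C' :: "'n sqmat" and I :: "real set" and \<gamma>
    assume "C \<in> Cor_plus" "C' \<in> Cor_plus" "is_interval I" "0 \<in> I" "1 \<in> I"
    from geodesic_between_iff[OF this, of \<gamma>]
    show "(geodesic_on Cor_plus Hol g I \<gamma> \<and> \<gamma> 0 = C \<and> \<gamma> 1 = C') =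
        (\<forall>t\<in>I. \<gamma> t = (Theta_inv \<circ> mexp) ((1 - t) *\<^sub>R mlog (Theta C) + t *\<^sub>R mlog (Theta C')))"
      by (simp only: o_apply)
  next
    fix C C' :: "'n sqmat" assume "C \<in> Cor_plus" "C' \<in> Cor_plus"
    then show "riem_dist Cor_plus g C C' = nrm (mlog (Theta C') - mlog (Theta C))"
      by (simp add: riem_dist_eq nrm diff ipe_eq)
  next
    fix C C' X :: "'n sqmat" assume "C \<in> Cor_plus" "C' \<in> Cor_plus" "X \<in> Hol"
    then show "parallel_transport Cor_plus Hol g C C' X = d_log_Theta_inv C' (d_log_Theta C X)"
      by (simp add: parallel_transport_eq d d_inv dF_in)
  next
    fix X Y Z :: "'n sqmat \<Rightarrow> 'n sqmat" and C :: "'n sqmat"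
    assume "vector_field Cor_plus Hol X" "vector_field Cor_plus Hol Y" "vector_field Cor_plus Hol Z" "C \<in> Cor_plus"
    then show "curvature Cor_plus Hol g X Y Z C = 0" by (rule curvature_zero)
  next
    fix k :: nat and Cs :: "nat \<Rightarrow> 'n sqmat" assume "1 \<le> k" "\<forall>i\<in>{1..k}. Cs i \<in> Cor_plus"
    then show "frechet_means Cor_plus g k Cs
        = {(Theta_inv \<circ> mexp) ((1 / real k) *\<^sub>R (\<Sum>i=1..k. mlog (Theta (Cs i))))}"
      using frechet_means_eq[of k Cs] by simp
  next
    fix C X :: "'n sqmat" assume "C \<in> Cor_plus" "X \<in> Hol"
    then show "d_log_Theta C X = d_mlog (Theta C) (d_Theta C X)" by (rule d_log_Theta_chain)
  qed
qed

end
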